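(* Let $p\in(0,1)$. Let $q_k^\nu(t)=\Pr\{M_\nu(t)=k\}$ for $\nu\in(0,1)$ and $\overline{q}_k^\nu(t)=\Pr\{\overline{M}_\nu(t)=k\}$ for $\nu>1$, where $M_\nu(t)=N_1(\Gamma_\nu(t))$ and $\overline{M}_\nu(t)=N_1(\overline{\Gamma}_\nu(t))$ are the fractional Negative Binomial processes. Then $$\mathcal{O}^\nu_{-1,t}q_k^\nu=\frac1p q_k^\nu-\frac{1-p}{p}q_{k-1}^\nu,\qquad k\ge0,\ t>1,\ \nu\in(0,1),$$ and $$\overline{\mathcal{O}}^\nu_{-1,t}\overline{q}_k^\nu=\frac1p \overline{q}_k^\nu-\frac{1-p}{p}\overline{q}_{k-1}^\nu,\qquad k\ge0,\ t>1,\ \nu>1.$$ The initial conditions for both equations are $q_0(0)=1$, $q_k(0)=0$ for any integer $k>0$, and $q_{-1}(t)=0$ for any $t$, where $q:=q^\nu$ for $\nu<1$ and $q:=\overline{q}^\nu$ for $\nu>1$.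
   Context: $N_1$ is a homogeneous Poisson process of intensity $1$. $\Gamma(t)$, $t\ge0$, is the Gamma subordinator with parameter $b=p/(1-p)$, with density $f_\Gamma(x,t)=\frac{b^t}{\Gamma(t)}x^{t-1}e^{-bx}$, $x\ge0$. $\mathcal{A}_\alpha$ ($0<\alpha<1$) is the stable subordinator with $\mathbb{E}e^{-k\mathcal{A}_\alpha(t)}=e^{-k^\alpha t}$, $k>0$, and $\mathcal{L}_\nu(t):=\inf\{z\ge0:\mathcal{A}_\nu(z)>t\}$. The fractional Gamma processes are $\Gamma_\nu(t)=\Gamma(\mathcal{L}_\nu(t))$ for $\nu\in(0,1)$ and $\overline{\Gamma}_\nu(t)=\Gamma(\mathcal{A}_{1/\nu}(t))$ for $\nu>1$; all component processes are independent. Caputo derivative ($0<\nu<1$): $D_t^\nu u(t)=\frac{1}{\Gamma(1-\nu)}\int_0^t (t-s)^{-\nu}u'(s)\,ds$. Right-sided Riemann–Liouville derivative ($m-1<\nu<m$): $\mathcal{D}^\nu_{-,t}u(t)=\frac{1}{\Gamma(m-\nu)}\left(-\frac{d}{dt}\right)^m\int_t^{+\infty}\frac{u(s)}{(s-t)^{1+\nu-m}}\,ds$, and $\mathcal{D}^n_{-,t}=(-1)^n d^n/dt^n$ for $n\in\mathbb{N}$. Fractional shift operators (provided the series converge): $\mathcal{O}^\nu_{c,t}f:=\sum_{n\ge0}\frac{c^n}{n!}\underbrace{D_t^\nu\cdots D_t^\nu}_{n\text{ times}}f$ for $\nu\le1$ and $\overline{\mathcal{O}}^\nu_{c,t}f:=\sum_{n\ge0}\frac{(-c)^n}{n!}\underbrace{\mathcal{D}_{-,t}^\nu\cdots\mathcal{D}_{-,t}^\nu}_{n\text{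 times}}f$ for $\nu\ge1$. *)

theory Defs
  imports "HOL-Probability.Probability"
begin

text \<open>
  Processes are functions of time and outcome, and only times \<open>t \<ge> 0\<close> matter. A subordinator is a
  nondecreasing Levy process; as usual one works with a version all of whose paths are nondecreasing,
  right-continuous and start at \<open>0\<close>.
\<close>

definition indep_increments :: "'a measure \<Rightarrow> (real \<Rightarrow> 'a \<Rightarrow> real) \<Rightarrow> bool" where
  "indep_increments M X \<longleftrightarrow>
     (\<forall>n (\<tau>::nat \<Rightarrow> real). 0 \<le> \<tau> 0 \<longrightarrow> mono \<tau> \<longrightarrow>
        prob_space.indep_vars M (\<lambda>_. borel) (\<lambda>i \<omega>. X (\<tau> (Suc i)) \<omega> - X (\<tau> i) \<omega>) {..<n})"

definition stationary_increments :: "'a measure \<Rightarrow> (real \<Rightarrow> 'a \<Rightarrow> real) \<Rightarrow> bool" where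
  "stationary_increments M X \<longleftrightarrow>
     (\<forall>s\<ge>0. \<forall>h\<ge>0. distr M borel (\<lambda>\<omega>. X (s + h) \<omega> - X s \<omega>) = distr M borel (X h))"

definition subordinator :: "'a measure \<Rightarrow> (real \<Rightarrow> 'a \<Rightarrow> real) \<Rightarrow> bool" where
  "subordinator M X \<longleftrightarrow>
     (\<forall>t\<ge>0. X t \<in> borel_measurable M) \<and>
     (\<forall>\<omega>\<in>space M. X 0 \<omega> = 0 \<and> mono_on {0..} (\<lambda>t. X t \<omega>) \<and>
        (\<forall>t\<ge>0. continuous (at_right t) (\<lambda>t. X t \<omega>))) \<and>
     indep_increments M X \<and> stationary_increments M X"

definition poisson_process :: "'a measure \<Rightarrow> real \<Rightarrow> (real \<Rightarrow> 'a \<Rightarrow> nat) \<Rightarrow> bool" where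
  "poisson_process M r N \<longleftrightarrow>
     subordinator M (\<lambda>t \<omega>. real (N t \<omega>)) \<and>
     (\<forall>t>0. distr M (count_space UNIV) (N t) = measure_pmf (poisson_pmf (r * t)))"

definition gamma_density :: "real \<Rightarrow> real \<Rightarrow> real \<Rightarrow> real" where
  "gamma_density b t x =
     (if x \<ge> 0 then b powr t / Gamma t * x powr (t - 1) * exp (- b * x) else 0)"

definition gamma_subordinator :: "'a measure \<Rightarrow> real \<Rightarrow> (real \<Rightarrow> 'a \<Rightarrow> real) \<Rightarrow> bool" where
  "gamma_subordinator M b G \<longleftrightarrow>
     subordinator M G \<and> (\<forall>t>0. distributed M lborel (G t) (\<lambda>x. ennreal (gamma_density b t x)))"

definition stable_subordinator :: "'a measure \<Rightarrow> real \<Rightarrow> (real \<Rightarrow> 'a \<Rightarrow> real) \<Rightarrow> bool" where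
  "stable_subordinator M \<alpha> A \<longleftrightarrow>
     subordinator M A \<and>
     (\<forall>t\<ge>0. \<forall>k>0. prob_space.expectation M (\<lambda>\<omega>. exp (- k * A t \<omega>)) = exp (- (k powr \<alpha>) * t))"

text \<open>
  The set below is nonempty almost surely for a stable subordinator. On the exceptional null event
  the infimum of the empty set would be an unspecified real number, so the value \<open>0\<close> is used.
\<close>

definition inverse_process :: "(real \<Rightarrow> 'a \<Rightarrow> real) \<Rightarrow> real \<Rightarrow> 'a \<Rightarrow> real" where
  "inverse_process A t \<omega> =
     (if {z. 0 \<le> z \<and> A z \<omega> > t} = {} then 0 else Inf {z. 0 \<le> z \<and> A z \<omega> > t})"

text \<open>Mutual independence of whole processes, as random elements of the product space.\<close>

definition indep_processes :: "'a measure \<Rightarrow> (real \<Rightarrow> 'a \<Rightarrow> real) list \<Rightarrow> bool" where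
  "indep_processes M Xs \<longleftrightarrow>
     prob_space.indep_vars M (\<lambda>_. Pi\<^sub>M {0..} (\<lambda>_. borel))
       (\<lambda>i \<omega>. \<lambda>t\<in>{0..}. (Xs ! i) t \<omega>) {..<length Xs}"

definition frac_gamma :: "(real \<Rightarrow> 'a \<Rightarrow> real) \<Rightarrow> (real \<Rightarrow> 'a \<Rightarrow> real) \<Rightarrow> real \<Rightarrow> 'a \<Rightarrow> real" where
  "frac_gamma G A t \<omega> = G (inverse_process A t \<omega>) \<omega>"

definition frac_gamma_bar :: "(real \<Rightarrow> 'a \<Rightarrow> real) \<Rightarrow> (real \<Rightarrow> 'a \<Rightarrow> real) \<Rightarrow> real \<Rightarrow> 'a \<Rightarrow> real" where
  "frac_gamma_bar G A t \<omega> = G (A t \<omega>) \<omega>"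

definition frac_nb :: "(real \<Rightarrow> 'a \<Rightarrow> nat) \<Rightarrow> (real \<Rightarrow> 'a \<Rightarrow> real) \<Rightarrow> (real \<Rightarrow> 'a \<Rightarrow> real)
    \<Rightarrow> real \<Rightarrow> 'a \<Rightarrow> nat" where
  "frac_nb N G A t \<omega> = N (frac_gamma G A t \<omega>) \<omega>"

definition frac_nb_bar :: "(real \<Rightarrow> 'a \<Rightarrow> nat) \<Rightarrow> (real \<Rightarrow> 'a \<Rightarrow> real) \<Rightarrow> (real \<Rightarrow> 'a \<Rightarrow> real)
    \<Rightarrow> real \<Rightarrow> 'a \<Rightarrow> nat" where
  "frac_nb_bar N G A t \<omega> = N (frac_gamma_bar G A t \<omega>) \<omega>"

text \<open>The state is an integer, so that the index \<open>k - 1\<close> makes sense for \<open>k = 0\<close>.\<close>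

definition state_prob :: "'a measure \<Rightarrow> (real \<Rightarrow> 'a \<Rightarrow> nat) \<Rightarrow> int \<Rightarrow> real \<Rightarrow> real" where
  "state_prob M X k t = measure M {\<omega> \<in> space M. int (X t \<omega>) = k}"

text \<open>
  Both derivatives act on functions on the open half-line \<open>t > 0\<close>. As \<open>deriv\<close> and the Lebesgue
  integral are total, each operator comes with a predicate stating that all derivatives and
  integrals in its definition exist.
\<close>

definition caputo_kernel :: "real \<Rightarrow> (real \<Rightarrow> real) \<Rightarrow> real \<Rightarrow> real \<Rightarrow> real" where
  "caputo_kernel \<nu> u t s = (t - s) powr (- \<nu>) * deriv u s"

text \<open>For \<open>0 < \<nu> < 1\<close>.\<close>

definition caputo :: "real \<Rightarrow> (real \<Rightarrow> real) \<Rightarrow> real \<Rightarrow> real" where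
  "caputo \<nu> u t = 1 / Gamma (1 - \<nu>) * (LINT s:{0<..<t}|lborel. caputo_kernel \<nu> u t s)"

definition caputo_exists :: "real \<Rightarrow> (real \<Rightarrow> real) \<Rightarrow> bool" where
  "caputo_exists \<nu> u \<longleftrightarrow>
     (\<forall>t>0. u differentiable (at t) \<and> set_integrable lborel {0<..<t} (caputo_kernel \<nu> u t))"

definition iter_differentiable :: "nat \<Rightarrow> (real \<Rightarrow> real) \<Rightarrow> bool" where
  "iter_differentiable m f \<longleftrightarrow> (\<forall>j<m. \<forall>t>0. (deriv ^^ j) f differentiable (at t))"

definition rl_order :: "real \<Rightarrow> nat" where
  "rl_order \<nu> = nat \<lceil>\<nu>\<rceil>"

definition rl_kernel :: "real \<Rightarrow> (real \<Rightarrow> real) \<Rightarrow> real \<Rightarrow> real \<Rightarrow> real" where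
  "rl_kernel \<nu> u t s = u s / (s - t) powr (1 + \<nu> - real (rl_order \<nu>))"

definition rl_integral :: "real \<Rightarrow> (real \<Rightarrow> real) \<Rightarrow> real \<Rightarrow> real" where
  "rl_integral \<nu> u t = (LINT s:{t<..}|lborel. rl_kernel \<nu> u t s)"

text \<open>
  For noninteger \<open>\<nu> > 0\<close>, \<open>m = rl_order \<nu>\<close> is the natural number with \<open>m - 1 < \<nu> < m\<close>; for
  \<open>\<nu>\<close> a natural number, \<open>m = \<nu>\<close>.
\<close>

definition right_rl :: "real \<Rightarrow> (real \<Rightarrow> real) \<Rightarrow> real \<Rightarrow> real" where
  "right_rl \<nu> u t =
     (let m = rl_order \<nu> in
      if \<nu> \<in> \<nat> then (-1) ^ m * (deriv ^^ m) u t
      else 1 / Gamma (real m - \<nu>) * ((-1) ^ m * (deriv ^^ m) (rl_integral \<nu> u) t))"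

definition right_rl_exists :: "real \<Rightarrow> (real \<Rightarrow> real) \<Rightarrow> bool" where
  "right_rl_exists \<nu> u \<longleftrightarrow>
     (if \<nu> \<in> \<nat> then iter_differentiable (rl_order \<nu>) u
      else (\<forall>t>0. set_integrable lborel {t<..} (rl_kernel \<nu> u t)) \<and>
           iter_differentiable (rl_order \<nu>) (rl_integral \<nu> u))"

definition shift_op :: "real \<Rightarrow> real \<Rightarrow> (real \<Rightarrow> real) \<Rightarrow> real \<Rightarrow> real" where
  "shift_op \<nu> c f t = (\<Sum>n. c ^ n / fact n * (caputo \<nu> ^^ n) f t)"

definition shift_op_defined :: "real \<Rightarrow> real \<Rightarrow> (real \<Rightarrow> real) \<Rightarrow> real \<Rightarrow> bool" where
  "shift_op_defined \<nu> c f t \<longleftrightarrow>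
     (\<forall>n. caputo_exists \<nu> ((caputo \<nu> ^^ n) f)) \<and>
     summable (\<lambda>n. c ^ n / fact n * (caputo \<nu> ^^ n) f t)"

definition shift_op_bar :: "real \<Rightarrow> real \<Rightarrow> (real \<Rightarrow> real) \<Rightarrow> real \<Rightarrow> real" where
  "shift_op_bar \<nu> c f t = (\<Sum>n. (- c) ^ n / fact n * (right_rl \<nu> ^^ n) f t)"

definition shift_op_bar_defined :: "real \<Rightarrow> real \<Rightarrow> (real \<Rightarrow> real) \<Rightarrow> real \<Rightarrow> bool" where
  "shift_op_bar_defined \<nu> c f t \<longleftrightarrow>
     (\<forall>n. right_rl_exists \<nu> ((right_rl \<nu> ^^ n) f)) \<and>
     summable (\<lambda>n. (- c) ^ n / fact n * (right_rl \<nu> ^^ n) f t)"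

end

theory Submission
  imports Defs "HOL-Real_Asymp.Real_Asymp"
begin

text \<open>
  Put \<open>\<lambda> = ln (1/p)\<close> and let \<open>S\<close> be the random clock: \<open>S(t) = \<L>\<^sub>\<nu>(t)\<close> for \<open>\<nu> < 1\<close> and
  \<open>S(t) = \<A>(t)\<close>, stable of index \<open>1/\<nu>\<close>, for \<open>\<nu> > 1\<close>. At a fixed operational time \<open>s\<close> the process
  \<open>N(\<Gamma>(s))\<close> is negative binomial, \<open>Pr = P\<^sub>k(s) exp (- \<lambda> s)\<close> with the polynomial
  \<open>P\<^sub>k(s) = (1-p)\<^sup>k s(s+1)\<dots>(s+k-1) / k!\<close>; hence \<open>q\<^sub>k(t) = E[P\<^sub>k(S(t)) exp (- \<lambda> S(t))]\<close>
  (\<open>negative_binomial_at_random_time\<close>).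

  Write \<open>F(P)(t) = E[P(S(t)) exp (- \<lambda> S(t))]\<close> for a real polynomial \<open>P\<close> and \<open>T P = \<lambda> P - P'\<close>, so
  that \<open>d/ds (P(s) exp (- \<lambda> s)) = - (T P)(s) exp (- \<lambda> s)\<close>. The key fact is that a fractional
  derivative in \<open>t\<close> acts on \<open>F(P)\<close> as an ordinary derivative in the operational time \<open>s\<close>:
  \<open>D\<^sup>\<nu> F(P) = - F(T P)\<close> for the Caputo derivative and \<open>\<D>\<^sup>\<nu> F(P) = F(T P)\<close> for the right-sided
  Riemann-Liouville derivative. With \<open>c = -1\<close> both shift operators therefore become
  \<open>F(P) \<mapsto> \<Sum>n. F(T\<^sup>n P) / n!\<close>, and \<open>\<Sum>n. T\<^sup>n / n! = exp (\<lambda> - d/ds)\<close> is \<open>exp \<lambda> = 1/p\<close> times the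
  translation \<open>P(s) \<mapsto> P(s - 1)\<close> (\<open>tilt_exp_shift\<close>). Pascal's rule
  \<open>P\<^sub>k(s - 1) = P\<^sub>k(s) - (1-p) P\<^sub>k\<^sub>-\<^sub>1(s)\<close> (\<open>nb_poly_shift\<close>) turns this into the claimed equation.

  For \<open>\<nu> < 1\<close> the key fact rests on the moments \<open>E[\<L>\<^sub>\<nu>(t)\<^sup>n] = n! t\<^sup>\<nu>\<^sup>n / \<Gamma>(\<nu> n + 1)\<close>
  (\<open>inverse_stable_moment\<close>). Expanding \<open>P(s) exp (- \<lambda> s)\<close> in powers of \<open>s\<close> gives
  \<open>F(P)(t) = \<Sum>n. b\<^sub>n t\<^sup>\<nu>\<^sup>n / \<Gamma>(\<nu> n + 1)\<close>, where \<open>b\<^sub>n\<close> is the \<open>n\<close>-th derivative of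
  \<open>P(s) exp (- \<lambda> s)\<close> at \<open>0\<close>, and the Beta integral shows that the Caputo derivative shifts
  the sequence \<open>b\<close> by one place (\<open>caputo_frac_series\<close>). The moments come from
  \<open>{\<L>\<^sub>\<nu>(t) > z} \<approx> {\<A>\<^sub>\<nu>(z) \<le> t}\<close> and self-similarity, \<open>\<A>\<^sub>\<nu>(z)\<close> having the law of \<open>z\<^sup>1\<^sup>/\<^sup>\<nu> \<A>\<^sub>\<nu>(1)\<close>:
  together they make \<open>\<L>\<^sub>\<nu>(t)\<close> distributed as \<open>(t / \<A>\<^sub>\<nu>(1))\<^sup>\<nu>\<close>, and negative moments of a positive
  variable are Mellin integrals of its Laplace transform.

  For \<open>\<nu> > 1\<close>, with \<open>\<alpha> = 1/\<nu>\<close>, one has \<open>E[\<A>(t)\<^sup>j exp (- l \<A>(t))] = (- d/dl)\<^sup>j exp (- l\<^sup>\<alpha> t)\<close>. On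
  the functions \<open>(d/dl)\<^sup>j (l\<^sup>a exp (- l\<^sup>\<alpha> t))\<close> a time derivative raises \<open>a\<close> by \<open>\<alpha>\<close> (with a sign), a
  fractional integral of order \<open>\<beta>\<close> lowers \<open>a\<close> by \<open>\<alpha> \<beta>\<close>, and so \<open>\<D>\<^sup>\<nu>\<close> raises \<open>a\<close> by \<open>\<alpha> \<nu> = 1\<close>
  (\<open>right_rl_powexp_comb\<close>); multiplication by \<open>l\<close> under \<open>(- d/dl)\<^sup>j\<close> is the operator \<open>T\<close>.
\<close>

section \<open>Exponentially tilted polynomials\<close>


text \<open>
  Up to sign, differentiation of \<open>P(s) exp (- lam s)\<close> in \<open>s\<close>, read off on the polynomial \<open>P\<close>.
\<close>

definition tilt :: "real \<Rightarrow> real poly \<Rightarrow> real poly" where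
  "tilt lam P = smult lam P - pderiv P"

lemma tilt_0: "tilt lam 0 = 0" by (simp add: tilt_def)
lemma funpow_tilt_0: "(tilt lam ^^ n) 0 = 0" by (induction n) (auto simp: tilt_0)

text \<open>
  \<open>tilt lam\<close> and multiplication by the variable have commutator \<open>-1\<close>, like \<open>- d/ds\<close> and \<open>s\<close>.
  This rule is what makes induction over the coefficients of a polynomial work below.
\<close>

lemma funpow_tilt_mult_X:
  "(tilt lam ^^ n) (pCons 0 Q) = pCons 0 ((tilt lam ^^ n) Q) - smult (real n) ((tilt lam ^^ (n - 1)) Q)"
proof (induction n)
  case (Suc n)
  have sm: "tilt lam (smult c R) = smult c (tilt lam R)" for c R
    by (simp add: tilt_def pderiv_smult smult_diff_right algebra_simps)
  have di: "tilt lam (R - R') = tilt lam R - tilt lam R'" for R R'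
    by (simp add: tilt_def pderiv_diff smult_diff_right)
  have X: "tilt lam (pCons 0 R) = pCons 0 (tilt lam R) - R" for R
    by (simp add: tilt_def pderiv_pCons)
  have "(tilt lam ^^ Suc n) (pCons 0 Q) = tilt lam ((tilt lam ^^ n) (pCons 0 Q))" by simp
  also have "\<dots> = pCons 0 ((tilt lam ^^ Suc n) Q) - (tilt lam ^^ n) Q
      - smult (real n) (tilt lam ((tilt lam ^^ (n - 1)) Q))"
    by (simp only: Suc di sm X funpow.simps o_apply)
  also have "smult (real n) (tilt lam ((tilt lam ^^ (n - 1)) Q)) = smult (real n) ((tilt lam ^^ n) Q)"
    by (cases n) simp_all
  finally show ?case by (simp add: smult_add_left)
qed simp

lemma funpow_tilt_add: "(tilt lam ^^ n) (P + Q) = (tilt lam ^^ n) P + (tilt lam ^^ n) Q"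
  by (induction n) (auto simp: tilt_def pderiv_add smult_add_right)

lemma funpow_tilt_const: "(tilt lam ^^ n) [:a:] = [:a * lam ^ n:]"
  by (induction n) (auto simp: tilt_def pderiv_pCons)

text \<open>
  \<open>exp (c (lam - d/ds)) = exp (lam c) exp (- c d/ds)\<close>, and \<open>exp (- c d/ds)\<close> is Taylor's formula for
  translation by \<open>-c\<close>. Testing against an arbitrary linear functional replaces a topology on polynomials,
  and quantifying over all functionals lets the induction on \<open>P\<close> apply the hypothesis to
  \<open>\<lambda>Q. phi (s Q)\<close>. It is used with \<open>c = 1\<close> for the shift operators, and with \<open>c = - s\<close> and
  evaluation at \<open>0\<close> for the Taylor series of \<open>P(s) exp (- lam s)\<close>.
\<close>

lemma tilt_exp_shift:
  fixes phi :: "real poly \<Rightarrow> real"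
  assumes add: "\<And>P Q. phi (P + Q) = phi P + phi Q" and sm: "\<And>a P. phi (smult a P) = a * phi P"
  shows "(\<lambda>n. c ^ n / fact n * phi ((tilt lam ^^ n) P)) sums (exp (lam * c) * phi (pcompose P [:-c, 1:]))"
  using assms
proof (induction P arbitrary: phi)
  case 0
  have "phi 0 = 0" using 0(2)[of 0 0] by simp
  then show ?case by (simp add: funpow_tilt_0)
next
  case (pCons a Q)
  have diff: "phi (P - R) = phi P - phi R" for P R
    using pCons(3)[of "P - R" R] by simp
  have c0: "phi [:x:] = x * phi 1" for x
    using pCons(4)[of x 1] by simp
  have dec: "pCons a Q = [:a:] + pCons 0 Q" by simp
  have "(\<lambda>n. (lam * c) ^ n /\<^sub>R fact n) sums exp (lam * c)" by (rule exp_converges)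
  hence "(\<lambda>n. (lam * c) ^ n /\<^sub>R fact n * (a * phi 1)) sums (exp (lam * c) * (a * phi 1))"
    by (rule sums_mult2)
  hence s1: "(\<lambda>n. c ^ n / fact n * phi ((tilt lam ^^ n) [:a:])) sums (exp (lam * c) * (a * phi 1))"
    by (simp add: funpow_tilt_const c0[of "a * _"] power_mult_distrib field_simps)
  have s2: "(\<lambda>n. c ^ n / fact n * phi (pCons 0 ((tilt lam ^^ n) Q))) sums
     (exp (lam * c) * phi (pCons 0 (pcompose Q [:-c, 1:])))"
    using pCons(2)[of "\<lambda>P. phi (pCons 0 P)"] pCons(3)[of "pCons 0 _" "pCons 0 _"]
      pCons(4)[of _ "pCons 0 _"] by simp
  have "(\<lambda>n. c ^ Suc n / fact (Suc n) * (real (Suc n) * phi ((tilt lam ^^ n) Q))) sums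
     (c * (exp (lam * c) * phi (pcompose Q [:-c, 1:])))"
    using sums_mult[OF pCons(2)[of phi, OF pCons(3,4)], of c] by (simp add: field_simps del: of_nat_Suc)
  hence s3: "(\<lambda>n. c ^ n / fact n * (real n * phi ((tilt lam ^^ (n - 1)) Q))) sums
     (c * (exp (lam * c) * phi (pcompose Q [:-c, 1:])))"
    using sums_Suc_iff[of "\<lambda>n. c ^ n / fact n * (real n * phi ((tilt lam ^^ (n - 1)) Q))"] by simp
  have eq: "c ^ n / fact n * phi ((tilt lam ^^ n) (pCons a Q)) =
     c ^ n / fact n * phi ((tilt lam ^^ n) [:a:]) +
     (c ^ n / fact n * phi (pCons 0 ((tilt lam ^^ n) Q)) -
      c ^ n / fact n * (real n * phi ((tilt lam ^^ (n - 1)) Q)))" for n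
    unfolding dec funpow_tilt_add funpow_tilt_mult_X pCons(3) diff pCons(4)
    by (simp only: ring_distribs right_diff_distrib)
  have eq2: "phi (pcompose (pCons a Q) [:-c, 1:]) =
     a * phi 1 + (phi (pCons 0 (pcompose Q [:-c, 1:])) - c * phi (pcompose Q [:-c, 1:]))"
  proof -
    have "pcompose (pCons a Q) [:-c, 1:] =
       [:a:] + (pCons 0 (pcompose Q [:-c, 1:]) - smult c (pcompose Q [:-c, 1:]))"
      by (simp add: pcompose_pCons)
    thus ?thesis by (simp only: pCons(3) diff pCons(4) c0)
  qed
  show ?case
    unfolding eq eq2 distrib_left right_diff_distrib mult.left_commute[of "exp (lam * c)" c]
    by (intro sums_add sums_diff s1 s2 s3)
qed

text \<open>
  These numbers are the Taylor data at \<open>0\<close> of a polynomial times an exponential, an entire function of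
  exponential type; hence geometric growth.
\<close>

lemma tilt_coeff_bound:
  assumes "lam \<ge> 0"
  shows "\<exists>C R. 0 \<le> C \<and> 0 < R \<and> (\<forall>n. \<bar>poly ((tilt lam ^^ n) P) 0\<bar> \<le> C * R ^ n)"
proof (induction P)
  case 0
  then show ?case by (intro exI[of _ 0] exI[of _ 1]) (simp add: funpow_tilt_0)
next
  case (pCons a Q)
  then obtain C R where CR: "0 \<le> C" "0 < R" "\<And>n. \<bar>poly ((tilt lam ^^ n) Q) 0\<bar> \<le> C * R ^ n" by blast
  \<comment> \<open>The factor \<open>n\<close> from the commutator is absorbed by \<open>n \<le> 2^n\<close>.\<close>
  define R' where "R' = max (2 * max R 1) lam"
  have "\<bar>poly ((tilt lam ^^ n) (pCons a Q)) 0\<bar> \<le> (\<bar>a\<bar> + C) * R' ^ n" for n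
  proof -
    have dec: "pCons a Q = [:a:] + pCons 0 Q" by simp
    have eq: "poly ((tilt lam ^^ n) (pCons a Q)) 0 = a * lam ^ n - real n * poly ((tilt lam ^^ (n-1)) Q) 0"
      unfolding dec funpow_tilt_add funpow_tilt_mult_X funpow_tilt_const by simp
    have "\<bar>a * lam ^ n\<bar> \<le> \<bar>a\<bar> * R' ^ n"
      using assms by (auto simp: abs_mult R'_def intro!: mult_left_mono power_mono)
    moreover have "\<bar>real n * poly ((tilt lam ^^ (n-1)) Q) 0\<bar> \<le> C * R' ^ n"
    proof -
      have "\<bar>real n * poly ((tilt lam ^^ (n-1)) Q) 0\<bar> \<le> real n * (C * R ^ (n-1))"
        by (simp add: abs_mult mult_left_mono[OF CR(3)])
      also have "\<dots> \<le> 2 ^ n * (C * max R 1 ^ n)"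
      proof (intro mult_mono)
        have "R ^ (n-1) \<le> max R 1 ^ (n-1)" using CR by (intro power_mono) auto
        also have "\<dots> \<le> max R 1 ^ n" by (intro power_increasing) auto
        finally show "R ^ (n-1) \<le> max R 1 ^ n" .
        show "real n \<le> 2 ^ n" using of_nat_less_two_power[of n] by (simp add: less_imp_le)
      qed (use CR in auto)
      also have "\<dots> = C * (2 * max R 1) ^ n" by (simp add: power_mult_distrib)
      also have "\<dots> \<le> C * R' ^ n"
        using CR by (intro mult_left_mono power_mono) (auto simp: R'_def)
      finally show ?thesis .
    qed
    ultimately show ?thesis unfolding eq by (simp add: distrib_right abs_le_iff)
  qed
  moreover have "0 < R'" by (simp add: R'_def less_max_iff_disj)
  ultimately show ?case using CR(1) by (intro exI[of _ "\<bar>a\<bar> + C"] exI[of _ R']) auto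
qed

definition nb_poly :: "real \<Rightarrow> nat \<Rightarrow> real poly" where
  "nb_poly p k = smult ((1 - p) ^ k / fact k) (\<Prod>i<k. [:real i, 1:])"

lemma poly_nb_poly: "poly (nb_poly p k) s = (1 - p) ^ k * pochhammer s k / fact k"
  by (simp add: nb_poly_def poly_prod pochhammer_prod add.commute atLeast0LessThan)

text \<open>
  Pascal's rule for rising factorials.
\<close>

lemma nb_poly_shift:
  "pcompose (nb_poly p k) [:-1, 1:] =
     nb_poly p k - (if k = 0 then 0 else smult (1 - p) (nb_poly p (k - 1)))"
proof (cases k)
  case 0
  then show ?thesis by (simp add: nb_poly_def)
next
  case (Suc m)
  have "poly (pcompose (nb_poly p k) [:-1, 1:]) s = poly (nb_poly p k - smult (1 - p) (nb_poly p m)) s" for s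
  proof -
    have 1: "pochhammer (s - 1) (Suc m) = (s - 1) * pochhammer s m"
      by (simp add: pochhammer_rec)
    have 2: "pochhammer s (Suc m) = pochhammer s m * (s + real m)" by (rule pochhammer_Suc)
    have fld: "R * ((s - 1) * X) / ((1 + m) * D) = R * (X * (s + m)) / ((1 + m) * D) - R * X / D"
      if "D > 0" "m \<ge> 0" for R X D m :: real
      using that by (simp add: divide_simps) algebra
    have eqs: "poly [:-1, 1:] s = s - 1" "fact (Suc m) = (1 + real m) * fact m" by simp_all
    show ?thesis
      unfolding poly_pcompose poly_nb_poly Suc poly_diff poly_smult eqs 1 2
      by (subst fld) simp_all
  qed
  then show ?thesis using Suc by (simp add: poly_eq_poly_eq_iff[symmetric] fun_eq_iff)
qed

section \<open>Gamma and Beta integrals on the half-line and on an interval\<close>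


lemma Gamma_scaled_has_bochner_integral:
  fixes a c :: real
  assumes "0 < a" "0 < c"
  shows "has_bochner_integral lborel (\<lambda>x. indicator {0<..} x * (x powr (a - 1) * exp (- c * x)))
     (Gamma a * c powr (- a))"
proof -
  have "has_bochner_integral lborel (\<lambda>x. indicator {0<..} x * (x powr (a - 1) * exp (- x))) (Gamma a)"
  proof (rule has_bochner_integral_nn_integral)
    have "(\<integral>\<^sup>+x. ennreal (indicator {0<..} x * (x powr (a - 1) * exp (- x))) \<partial>lborel) =
          (\<integral>\<^sup>+x. ennreal (indicator {0..} x * x powr (a - 1) / exp x) \<partial>lborel)"
      by (intro nn_integral_cong arg_cong[where f=ennreal])
         (auto simp: indicator_def exp_minus field_simps)
    thus "(\<integral>\<^sup>+x. ennreal (indicator {0<..} x * (x powr (a - 1) * exp (- x))) \<partial>lborel) = ennreal (Gamma a)"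
      using Gamma_conv_nn_integral_real[OF assms(1)] by simp
  qed (use assms in \<open>auto intro!: Gamma_real_nonneg\<close>)
  hence "has_bochner_integral lborel (\<lambda>x. indicator {0<..} (0 + c * x) *
      ((0 + c * x) powr (a - 1) * exp (- (0 + c * x)))) (Gamma a /\<^sub>R \<bar>c\<bar>)"
    using assms by (subst (asm) lborel_has_bochner_integral_real_affine_iff[of c _ _ 0]) auto
  hence "has_bochner_integral lborel (\<lambda>x. c powr (1 - a) * (indicator {0<..} (0 + c * x) *
      ((0 + c * x) powr (a - 1) * exp (- (0 + c * x))))) (c powr (1 - a) * (Gamma a /\<^sub>R \<bar>c\<bar>))"
    by (rule has_bochner_integral_mult_right)
  also have "c powr (1 - a) * (Gamma a /\<^sub>R \<bar>c\<bar>) = Gamma a * c powr (- a)"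
    using assms by (simp add: powr_diff powr_minus field_simps)
  also have "(\<lambda>x. c powr (1 - a) * (indicator {0<..} (0 + c * x) *
      ((0 + c * x) powr (a - 1) * exp (- (0 + c * x))))) =
     (\<lambda>x. indicator {0<..} x * (x powr (a - 1) * exp (- c * x)))"
  proof
    fix x :: real
    have "c powr (1 - a) * (c powr (a - 1) * y) = y" for y
      using assms by (simp add: mult.assoc[symmetric] powr_add[symmetric])
    thus "c powr (1 - a) * (indicator {0<..} (0 + c * x) * ((0 + c * x) powr (a - 1) * exp (- (0 + c * x)))) =
        indicator {0<..} x * (x powr (a - 1) * exp (- c * x))"
      using assms by (auto simp: indicator_def zero_less_mult_iff powr_mult mult.assoc)
  qed
  finally show ?thesis .
qed

lemma Beta_scaled_has_bochner_integral:
  fixes a b t :: real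
  assumes "0 < a" "0 < b" "0 < t"
  shows "has_bochner_integral lborel (\<lambda>s. indicator {0<..<t} s * ((t - s) powr (a - 1) * s powr (b - 1)))
     (Beta a b * t powr (a + b - 1))"
proof -
  let ?g = "\<lambda>s. s powr (b - 1) * (1 - s) powr (a - 1)"
  have "has_bochner_integral lborel (\<lambda>x. indicator {0..1} x * ?g x) (Beta b a)"
  proof -
    have i: "set_integrable lborel {0..1} ?g" using integrable_Beta[of b a] assms by simp
    moreover have "(LINT x:{0..1}|lborel. ?g x) = Beta b a"
      using set_borel_integral_eq_integral(2)[OF i] has_integral_Beta_real[of b a] assms
      by (simp add: integral_unique)
    ultimately show ?thesis
      by (simp add: has_bochner_integral_iff set_integrable_def set_lebesgue_integral_def)
  qed
  hence "has_bochner_integral lborel (\<lambda>x. indicator {0<..<1} x * ?g x) (Beta b a)"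
  proof (rule has_bochner_integral_cong_AE[THEN iffD1, rotated -1])
    have "AE x in lborel. x \<noteq> (0::real) \<and> x \<noteq> 1"
      using AE_lborel_singleton[of "0::real"] AE_lborel_singleton[of "1::real"] by auto
    thus "AE x in lborel. indicator {0..1} x * ?g x = indicator {0<..<1} x * ?g x"
      by eventually_elim (auto simp: indicator_def)
  qed auto
  hence "has_bochner_integral lborel (\<lambda>x. indicator {0<..<1} (0 + (1/t) * x) * ?g (0 + (1/t) * x)) (Beta b a /\<^sub>R \<bar>1/t\<bar>)"
    using assms by (subst (asm) lborel_has_bochner_integral_real_affine_iff[of "1/t" _ _ 0]) auto
  hence "has_bochner_integral lborel (\<lambda>x. t powr (a + b - 2) * (indicator {0<..<1} (0 + (1/t) * x) * ?g (0 + (1/t) * x)))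
     (t powr (a + b - 2) * (Beta b a /\<^sub>R \<bar>1/t\<bar>))"
    by (rule has_bochner_integral_mult_right)
  also have "t powr (a + b - 2) * (Beta b a /\<^sub>R \<bar>1/t\<bar>) = Beta a b * t powr (a + b - 1)"
  proof -
    have "t powr (a + b - 2) * t powr 1 = t powr (a + b - 1)"
      by (subst powr_add[symmetric]) (simp add: algebra_simps)
    thus ?thesis using assms by (simp add: Beta_commute[of b a] field_simps)
  qed
  also have "(\<lambda>x. t powr (a + b - 2) * (indicator {0<..<1} (0 + (1/t) * x) * ?g (0 + (1/t) * x))) =
     (\<lambda>s. indicator {0<..<t} s * ((t - s) powr (a - 1) * s powr (b - 1)))"
  proof
    fix s :: real
    show "t powr (a + b - 2) * (indicator {0<..<1} (0 + (1/t) * s) * ?g (0 + (1/t) * s)) =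
      indicator {0<..<t} s * ((t - s) powr (a - 1) * s powr (b - 1))"
    proof (cases "s \<in> {0<..<t}")
      case True
      have "1 - s / t = (t - s) / t" using assms by (simp add: field_simps)
      moreover have "t powr (a + b - 2) = t powr (a - 1) * t powr (b - 1)"
        by (subst powr_add[symmetric]) (simp add: algebra_simps)
      ultimately show ?thesis using True assms
        by (simp add: powr_divide field_simps)
    next
      case False
      then show ?thesis using assms by (auto simp: indicator_def field_simps)
    qed
  qed
  finally show ?thesis .
qed

section \<open>The Caputo derivative on series in fractional powers\<close>


text \<open>
  Log-convexity: the slope of \<open>ln \<Gamma>\<close> on \<open>[y, y + \<nu>]\<close> is at least its slope \<open>ln (y - 1)\<close> on
  \<open>[y - 1, y]\<close>.
\<close>

lemma Gamma_shift_lower_bound: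
  fixes y \<nu> :: real
  assumes "1 < y" "0 < \<nu>"
  shows "Gamma y * (y - 1) powr \<nu> \<le> Gamma (y + \<nu>)"
proof -
  let ?g = "\<lambda>x. ln (Gamma x :: real)"
  \<comment> \<open>The weight with \<open>y = (1 - w) (y - 1) + w (y + \<nu>)\<close>.\<close>
  define w where "w = 1 / (1 + \<nu>)"
  have pos: "Gamma (y - 1) > 0" "Gamma y > 0" "Gamma (y + \<nu>) > 0"
    using assms by (auto intro!: Gamma_real_pos)
  have w: "0 \<le> w" "w \<le> 1" using assms by (auto simp: w_def)
  have "Gamma (y - 1 + 1) = (y - 1) * Gamma (y - 1)"
    using assms by (intro Gamma_plus1) (auto elim!: nonpos_Ints_cases)
  hence rec: "?g y = ln (y - 1) + ?g (y - 1)"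
    using assms less_imp_neq[OF pos(1)] by (simp add: ln_mult)
  have "?g ((1 - w) *\<^sub>R (y - 1) + w *\<^sub>R (y + \<nu>)) \<le> (1 - w) * ?g (y - 1) + w * ?g (y + \<nu>)"
    using convex_onD[OF log_convex_Gamma_real w, of "y - 1" "y + \<nu>"] assms by (simp add: o_def)
  moreover have "(1 - w) *\<^sub>R (y - 1) + w *\<^sub>R (y + \<nu>) = y"
  proof -
    have "w + w * \<nu> = 1" using assms by (simp add: w_def add_divide_distrib[symmetric])
    thus ?thesis by (simp add: algebra_simps)
  qed
  ultimately have "(1 + \<nu>) * ?g y \<le> (1 + \<nu>) * ((1 - w) * ?g (y - 1) + w * ?g (y + \<nu>))"
    using assms by (intro mult_left_mono) auto
  also have "\<dots> = \<nu> * ?g (y - 1) + ?g (y + \<nu>)"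
  proof -
    have w1: "(1 + \<nu>) * w = 1" using assms by (simp add: w_def)
    have "(1 + \<nu>) * ((1 - w) * A + w * B) = (1 + \<nu>) * A - ((1 + \<nu>) * w) * A + ((1 + \<nu>) * w) * B" for A B :: real
      by (simp add: algebra_simps)
    thus ?thesis unfolding w1 by (simp add: distrib_right)
  qed
  finally have "?g y + \<nu> * ln (y - 1) \<le> ?g (y + \<nu>)"
    unfolding rec by (simp add: algebra_simps)
  hence "exp (?g y + \<nu> * ln (y - 1)) \<le> exp (?g (y + \<nu>))" by simp
  thus ?thesis using assms pos by (simp add: exp_add powr_def mult.commute)
qed

text \<open>
  Ratio test: consecutive Gamma values grow by a factor of at least \<open>(\<nu> n)\<^sup>\<nu>\<close>, which is unbounded.
\<close>

lemma summable_Mittag_Leffler: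
  fixes \<nu> x :: real
  assumes "0 < \<nu>" "0 \<le> x"
  shows "summable (\<lambda>n. x ^ n / Gamma (\<nu> * real n + 1))"
proof -
  have "filterlim (\<lambda>n. (\<nu> * real n) powr \<nu>) at_top sequentially"
    using assms by real_asymp
  hence "\<forall>\<^sub>F n in sequentially. 2 * x \<le> (\<nu> * real n) powr \<nu>"
    by (simp add: filterlim_at_top)
  then obtain N where N: "\<And>n. n \<ge> N \<Longrightarrow> 2 * x \<le> (\<nu> * real n) powr \<nu>"
    by (auto simp: eventually_sequentially)
  show ?thesis
  proof (rule summable_ratio_test[where c="1/2" and N="Suc N"])
    fix n assume n: "n \<ge> Suc N"
    let ?G = "Gamma (\<nu> * real n + 1)" and ?G' = "Gamma (\<nu> * real (Suc n) + 1)"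
    have pos: "0 < ?G" "0 < ?G'" using assms by (auto intro!: Gamma_real_pos add_nonneg_pos)
    have "?G * (2 * x) \<le> ?G * (\<nu> * real n) powr \<nu>"
      using pos N n by (intro mult_left_mono) auto
    also have "\<dots> \<le> ?G'"
      using Gamma_shift_lower_bound[of "\<nu> * real n + 1" \<nu>] assms n by (simp add: algebra_simps)
    finally have "x / ?G' \<le> 1/2 * (1 / ?G)" using pos by (simp add: field_simps)
    from mult_left_mono[OF this, of "x ^ n"] show "norm (x ^ Suc n / ?G') \<le> 1/2 * norm (x ^ n / ?G)"
      using assms pos by (simp add: mult.commute)
  qed simp
qed

text \<open>
  With \<open>b n = (- lam)^n\<close> this is, for \<open>t > 0\<close>, the Mittag-Leffler function at \<open>- lam t\<^sup>\<nu>\<close>. In general it is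
  \<open>E[f(L)]\<close> for \<open>L\<close> the inverse stable subordinator at \<open>t\<close> and \<open>f\<close> with derivatives \<open>b n\<close> at \<open>0\<close>.
\<close>

definition frac_series :: "real \<Rightarrow> (nat \<Rightarrow> real) \<Rightarrow> real \<Rightarrow> real" where
  "frac_series \<nu> b t = (\<Sum>n. b n * t powr (\<nu> * real n) / Gamma (\<nu> * real n + 1))"

lemma frac_series_abs_summable:
  assumes nu: "0 < \<nu>" and b: "\<And>n. \<bar>b n\<bar> \<le> C * R ^ n" and R: "0 \<le> R" and y: "0 \<le> y"
  shows "summable (\<lambda>n. \<bar>b n\<bar> * y ^ n / Gamma (\<nu> * real n + 1))"
proof (rule summable_comparison_test_ev)
  have pos: "0 < Gamma (\<nu> * real n + 1)" for n
    using nu by (auto intro!: Gamma_real_pos add_nonneg_pos)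
  show "summable (\<lambda>n. C * ((R * y) ^ n / Gamma (\<nu> * real n + 1)))"
    using nu R y by (intro summable_mult summable_Mittag_Leffler) auto
  show "\<forall>\<^sub>F n in sequentially. norm (\<bar>b n\<bar> * y ^ n / Gamma (\<nu> * real n + 1)) \<le>
      C * ((R * y) ^ n / Gamma (\<nu> * real n + 1))"
  proof (rule always_eventually, rule allI)
    fix n
    have "\<bar>b n\<bar> * y ^ n \<le> C * R ^ n * y ^ n"
      using b y by (intro mult_right_mono) auto
    thus "norm (\<bar>b n\<bar> * y ^ n / Gamma (\<nu> * real n + 1)) \<le>
      C * ((R * y) ^ n / Gamma (\<nu> * real n + 1))"
      using pos[of n] y by (simp add: abs_mult power_mult_distrib divide_right_mono mult.assoc)
  qed
qed

lemma powr_mult_nat: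
  assumes "0 < (t::real)"
  shows "t powr (\<nu> * real n) = (t powr \<nu>) ^ n"
  using assms by (simp add: powr_powr[symmetric] powr_realpow)

lemma frac_series_summable:
  assumes nu: "0 < \<nu>" and b: "\<And>n. \<bar>b n\<bar> \<le> C * R ^ n" and R: "0 \<le> R" and t: "0 < t"
  shows "summable (\<lambda>n. b n * t powr (\<nu> * real n) / Gamma (\<nu> * real n + 1))"
proof (rule summable_rabs_cancel)
  have "0 < Gamma (\<nu> * real n + 1)" for n
    using nu by (auto intro!: Gamma_real_pos add_nonneg_pos)
  hence "\<bar>b n * t powr (\<nu> * real n) / Gamma (\<nu> * real n + 1)\<bar> =
      \<bar>b n\<bar> * (t powr \<nu>) ^ n / Gamma (\<nu> * real n + 1)" for n
    by (simp add: abs_mult powr_mult_nat[OF t] abs_of_pos)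
  thus "summable (\<lambda>n. \<bar>b n * t powr (\<nu> * real n) / Gamma (\<nu> * real n + 1)\<bar>)"
    using frac_series_abs_summable[OF nu b R, of "t powr \<nu>"] by simp
qed

text \<open>
  In the variable \<open>x = t\<^sup>\<nu>\<close> the series is an entire power series, so termwise differentiation and the
  chain rule apply. The bound on the absolute values is needed to integrate the derivative termwise.
\<close>

lemma frac_series_deriv:
  assumes nu: "0 < \<nu>" and b: "\<And>n. \<bar>b n\<bar> \<le> C * R ^ n" and R: "0 \<le> R" and t: "0 < t"
  defines "D \<equiv> (\<lambda>n. b (Suc n) * t powr (\<nu> * real (Suc n) - 1) / Gamma (\<nu> * real (Suc n)))"
  shows "summable (\<lambda>n. \<bar>D n\<bar>)"
    and "(frac_series \<nu> b has_real_derivative (\<Sum>n. D n)) (at t)"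
proof -
  define c where "c = (\<lambda>n. b n / Gamma (\<nu> * real n + 1))"
  have pos: "0 < Gamma (\<nu> * real n + 1)" for n
    using nu by (auto intro!: Gamma_real_pos add_nonneg_pos)
  have sm: "summable (\<lambda>n. \<bar>b n\<bar> / Gamma (\<nu> * real n + 1) * y ^ n)" for y
  proof (rule summable_norm_cancel)
    show "summable (\<lambda>n. norm (\<bar>b n\<bar> / Gamma (\<nu> * real n + 1) * y ^ n))"
      using frac_series_abs_summable[OF nu b R, of "\<bar>y\<bar>"] pos
      by (simp add: abs_mult power_abs abs_of_pos)
  qed
  have sc: "summable (\<lambda>n. c n * y ^ n)" for y
  proof (rule summable_norm_cancel)
    show "summable (\<lambda>n. norm (c n * y ^ n))"
      using sm[of "\<bar>y\<bar>"] pos by (simp add: c_def abs_mult power_abs abs_of_pos)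
  qed
  have G: "Gamma (\<nu> * real (Suc n) + 1) = \<nu> * real (Suc n) * Gamma (\<nu> * real (Suc n))" for n
    using nu by (intro Gamma_plus1) (auto elim!: nonpos_Ints_cases simp del: of_nat_Suc dest!: arg_cong[where f="\<lambda>x. x \<le> 0"] simp: mult_le_0_iff)
  have Gp: "0 < Gamma (\<nu> * real (Suc n))" for n using nu by (intro Gamma_real_pos) simp
  have trm: "e (Suc n) / Gamma (\<nu> * real (Suc n) + 1) * real (Suc n) * (t powr \<nu>) ^ n * (\<nu> * t powr (\<nu> - 1)) =
      e (Suc n) * t powr (\<nu> * real (Suc n) - 1) / Gamma (\<nu> * real (Suc n))" for n and e :: "nat \<Rightarrow> real"
  proof -
    have "t powr (\<nu> * real (Suc n) - 1) = (t powr \<nu>) ^ n * t powr (\<nu> - 1)"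
      using t by (simp add: powr_mult_nat[symmetric] powr_add[symmetric] algebra_simps)
    thus ?thesis unfolding G using nu Gp[of n] by (simp add: divide_simps)
  qed
  have "summable (\<lambda>n. diffs (\<lambda>n. \<bar>b n\<bar> / Gamma (\<nu> * real n + 1)) n * (t powr \<nu>) ^ n)"
    by (rule termdiff_converges_all) (rule sm)
  hence "summable (\<lambda>n. diffs (\<lambda>n. \<bar>b n\<bar> / Gamma (\<nu> * real n + 1)) n * (t powr \<nu>) ^ n * (\<nu> * t powr (\<nu> - 1)))"
    by (rule summable_mult2)
  also have "(\<lambda>n. diffs (\<lambda>n. \<bar>b n\<bar> / Gamma (\<nu> * real n + 1)) n * (t powr \<nu>) ^ n * (\<nu> * t powr (\<nu> - 1))) =
     (\<lambda>n. \<bar>D n\<bar>)"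
    using trm[of "\<lambda>n. \<bar>b n\<bar>"] Gp by (simp add: diffs_def D_def abs_mult abs_of_pos fun_eq_iff mult_ac)
  finally show "summable (\<lambda>n. \<bar>D n\<bar>)" .
  have "((\<lambda>x. \<Sum>n. c n * x ^ n) has_real_derivative (\<Sum>n. diffs c n * (t powr \<nu>) ^ n)) (at (t powr \<nu>))"
    by (rule termdiffs_strong_converges_everywhere) (rule sc)
  moreover have "((\<lambda>t. t powr \<nu>) has_real_derivative \<nu> * t powr (\<nu> - 1)) (at t)"
    using t by (auto intro!: derivative_eq_intros)
  ultimately have "((\<lambda>t. \<Sum>n. c n * (t powr \<nu>) ^ n) has_real_derivative
      (\<Sum>n. diffs c n * (t powr \<nu>) ^ n) * (\<nu> * t powr (\<nu> - 1))) (at t)"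
    by (rule DERIV_chain2)
  also have "(\<Sum>n. diffs c n * (t powr \<nu>) ^ n) * (\<nu> * t powr (\<nu> - 1)) =
      (\<Sum>n. diffs c n * (t powr \<nu>) ^ n * (\<nu> * t powr (\<nu> - 1)))"
    by (rule suminf_mult2) (rule termdiff_converges_all, rule sc)
  also have "\<dots> = (\<Sum>n. D n)"
    using trm[of b] by (simp add: diffs_def D_def c_def mult_ac)
  finally show "(frac_series \<nu> b has_real_derivative (\<Sum>n. D n)) (at t)"
  proof (rule has_field_derivative_transform_within_open)
    show "open {0::real<..}" by (rule open_greaterThan)
  qed (use t in \<open>auto simp: frac_series_def c_def powr_mult_nat\<close>)
qed

text \<open>
  The kernel integrates \<open>s powr (\<nu> (n + 1) - 1)\<close> to a Beta value that turns \<open>\<Gamma>(\<nu> (n + 1))\<close> into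
  \<open>\<Gamma>(\<nu> n + 1)\<close>; the constant term is lost by differentiation, so the coefficients move down by one.
\<close>

lemma caputo_frac_series:
  assumes nu: "0 < \<nu>" "\<nu> < 1" and b: "\<And>n. \<bar>b n\<bar> \<le> C * R ^ n" and R: "0 \<le> R"
    and u: "\<And>t. 0 < t \<Longrightarrow> u t = frac_series \<nu> b t"
  shows "caputo_exists \<nu> u"
    and "0 < t \<Longrightarrow> caputo \<nu> u t = frac_series \<nu> (\<lambda>n. b (Suc n)) t"
proof -
  define D where "D = (\<lambda>s n. b (Suc n) * s powr (\<nu> * real (Suc n) - 1) / Gamma (\<nu> * real (Suc n)))"
  have Du: "(u has_real_derivative (\<Sum>n. D s n)) (at s)" if "0 < s" for s
    using frac_series_deriv(2)[OF nu(1) b R that]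
    unfolding D_def
  proof (rule has_field_derivative_transform_within_open)
    show "open {0::real<..}" by (rule open_greaterThan)
  qed (use that u in auto)
  have bs: "\<bar>b (Suc n)\<bar> \<le> C * R * R ^ n" for n using b[of "Suc n"] by simp
  have "has_bochner_integral lborel (\<lambda>s. indicator {0<..<t} s *\<^sub>R caputo_kernel \<nu> u t s)
      (Gamma (1 - \<nu>) * frac_series \<nu> (\<lambda>n. b (Suc n)) t)" if t: "0 < t" for t
  proof -
    let ?k = "\<lambda>n s. indicator {0<..<t} s * ((t - s) powr ((1 - \<nu>) - 1) * s powr (\<nu> * real (Suc n) - 1))"
    define v where "v = (\<lambda>n. Gamma (1 - \<nu>) * t powr (\<nu> * real n) / Gamma (\<nu> * real n + 1))"
    have Gp: "0 < Gamma (\<nu> * real (Suc n))" "0 < Gamma (\<nu> * real n + 1)" "0 < Gamma (1 - \<nu>)" for n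
      using nu by (auto intro!: Gamma_real_pos add_nonneg_pos)
    have k: "has_bochner_integral lborel (?k n) (Gamma (\<nu> * real (Suc n)) * v n)" for n
    proof -
      have "has_bochner_integral lborel (?k n)
          (Beta (1 - \<nu>) (\<nu> * real (Suc n)) * t powr ((1 - \<nu>) + \<nu> * real (Suc n) - 1))"
        using nu t by (intro Beta_scaled_has_bochner_integral) auto
      moreover have "(1 - \<nu>) + \<nu> * real (Suc n) = \<nu> * real n + 1" by (simp add: algebra_simps)
      ultimately show ?thesis
        by (simp only: Beta_def v_def) (simp add: mult_ac)
    qed
    define f where "f = (\<lambda>n s. b (Suc n) / Gamma (\<nu> * real (Suc n)) * ?k n s)"
    have f: "has_bochner_integral lborel (f n) (b (Suc n) * v n)" for n
      using has_bochner_integral_mult_right[OF k[of n], where c="b (Suc n) / Gamma (\<nu> * real (Suc n))"] Gp(1,2)[of n]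
      by (simp add: f_def)
    have absf: "(\<integral>s. norm (f n s) \<partial>lborel) = \<bar>b (Suc n)\<bar> * v n" for n
    proof -
      have "(\<lambda>s. norm (f n s)) = (\<lambda>s. \<bar>b (Suc n)\<bar> / Gamma (\<nu> * real (Suc n)) * ?k n s)"
        using Gp(1,2)[of n] by (auto simp: f_def abs_mult indicator_def fun_eq_iff)
      thus ?thesis
        using has_bochner_integral_mult_right[OF k[of n], where c="\<bar>b (Suc n)\<bar> / Gamma (\<nu> * real (Suc n))"] Gp(1,2)[of n]
        by (simp add: has_bochner_integral_iff)
    qed
    have f_eq: "f n s = indicator {0<..<t} s * (t - s) powr (- \<nu>) * D s n" for n s
      by (simp add: f_def D_def)
    have 1: "AE s in lborel. summable (\<lambda>n. norm (f n s))"
    proof (rule AE_I2)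
      fix s :: real
      show "summable (\<lambda>n. norm (f n s))"
      proof (cases "s \<in> {0<..<t}")
        case True
        have "summable (\<lambda>n. \<bar>D s n\<bar>)"
          unfolding D_def using True by (intro frac_series_deriv(1)[OF nu(1) b R]) auto
        thus ?thesis by (simp add: f_eq abs_mult summable_mult)
      qed (simp add: f_eq)
    qed
    have 2: "summable (\<lambda>n. \<integral>s. norm (f n s) \<partial>lborel)"
    proof -
      have "summable (\<lambda>n. Gamma (1 - \<nu>) * (\<bar>b (Suc n)\<bar> * (t powr \<nu>) ^ n / Gamma (\<nu> * real n + 1)))"
        using nu R by (intro summable_mult frac_series_abs_summable[where b="\<lambda>n. b (Suc n)", OF nu(1) bs]) auto
      thus ?thesis unfolding absf v_def powr_mult_nat[OF t] by (simp add: mult_ac)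
    qed
    have int: "integrable lborel (f n)" for n using f by (auto simp: has_bochner_integral_iff)
    have S: "(\<Sum>n. f n s) = indicator {0<..<t} s *\<^sub>R caputo_kernel \<nu> u t s" for s
    proof (cases "s \<in> {0<..<t}")
      case True
      have "summable (\<lambda>n. \<bar>D s n\<bar>)"
        unfolding D_def using True by (intro frac_series_deriv(1)[OF nu(1) b R]) auto
      hence "summable (D s)" by (rule summable_rabs_cancel)
      moreover have "deriv u s = (\<Sum>n. D s n)" using Du[of s] True by (intro DERIV_imp_deriv) auto
      moreover have "(\<lambda>n. f n s) = (\<lambda>n. (t - s) powr (- \<nu>) * D s n)"
        unfolding f_eq using True by simp
      ultimately show ?thesis
        using True by (simp only: suminf_mult caputo_kernel_def indicator_simps scaleR_one)
    qed (simp add: f_eq)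
    have "integral\<^sup>L lborel (\<lambda>s. \<Sum>n. f n s) = (\<Sum>n. integral\<^sup>L lborel (f n))"
      by (rule integral_suminf[OF int 1 2])
    also have "\<dots> = (\<Sum>n. Gamma (1 - \<nu>) * (b (Suc n) * t powr (\<nu> * real n) / Gamma (\<nu> * real n + 1)))"
      using f by (simp add: has_bochner_integral_iff v_def mult_ac)
    also have "\<dots> = Gamma (1 - \<nu>) * frac_series \<nu> (\<lambda>n. b (Suc n)) t"
      unfolding frac_series_def
      by (rule suminf_mult) (rule frac_series_summable[OF nu(1) bs R t])
    finally show ?thesis
      using integrable_suminf[OF int 1 2] unfolding S by (simp add: has_bochner_integral_iff)
  qed note int = this
  show "caputo_exists \<nu> u"
    using Du int unfolding caputo_exists_def set_integrable_def
    by (auto simp: real_differentiable_def has_bochner_integral_iff)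
  have "Gamma (1 - \<nu>) > 0" using nu by (intro Gamma_real_pos) auto
  thus "0 < t \<Longrightarrow> caputo \<nu> u t = frac_series \<nu> (\<lambda>n. b (Suc n)) t"
    using int[of t] by (simp add: caputo_def set_lebesgue_integral_def has_bochner_integral_iff)
qed

section \<open>The right-sided Riemann-Liouville derivative on tilted stable exponentials\<close>


text \<open>
  The \<open>j\<close>-th derivative in \<open>l\<close> of \<open>l\<^sup>a exp (- l\<^sup>\<alpha> t)\<close>: differentiating once gives
  \<open>a l\<^sup>a\<^sup>-\<^sup>1 exp (- l\<^sup>\<alpha> t) - \<alpha> t l\<^sup>a\<^sup>+\<^sup>\<alpha>\<^sup>-\<^sup>1 exp (- l\<^sup>\<alpha> t)\<close>, to which the remaining \<open>j - 1\<close> derivatives are applied.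
  Keeping the exponent \<open>a\<close> as a parameter closes the family under every operation in \<open>t\<close> below, so that
  none of them has to be interchanged with the derivatives in \<open>l\<close>.
\<close>

fun powexp_deriv :: "real \<Rightarrow> nat \<Rightarrow> real \<Rightarrow> real \<Rightarrow> real \<Rightarrow> real" where
  "powexp_deriv \<alpha> 0 a l t = l powr a * exp (- (l powr \<alpha>) * t)"
| "powexp_deriv \<alpha> (Suc j) a l t =
     a * powexp_deriv \<alpha> j (a - 1) l t - \<alpha> * t * powexp_deriv \<alpha> j (a + \<alpha> - 1) l t"

lemma powexp_deriv_base:
  assumes "0 < l"
  shows "((\<lambda>l. powexp_deriv \<alpha> j a l t) has_real_derivative powexp_deriv \<alpha> (Suc j) a l t) (at l)"
proof (induction j arbitrary: a)
  case 0
  show ?case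
    using assms by (auto intro!: derivative_eq_intros simp: powr_add powr_diff field_simps)
next
  case (Suc j)
  show ?case
    by (auto intro!: derivative_eq_intros Suc[simplified] simp: algebra_simps)
qed

lemma powexp_deriv_time:
  assumes "0 < l"
  shows "((\<lambda>t. powexp_deriv \<alpha> j a l t) has_real_derivative - powexp_deriv \<alpha> j (a + \<alpha>) l t) (at t)"
proof (induction j arbitrary: a)
  case 0
  show ?case
    using assms by (auto intro!: derivative_eq_intros simp: powr_add)
next
  case (Suc j)
  have e: "a - 1 + \<alpha> = a + \<alpha> - 1" "a + \<alpha> - 1 + \<alpha> = a + \<alpha> + \<alpha> - 1" by simp_all
  show ?case
    by (auto intro!: derivative_eq_intros Suc simp: e) (simp add: algebra_simps)
qed

text \<open>
  Leibniz' rule for \<open>l\<close> times \<open>l\<^sup>a exp (- l\<^sup>\<alpha> t)\<close>.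
\<close>

lemma powexp_deriv_exponent_plus_1:
  assumes "0 < l"
  shows "powexp_deriv \<alpha> j (a + 1) l t =
     l * powexp_deriv \<alpha> j a l t + real j * powexp_deriv \<alpha> (j - 1) a l t"
proof (induction j arbitrary: a)
  case 0
  then show ?case using assms by (simp add: powr_add)
next
  case (Suc j)
  have j1: "real j * powexp_deriv \<alpha> j a l t =
      real j * (a * powexp_deriv \<alpha> (j - 1) (a - 1) l t - \<alpha> * t * powexp_deriv \<alpha> (j - 1) (a + \<alpha> - 1) l t)"
    by (cases j) simp_all
  have IH1: "powexp_deriv \<alpha> j a l t = l * powexp_deriv \<alpha> j (a - 1) l t + real j * powexp_deriv \<alpha> (j - 1) (a - 1) l t"
    using Suc[of "a - 1"] by simp
  have e: "a + 1 + \<alpha> - 1 = (a + \<alpha> - 1) + 1" "a + 1 - 1 = a" by simp_all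
  have "powexp_deriv \<alpha> (Suc j) (a + 1) l t =
     powexp_deriv \<alpha> j a l t + a * powexp_deriv \<alpha> j a l t
      - \<alpha> * t * powexp_deriv \<alpha> j ((a + \<alpha> - 1) + 1) l t"
    unfolding powexp_deriv.simps e by (simp add: algebra_simps)
  also have "\<dots> = l * powexp_deriv \<alpha> (Suc j) a l t + (1 + real j) * powexp_deriv \<alpha> j a l t"
    unfolding Suc distrib_right[of 1] j1 by (subst (2) IH1) (simp add: algebra_simps)
  finally show ?case by simp
qed

text \<open>
  For \<open>j = 0\<close> this is the Gamma integral \<open>\<integral> exp (- l\<^sup>\<alpha> r) r\<^sup>\<beta>\<^sup>-\<^sup>1 dr = \<Gamma>(\<beta>) l\<^sup>-\<^sup>\<alpha>\<^sup>\<beta>\<close>; the general case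
  is its \<open>j\<close>-th derivative in \<open>l\<close>, obtained here by induction through the recursion.
\<close>

lemma powexp_deriv_fractional_integral:
  assumes "0 < l" "0 < \<beta>"
  shows "has_bochner_integral lborel
     (\<lambda>r. indicator {0<..} r * (powexp_deriv \<alpha> j a l (t + r) * r powr (\<beta> - 1)))
     (Gamma \<beta> * powexp_deriv \<alpha> j (a - \<alpha> * \<beta>) l t)"
  using assms(2)
proof (induction j arbitrary: a \<beta>)
  case 0
  have "has_bochner_integral lborel
     (\<lambda>r. (l powr a * exp (- (l powr \<alpha>) * t)) * (indicator {0<..} r * (r powr (\<beta> - 1) * exp (- (l powr \<alpha>) * r))))
     ((l powr a * exp (- (l powr \<alpha>) * t)) * (Gamma \<beta> * (l powr \<alpha>) powr (- \<beta>)))"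
    using assms 0 by (intro has_bochner_integral_mult_right Gamma_scaled_has_bochner_integral) auto
  also have "(\<lambda>r. (l powr a * exp (- (l powr \<alpha>) * t)) * (indicator {0<..} r * (r powr (\<beta> - 1) * exp (- (l powr \<alpha>) * r))))
     = (\<lambda>r. indicator {0<..} r * (powexp_deriv \<alpha> 0 a l (t + r) * r powr (\<beta> - 1)))"
    by (simp add: fun_eq_iff distrib_left exp_add mult_ac exp_diff exp_minus field_simps)
  also have "(l powr a * exp (- (l powr \<alpha>) * t)) * (Gamma \<beta> * (l powr \<alpha>) powr (- \<beta>)) =
     Gamma \<beta> * powexp_deriv \<alpha> 0 (a - \<alpha> * \<beta>) l t"
    using assms by (simp add: powr_powr powr_diff powr_minus field_simps)
  finally show ?case .
next
  case (Suc j)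
  \<comment> \<open>The factor \<open>t + r\<close> splits; the part \<open>r\<close> raises \<open>\<beta>\<close> by one.\<close>
  have "has_bochner_integral lborel
     (\<lambda>r. a * (indicator {0<..} r * (powexp_deriv \<alpha> j (a - 1) l (t + r) * r powr (\<beta> - 1)))
        - (\<alpha> * t * (indicator {0<..} r * (powexp_deriv \<alpha> j (a + \<alpha> - 1) l (t + r) * r powr (\<beta> - 1)))
         + \<alpha> * (indicator {0<..} r * (powexp_deriv \<alpha> j (a + \<alpha> - 1) l (t + r) * r powr (\<beta> + 1 - 1)))))
     (a * (Gamma \<beta> * powexp_deriv \<alpha> j (a - 1 - \<alpha> * \<beta>) l t)
        - (\<alpha> * t * (Gamma \<beta> * powexp_deriv \<alpha> j (a + \<alpha> - 1 - \<alpha> * \<beta>) l t)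
         + \<alpha> * (Gamma (\<beta> + 1) * powexp_deriv \<alpha> j (a + \<alpha> - 1 - \<alpha> * (\<beta> + 1)) l t)))"
    using Suc.prems
    by (intro has_bochner_integral_diff has_bochner_integral_add has_bochner_integral_mult_right Suc.IH) auto
  also have "(\<lambda>r. a * (indicator {0<..} r * (powexp_deriv \<alpha> j (a - 1) l (t + r) * r powr (\<beta> - 1)))
        - (\<alpha> * t * (indicator {0<..} r * (powexp_deriv \<alpha> j (a + \<alpha> - 1) l (t + r) * r powr (\<beta> - 1)))
         + \<alpha> * (indicator {0<..} r * (powexp_deriv \<alpha> j (a + \<alpha> - 1) l (t + r) * r powr (\<beta> + 1 - 1))))) =
     (\<lambda>r. indicator {0<..} r * (powexp_deriv \<alpha> (Suc j) a l (t + r) * r powr (\<beta> - 1)))"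
  proof
    fix r :: real
    have "r powr (\<beta> + 1 - 1) = r * r powr (\<beta> - 1)" if "0 < r"
      using that by (simp add: powr_diff)
    thus "a * (indicator {0<..} r * (powexp_deriv \<alpha> j (a - 1) l (t + r) * r powr (\<beta> - 1)))
        - (\<alpha> * t * (indicator {0<..} r * (powexp_deriv \<alpha> j (a + \<alpha> - 1) l (t + r) * r powr (\<beta> - 1)))
         + \<alpha> * (indicator {0<..} r * (powexp_deriv \<alpha> j (a + \<alpha> - 1) l (t + r) * r powr (\<beta> + 1 - 1)))) =
      indicator {0<..} r * (powexp_deriv \<alpha> (Suc j) a l (t + r) * r powr (\<beta> - 1))"
      by (cases "0 < r") (simp_all add: algebra_simps)
  qed
  also have "a * (Gamma \<beta> * powexp_deriv \<alpha> j (a - 1 - \<alpha> * \<beta>) l t)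
        - (\<alpha> * t * (Gamma \<beta> * powexp_deriv \<alpha> j (a + \<alpha> - 1 - \<alpha> * \<beta>) l t)
         + \<alpha> * (Gamma (\<beta> + 1) * powexp_deriv \<alpha> j (a + \<alpha> - 1 - \<alpha> * (\<beta> + 1)) l t)) =
     Gamma \<beta> * powexp_deriv \<alpha> (Suc j) (a - \<alpha> * \<beta>) l t"
  proof -
    have G: "Gamma (\<beta> + 1) = \<beta> * Gamma \<beta>"
      using Suc.prems by (intro Gamma_plus1) (auto elim!: nonpos_Ints_cases)
    have e: "a + \<alpha> - 1 - \<alpha> * (\<beta> + 1) = a - \<alpha> * \<beta> - 1" "a - 1 - \<alpha> * \<beta> = a - \<alpha> * \<beta> - 1"
      "a + \<alpha> - 1 - \<alpha> * \<beta> = a - \<alpha> * \<beta> + \<alpha> - 1" by (simp_all add: algebra_simps)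
    show ?thesis unfolding G e powexp_deriv.simps by (simp add: algebra_simps)
  qed
  finally show ?case .
qed

text \<open>
  The operator \<open>P(- d/dl)\<close> applied to \<open>l\<^sup>a exp (- l\<^sup>\<alpha> t)\<close>; for \<open>a = 0\<close> it is \<open>E[P(A) exp (- l A)]\<close>
  for a stable variable \<open>A\<close> with Laplace transform \<open>exp (- l\<^sup>\<alpha> t)\<close>.
\<close>

definition powexp_comb :: "real \<Rightarrow> real poly \<Rightarrow> real \<Rightarrow> real \<Rightarrow> real \<Rightarrow> real" where
  "powexp_comb \<alpha> P a l t = (\<Sum>j\<le>degree P. coeff P j * (-1) ^ j * powexp_deriv \<alpha> j a l t)"

lemma powexp_comb_bound:
  assumes "degree P \<le> N"
  shows "powexp_comb \<alpha> P a l t = (\<Sum>j\<le>N. coeff P j * (-1) ^ j * powexp_deriv \<alpha> j a l t)"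
  unfolding powexp_comb_def using assms
  by (intro sum.mono_neutral_left) (auto simp: coeff_eq_0)

lemma powexp_comb_add: "powexp_comb \<alpha> (P + Q) a l t = powexp_comb \<alpha> P a l t + powexp_comb \<alpha> Q a l t"
proof -
  define N where "N = max (degree P) (degree Q)"
  have "degree P \<le> N" "degree Q \<le> N" "degree (P + Q) \<le> N"
    by (auto simp: N_def intro: degree_add_le)
  thus ?thesis
    by (simp add: powexp_comb_bound[of _ N] sum.distrib distrib_right)
qed

lemma powexp_comb_smult: "powexp_comb \<alpha> (smult c P) a l t = c * powexp_comb \<alpha> P a l t"
  using degree_smult_le[of c P]
  by (simp add: powexp_comb_bound[of _ "degree P"] sum_distrib_left mult_ac)

text \<open>
  Commuting the factor \<open>l\<close> past \<open>P(- d/dl)\<close> gives \<open>P(- d/dl) l = l P(- d/dl) - P'(- d/dl)\<close>.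
\<close>

lemma powexp_comb_exponent_plus_1:
  assumes "0 < l"
  shows "powexp_comb \<alpha> P (a + 1) l t = powexp_comb \<alpha> (tilt l P) a l t"
proof -
  define N where "N = degree P"
  let ?W = "\<lambda>j. powexp_deriv \<alpha> j a l t"
  have shift: "(\<Sum>j\<le>N. coeff P j * (-1) ^ j * (real j * ?W (j - 1))) = - powexp_comb \<alpha> (pderiv P) a l t"
  proof -
    have "(\<Sum>j\<le>N. coeff P j * (-1) ^ j * (real j * ?W (j - 1))) =
       (\<Sum>j\<le>Suc N. coeff P j * (-1) ^ j * (real j * ?W (j - 1)))"
      by (simp add: N_def coeff_eq_0)
    also have "\<dots> = (\<Sum>j\<le>N. coeff P (Suc j) * (-1) ^ Suc j * (real (Suc j) * ?W j))"
      by (subst sum.atMost_Suc_shift) simp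
    also have "\<dots> = - (\<Sum>j\<le>N. coeff (pderiv P) j * (-1) ^ j * ?W j)"
      by (simp add: coeff_pderiv sum_negf mult_ac)
    also have "\<dots> = - powexp_comb \<alpha> (pderiv P) a l t"
      by (subst powexp_comb_bound[of _ N]) (simp_all add: degree_pderiv N_def)
    finally show ?thesis .
  qed
  have "powexp_comb \<alpha> P (a + 1) l t =
      l * powexp_comb \<alpha> P a l t + (\<Sum>j\<le>N. coeff P j * (-1) ^ j * (real j * ?W (j - 1)))"
    by (simp add: powexp_comb_def N_def powexp_deriv_exponent_plus_1[OF assms] distrib_left
        sum.distrib sum_distrib_left mult_ac)
  also have "\<dots> = powexp_comb \<alpha> (smult l P + smult (-1) (pderiv P)) a l t"
    unfolding shift powexp_comb_add powexp_comb_smult by simp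
  finally show ?thesis by (simp add: tilt_def)
qed

lemma powexp_comb_time:
  assumes "0 < l"
  shows "(powexp_comb \<alpha> P a l has_real_derivative - powexp_comb \<alpha> P (a + \<alpha>) l t) (at t)"
  unfolding powexp_comb_def[abs_def]
  by (auto intro!: derivative_eq_intros powexp_deriv_time[OF assms] simp: sum_negf mult_ac)

lemma powexp_comb_fractional_integral:
  assumes "0 < l" "0 < \<beta>"
  shows "has_bochner_integral lborel
     (\<lambda>s. indicator {t<..} s * (powexp_comb \<alpha> P a l s * (s - t) powr (\<beta> - 1)))
     (Gamma \<beta> * powexp_comb \<alpha> P (a - \<alpha> * \<beta>) l t)"
proof -
  have "has_bochner_integral lborel
     (\<lambda>r. \<Sum>j\<le>degree P. coeff P j * (-1) ^ j *
        (indicator {0<..} r * (powexp_deriv \<alpha> j a l (t + r) * r powr (\<beta> - 1))))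
     (\<Sum>j\<le>degree P. coeff P j * (-1) ^ j * (Gamma \<beta> * powexp_deriv \<alpha> j (a - \<alpha> * \<beta>) l t))"
    by (intro has_bochner_integral_sum has_bochner_integral_mult_right
        powexp_deriv_fractional_integral assms)
  also have "(\<Sum>j\<le>degree P. coeff P j * (-1) ^ j * (Gamma \<beta> * powexp_deriv \<alpha> j (a - \<alpha> * \<beta>) l t)) =
      Gamma \<beta> * powexp_comb \<alpha> P (a - \<alpha> * \<beta>) l t"
    by (simp add: powexp_comb_def sum_distrib_left mult_ac)
  also have "(\<lambda>r. \<Sum>j\<le>degree P. coeff P j * (-1) ^ j *
        (indicator {0<..} r * (powexp_deriv \<alpha> j a l (t + r) * r powr (\<beta> - 1)))) =
     (\<lambda>r. indicator {t<..} (t + 1 * r) * (powexp_comb \<alpha> P a l (t + 1 * r) * ((t + 1 * r) - t) powr (\<beta> - 1)))"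
    by (auto simp: powexp_comb_def sum_distrib_left sum_distrib_right mult_ac indicator_def fun_eq_iff)
  finally show ?thesis
    by (subst lborel_has_bochner_integral_real_affine_iff[of 1 _ _ t]) simp_all
qed

lemma iterated_deriv_powexp_comb:
  assumes "0 < l" and f: "\<And>t. 0 < t \<Longrightarrow> f t = c * powexp_comb \<alpha> P a l t"
  shows "0 < t \<Longrightarrow> (deriv ^^ n) f t = c * (-1) ^ n * powexp_comb \<alpha> P (a + real n * \<alpha>) l t"
    and "iter_differentiable n f"
proof -
  have local: "(g has_real_derivative - (c' * powexp_comb \<alpha> P (a' + \<alpha>) l t)) (at t)"
    if "0 < t" "\<And>t. 0 < t \<Longrightarrow> g t = c' * powexp_comb \<alpha> P a' l t" for g c' a' t
  proof -
    have "((\<lambda>t. c' * powexp_comb \<alpha> P a' l t) has_real_derivative - (c' * powexp_comb \<alpha> P (a' + \<alpha>) l t)) (at t)"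
      by (auto intro!: derivative_eq_intros powexp_comb_time[OF assms(1)])
    thus ?thesis
    proof (rule has_field_derivative_transform_within_open)
      show "open {0::real<..}" by (rule open_greaterThan)
    qed (use that in auto)
  qed
  have D: "\<forall>t>0. (deriv ^^ n) f t = c * (-1) ^ n * powexp_comb \<alpha> P (a + real n * \<alpha>) l t" for n
  proof (induction n)
    case 0
    then show ?case using f by simp
  next
    case (Suc n)
    show ?case
    proof (intro allI impI)
      fix t :: real assume "0 < t"
      have "((deriv ^^ n) f has_real_derivative
          - (c * (-1) ^ n * powexp_comb \<alpha> P (a + real n * \<alpha> + \<alpha>) l t)) (at t)"
        using Suc by (intro local[OF \<open>0 < t\<close>]) auto
      from DERIV_imp_deriv[OF this]
      show "(deriv ^^ Suc n) f t = c * (-1) ^ Suc n * powexp_comb \<alpha> P (a + real (Suc n) * \<alpha>) l t"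
        by (simp add: algebra_simps)
    qed
  qed
  show "0 < t \<Longrightarrow> (deriv ^^ n) f t = c * (-1) ^ n * powexp_comb \<alpha> P (a + real n * \<alpha>) l t"
    using D by blast
  show "iter_differentiable n f"
    unfolding iter_differentiable_def
  proof (intro allI impI)
    fix j and t :: real assume "0 < t"
    have "((deriv ^^ j) f has_real_derivative
          - (c * (-1) ^ j * powexp_comb \<alpha> P (a + real j * \<alpha> + \<alpha>) l t)) (at t)"
      using D by (intro local[OF \<open>0 < t\<close>]) auto
    thus "(deriv ^^ j) f differentiable at t" by (auto simp: real_differentiable_def)
  qed
qed

text \<open>
  For \<open>\<nu>\<close> outside the naturals, the fractional integral of order \<open>m - \<nu>\<close> lowers the exponent by
  \<open>(m - \<nu>) / \<nu>\<close> and the \<open>m\<close> derivatives raise it by \<open>m / \<nu>\<close>; for a natural \<open>\<nu> = m\<close> only the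
  derivatives act. The net change is \<open>1\<close> in both cases, and the signs cancel.
\<close>

lemma right_rl_powexp_comb:
  assumes nu: "1 < \<nu>" and l: "0 < l" and u: "\<And>t. 0 < t \<Longrightarrow> u t = powexp_comb (1 / \<nu>) P a l t"
  shows "right_rl_exists \<nu> u" and "0 < t \<Longrightarrow> right_rl \<nu> u t = powexp_comb (1 / \<nu>) P (a + 1) l t"
proof -
  define m where "m = rl_order \<nu>"
  have "right_rl_exists \<nu> u \<and> (\<forall>t>0. right_rl \<nu> u t = powexp_comb (1 / \<nu>) P (a + 1) l t)"
  proof (cases "\<nu> \<in> \<nat>")
    case True
    then obtain i where i: "\<nu> = real i" by (auto elim: Nats_cases)
    have m: "real m = \<nu>" by (simp add: m_def rl_order_def i)
    have "(deriv ^^ m) u t = 1 * (-1) ^ m * powexp_comb (1 / \<nu>) P (a + real m * (1 / \<nu>)) l t" if "0 < t" for t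
      by (rule iterated_deriv_powexp_comb(1)[OF l _ that]) (simp add: u)
    moreover have "iter_differentiable m u"
      by (rule iterated_deriv_powexp_comb(2)[OF l, where c=1]) (simp add: u)
    ultimately show ?thesis
      using nu True by (simp add: right_rl_exists_def right_rl_def m_def[symmetric] m)
  next
    case False
    have "\<nu> \<notin> \<int>"
    proof
      assume "\<nu> \<in> \<int>"
      then obtain i where "\<nu> = of_int i" by (auto elim: Ints_cases)
      with nu have "\<nu> = of_nat (nat i)" by simp
      with False show False by simp
    qed
    hence "real m \<noteq> \<nu>" by (metis Ints_of_nat)
    moreover have "\<nu> \<le> real m"
      unfolding m_def rl_order_def using nu by linarith
    ultimately have be: "0 < real m - \<nu>" by simp
    have int: "has_bochner_integral lborel (\<lambda>s. indicator {t<..} s *\<^sub>R rl_kernel \<nu> u t s)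
        (Gamma (real m - \<nu>) * powexp_comb (1 / \<nu>) P (a - 1 / \<nu> * (real m - \<nu>)) l t)" if "0 < t" for t
    proof -
      have "(\<lambda>s. indicator {t<..} s *\<^sub>R rl_kernel \<nu> u t s) =
        (\<lambda>s. indicator {t<..} s * (powexp_comb (1 / \<nu>) P a l s * (s - t) powr (real m - \<nu> - 1)))"
      proof
        fix s :: real
        have "(s - t) powr (real m - \<nu> - 1) = inverse ((s - t) powr (1 + \<nu> - real m))"
          by (subst powr_minus[symmetric]) (simp add: algebra_simps)
        thus "indicator {t<..} s *\<^sub>R rl_kernel \<nu> u t s =
          indicator {t<..} s * (powexp_comb (1 / \<nu>) P a l s * (s - t) powr (real m - \<nu> - 1))"
          using that by (auto simp: rl_kernel_def m_def[symmetric] u divide_inverse indicator_def)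
      qed
      thus ?thesis by (simp only: powexp_comb_fractional_integral[OF l be])
    qed
    have I: "rl_integral \<nu> u t =
        Gamma (real m - \<nu>) * powexp_comb (1 / \<nu>) P (a - 1 / \<nu> * (real m - \<nu>)) l t" if "0 < t" for t
      using int[OF that] by (simp add: rl_integral_def set_lebesgue_integral_def has_bochner_integral_iff)
    have "(deriv ^^ m) (rl_integral \<nu> u) t = Gamma (real m - \<nu>) * (-1) ^ m *
        powexp_comb (1 / \<nu>) P (a - 1 / \<nu> * (real m - \<nu>) + real m * (1 / \<nu>)) l t" if "0 < t" for t
      by (rule iterated_deriv_powexp_comb(1)[OF l I that])
    moreover have "iter_differentiable m (rl_integral \<nu> u)"
      by (rule iterated_deriv_powexp_comb(2)[OF l I])
    moreover have "a - 1 / \<nu> * (real m - \<nu>) + real m * (1 / \<nu>) = a + 1"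
      using nu by (simp add: field_simps)
    moreover have "set_integrable lborel {t<..} (rl_kernel \<nu> u t)" if "0 < t" for t
      using int[OF that] by (simp add: set_integrable_def has_bochner_integral_iff)
    moreover have "Gamma (real m - \<nu>) \<noteq> 0" using Gamma_real_pos[OF be] by simp
    ultimately show ?thesis
      using False by (simp only: right_rl_exists_def right_rl_def m_def[symmetric] Let_def if_False) simp
  qed
  thus "right_rl_exists \<nu> u" and "0 < t \<Longrightarrow> right_rl \<nu> u t = powexp_comb (1 / \<nu>) P (a + 1) l t"
    by blast+
qed

section \<open>Tilted moments of stable variables\<close>


lemma power_times_exp_bound:
  fixes c x :: real
  assumes "0 < c" "0 \<le> x"
  shows "x ^ n * exp (- c * x) \<le> fact n / c ^ n"
proof -
  have "(c * x) ^ n / fact n \<le> exp (c * x)"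
  proof -
    have "(\<Sum>k\<in>{n}. (c * x) ^ k /\<^sub>R fact k) \<le> (\<Sum>k. (c * x) ^ k /\<^sub>R fact k)"
      using assms by (intro sum_le_suminf summable_exp_generic) auto
    thus ?thesis by (simp add: exp_def divide_inverse mult.commute)
  qed
  hence "x ^ n * c ^ n \<le> fact n * exp (c * x)" by (simp add: field_simps power_mult_distrib)
  thus ?thesis using assms by (simp add: exp_minus field_simps)
qed

text \<open>
  Difference quotients taken in \<open>(l/2, \<infinity>)\<close> are dominated by \<open>X\<^sup>j\<^sup>+\<^sup>1 exp (- (l/2) X)\<close>, which is bounded.
\<close>

lemma (in finite_measure) laplace_derivative:
  fixes X :: "'a \<Rightarrow> real"
  assumes [measurable]: "X \<in> borel_measurable M" and X: "\<And>\<omega>. \<omega> \<in> space M \<Longrightarrow> 0 \<le> X \<omega>" and l: "0 < l"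
  shows "integrable M (\<lambda>\<omega>. X \<omega> ^ j * exp (- l * X \<omega>))"
    and "((\<lambda>l. \<integral>\<omega>. X \<omega> ^ j * exp (- l * X \<omega>) \<partial>M) has_real_derivative
           - (\<integral>\<omega>. X \<omega> ^ Suc j * exp (- l * X \<omega>) \<partial>M)) (at l)"
proof -
  have int: "integrable M (\<lambda>\<omega>. X \<omega> ^ j * exp (- l * X \<omega>))" if "0 < l" for l j
    using power_times_exp_bound[OF that X, of _ j] X
    by (intro integrable_const_bound[where B="fact j / l ^ j"] AE_I2) (auto simp: abs_mult)
  show "integrable M (\<lambda>\<omega>. X \<omega> ^ j * exp (- l * X \<omega>))" by (rule int[OF l])
  let ?S = "{l/2<..}"
  have "((\<lambda>l. \<integral>\<omega>. X \<omega> ^ j * exp (- l * X \<omega>) \<partial>M) has_real_derivative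
           - (\<integral>\<omega>. X \<omega> ^ Suc j * exp (- l * X \<omega>) \<partial>M)) (at l within ?S)"
    unfolding has_field_derivative_iff tendsto_at_iff_sequentially comp_def
  proof (intro allI impI)
    fix Y :: "nat \<Rightarrow> real" assume Y: "\<forall>i. Y i \<in> ?S - {l}" and lim: "Y \<longlonglongrightarrow> l"
    let ?d = "\<lambda>i \<omega>. (X \<omega> ^ j * exp (- Y i * X \<omega>) - X \<omega> ^ j * exp (- l * X \<omega>)) / (Y i - l)"
    have Ypos: "0 < Y i" for i using Y[rule_format, of i] l by auto
    have eq: "(\<integral>\<omega>. X \<omega> ^ j * exp (- Y i * X \<omega>) \<partial>M - (\<integral>\<omega>. X \<omega> ^ j * exp (- l * X \<omega>) \<partial>M)) / (Y i - l)
        = integral\<^sup>L M (?d i)" for i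
      using int[OF Ypos[of i], of j] int[OF l, of j]
      by (subst integral_divide_zero, subst Bochner_Integration.integral_diff) auto
    have "(\<lambda>i. integral\<^sup>L M (?d i)) \<longlonglongrightarrow> (\<integral>\<omega>. - (X \<omega> ^ Suc j * exp (- l * X \<omega>)) \<partial>M)"
    proof (rule integral_dominated_convergence[where w="\<lambda>_. fact (Suc j) / (l/2) ^ Suc j"])
      show "AE \<omega> in M. (\<lambda>i. ?d i \<omega>) \<longlonglongrightarrow> - (X \<omega> ^ Suc j * exp (- l * X \<omega>))"
      proof (rule AE_I2)
        fix \<omega>
        have "((\<lambda>l. X \<omega> ^ j * exp (- l * X \<omega>)) has_real_derivative - (X \<omega> ^ Suc j * exp (- l * X \<omega>))) (at l)"
          by (auto intro!: derivative_eq_intros)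
        moreover have "filterlim Y (at l) sequentially"
          using Y lim by (simp add: filterlim_at)
        ultimately show "(\<lambda>i. ?d i \<omega>) \<longlonglongrightarrow> - (X \<omega> ^ Suc j * exp (- l * X \<omega>))"
          unfolding has_field_derivative_iff by (rule filterlim_compose)
      qed
      show "AE \<omega> in M. norm (?d i \<omega>) \<le> fact (Suc j) / (l/2) ^ Suc j" for i
      proof (rule AE_I2)
        fix \<omega> assume w: "\<omega> \<in> space M"
        have D: "\<bar>exp (- a * x) - exp (- b * x)\<bar> \<le> \<bar>a - b\<bar> * (x * exp (- (l/2) * x))"
          if "l/2 \<le> a" "l/2 \<le> b" "a \<le> b" "0 \<le> x" for a b x :: real
        proof -
          have "exp (- a * x) - exp (- b * x) = exp (- a * x) * (1 - exp (- ((b - a) * x)))"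
            by (simp add: right_diff_distrib exp_add[symmetric] algebra_simps)
          also have "\<dots> \<le> exp (- (l/2) * x) * ((b - a) * x)"
            using that mult_right_mono[of "l/2" a x] exp_ge_add_one_self[of "- ((b - a) * x)"]
            by (intro mult_mono) (auto intro!: mult_right_mono)
          finally have "exp (- a * x) - exp (- b * x) \<le> (b - a) * (x * exp (- (l/2) * x))"
            by (simp add: mult_ac)
          moreover have "exp (- b * x) \<le> exp (- a * x)" using that by (simp add: mult_right_mono)
          ultimately show ?thesis using that by simp
        qed
        have D': "\<bar>exp (- Y i * X \<omega>) - exp (- l * X \<omega>)\<bar> \<le> \<bar>Y i - l\<bar> * (X \<omega> * exp (- (l/2) * X \<omega>))"
          using D[of "Y i" l "X \<omega>"] D[of l "Y i" "X \<omega>"] X[OF w] Y[rule_format, of i] l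
          by (cases "Y i \<le> l") (auto simp: abs_minus_commute)
        have "norm (?d i \<omega>) = X \<omega> ^ j * (\<bar>exp (- Y i * X \<omega>) - exp (- l * X \<omega>)\<bar> / \<bar>Y i - l\<bar>)"
          using X[OF w] by (simp add: abs_mult right_diff_distrib[symmetric])
        also have "\<dots> \<le> X \<omega> ^ j * (X \<omega> * exp (- (l/2) * X \<omega>))"
          using D' X[OF w] Y[rule_format, of i]
          by (intro mult_left_mono) (auto simp: pos_divide_le_eq mult_ac)
        also have "\<dots> = X \<omega> ^ Suc j * exp (- (l/2) * X \<omega>)" by (simp add: mult_ac)
        also have "\<dots> \<le> fact (Suc j) / (l/2) ^ Suc j"
          using l by (intro power_times_exp_bound X w) auto
        finally show "norm (?d i \<omega>) \<le> fact (Suc j) / (l/2) ^ Suc j" .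
      qed
    qed simp_all
    thus "(\<lambda>i. ((\<integral>\<omega>. X \<omega> ^ j * exp (- Y i * X \<omega>) \<partial>M) - (\<integral>\<omega>. X \<omega> ^ j * exp (- l * X \<omega>) \<partial>M)) / (Y i - l))
        \<longlonglongrightarrow> - (\<integral>\<omega>. X \<omega> ^ Suc j * exp (- l * X \<omega>) \<partial>M)"
      by (simp only: eq Bochner_Integration.integral_minus)
  qed
  thus "((\<lambda>l. \<integral>\<omega>. X \<omega> ^ j * exp (- l * X \<omega>) \<partial>M) has_real_derivative
           - (\<integral>\<omega>. X \<omega> ^ Suc j * exp (- l * X \<omega>) \<partial>M)) (at l)"
    using l by (subst (asm) at_within_open) auto
qed

lemma (in finite_measure) stable_tilted_moments:
  fixes X :: "'a \<Rightarrow> real"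
  assumes [measurable]: "X \<in> borel_measurable M" and X: "\<And>\<omega>. \<omega> \<in> space M \<Longrightarrow> 0 \<le> X \<omega>"
    and laplace: "\<And>k. 0 < k \<Longrightarrow> (\<integral>\<omega>. exp (- k * X \<omega>) \<partial>M) = exp (- (k powr \<alpha>) * t)"
    and "0 < l"
  shows "(\<integral>\<omega>. X \<omega> ^ j * exp (- l * X \<omega>) \<partial>M) = (-1) ^ j * powexp_deriv \<alpha> j 0 l t"
  using \<open>0 < l\<close>
proof (induction j arbitrary: l)
  case 0
  then show ?case using laplace[of l] by simp
next
  case (Suc j)
  have "((\<lambda>l. \<integral>\<omega>. X \<omega> ^ j * exp (- l * X \<omega>) \<partial>M) has_real_derivative
      (-1) ^ j * powexp_deriv \<alpha> (Suc j) 0 l t) (at l)"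
  proof (rule has_field_derivative_transform_within_open)
    show "((\<lambda>l. (-1) ^ j * powexp_deriv \<alpha> j 0 l t) has_real_derivative
        (-1) ^ j * powexp_deriv \<alpha> (Suc j) 0 l t) (at l)"
      using powexp_deriv_base[OF Suc.prems] by (rule DERIV_cmult)
    show "open {0::real<..}" by (rule open_greaterThan)
  qed (use Suc in auto)
  from DERIV_unique[OF this laplace_derivative(2)[OF assms(1) X Suc.prems]]
  show ?case by simp
qed

lemma (in finite_measure) stable_tilted_poly:
  fixes X :: "'a \<Rightarrow> real"
  assumes [measurable]: "X \<in> borel_measurable M" and X: "\<And>\<omega>. \<omega> \<in> space M \<Longrightarrow> 0 \<le> X \<omega>"
    and laplace: "\<And>k. 0 < k \<Longrightarrow> (\<integral>\<omega>. exp (- k * X \<omega>) \<partial>M) = exp (- (k powr \<alpha>) * t)"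
    and l: "0 < l"
  shows "(\<integral>\<omega>. poly P (X \<omega>) * exp (- l * X \<omega>) \<partial>M) = powexp_comb \<alpha> P 0 l t"
proof -
  have "(\<integral>\<omega>. poly P (X \<omega>) * exp (- l * X \<omega>) \<partial>M) =
      (\<integral>\<omega>. (\<Sum>j\<le>degree P. coeff P j * (X \<omega> ^ j * exp (- l * X \<omega>))) \<partial>M)"
    by (simp add: poly_altdef sum_distrib_left sum_distrib_right mult_ac)
  also have "\<dots> = (\<Sum>j\<le>degree P. coeff P j * (\<integral>\<omega>. X \<omega> ^ j * exp (- l * X \<omega>) \<partial>M))"
    by (subst Bochner_Integration.integral_sum)
       (intro integrable_mult_right laplace_derivative(1)[OF assms(1) X l], simp_all)
  also have "\<dots> = powexp_comb \<alpha> P 0 l t"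
  proof -
    have "(\<integral>\<omega>. X \<omega> ^ j * exp (- l * X \<omega>) \<partial>M) = (-1) ^ j * powexp_deriv \<alpha> j 0 l t" for j
      by (rule stable_tilted_moments) (use X laplace l in auto)
    thus ?thesis by (simp only: powexp_comb_def mult.assoc)
  qed
  finally show ?thesis .
qed

section \<open>Laplace transforms, moments and a Mellin integral\<close>


text \<open>
  The values of the Laplace transform at positive integers are the moments of \<open>exp (- X)\<close>, a variable
  with values in \<open>[0, 1]\<close>; by the Weierstrass approximation theorem they determine its law.
\<close>

lemma (in prob_space) laplace_determines_cdf:
  fixes X Y :: "'a \<Rightarrow> real"
  assumes [measurable]: "X \<in> borel_measurable M" "Y \<in> borel_measurable M"
    and X: "\<And>\<omega>. \<omega> \<in> space M \<Longrightarrow> 0 \<le> X \<omega>" and Y: "\<And>\<omega>. \<omega> \<in> space M \<Longrightarrow> 0 \<le> Y \<omega>"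
    and eq: "\<And>k. 0 < k \<Longrightarrow> expectation (\<lambda>\<omega>. exp (- k * X \<omega>)) = expectation (\<lambda>\<omega>. exp (- k * Y \<omega>))"
  shows "prob {\<omega> \<in> space M. X \<omega> \<le> t} = prob {\<omega> \<in> space M. Y \<omega> \<le> t}"
proof -
  let ?U = "\<lambda>Z \<omega>. exp (- Z \<omega>) :: real"
  have U01: "?U X \<omega> \<in> {0..1}" "?U Y \<omega> \<in> {0..1}" if "\<omega> \<in> space M" for \<omega>
    using X Y that by auto
  have poly_eq: "expectation (\<lambda>\<omega>. g (?U X \<omega>)) = expectation (\<lambda>\<omega>. g (?U Y \<omega>))"
    and poly_int: "integrable M (\<lambda>\<omega>. g (?U X \<omega>))" "integrable M (\<lambda>\<omega>. g (?U Y \<omega>))"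
    if pg: "polynomial_function g" for g :: "real \<Rightarrow> real"
  proof -
    obtain a n where g: "g = (\<lambda>x. \<Sum>i\<le>n. a i * x ^ i)"
      using pg unfolding real_polynomial_function_eq[symmetric] real_polynomial_function_iff_sum by blast
    have int: "integrable M (\<lambda>\<omega>. ?U Z \<omega> ^ i)"
      if "\<And>\<omega>. \<omega> \<in> space M \<Longrightarrow> 0 \<le> Z \<omega>" "Z \<in> borel_measurable M" for Z :: "'a \<Rightarrow> real" and i
      using that by (intro integrable_const_bound[where B=1]) (auto intro!: AE_I2 power_le_one)
    have pw: "?U Z \<omega> ^ i = exp (- real i * Z \<omega>)" for Z :: "'a \<Rightarrow> real" and \<omega> i
      by (simp add: exp_of_nat_mult[symmetric])
    have mom: "expectation (\<lambda>\<omega>. ?U X \<omega> ^ i) = expectation (\<lambda>\<omega>. ?U Y \<omega> ^ i)" for i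
      unfolding pw using eq[of "real i"] by (cases "i = 0") simp_all
    show "expectation (\<lambda>\<omega>. g (?U X \<omega>)) = expectation (\<lambda>\<omega>. g (?U Y \<omega>))"
      unfolding g using int[OF X] int[OF Y]
      by (subst (1 2) Bochner_Integration.integral_sum) (simp_all add: mom del: exp_minus)
    show "integrable M (\<lambda>\<omega>. g (?U X \<omega>))" "integrable M (\<lambda>\<omega>. g (?U Y \<omega>))"
      unfolding g using int[OF X] int[OF Y] by (auto intro!: Bochner_Integration.integrable_sum)
  qed
  have cont_eq: "expectation (\<lambda>\<omega>. f (?U X \<omega>)) = expectation (\<lambda>\<omega>. f (?U Y \<omega>))"
    if f: "continuous_on UNIV f" "\<And>x. \<bar>f x\<bar> \<le> 1" for f :: "real \<Rightarrow> real"
  proof -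
    have [measurable]: "f \<in> borel_measurable borel"
      using f(1) by (rule borel_measurable_continuous_onI)
    have int: "integrable M (\<lambda>\<omega>. f (?U X \<omega>))" "integrable M (\<lambda>\<omega>. f (?U Y \<omega>))"
      using f(2) by (auto intro!: integrable_const_bound[where B=1])
    have "\<bar>expectation (\<lambda>\<omega>. f (?U X \<omega>)) - expectation (\<lambda>\<omega>. f (?U Y \<omega>))\<bar> \<le> 0 + e" if "0 < e" for e
    proof -
      obtain g :: "real \<Rightarrow> real" where g: "polynomial_function g" "\<And>x. x \<in> {0..1} \<Longrightarrow> norm (f x - g x) < e / 2"
        using Stone_Weierstrass_polynomial_function[of "{0..1::real}" f "e/2"]
          continuous_on_subset[OF f(1), of "{0..1}"] \<open>0 < e\<close>
        by (metis compact_Icc half_gt_zero subset_UNIV)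
      have close: "\<bar>expectation (\<lambda>\<omega>. f (?U Z \<omega>)) - expectation (\<lambda>\<omega>. g (?U Z \<omega>))\<bar> \<le> e / 2"
        if i: "integrable M (\<lambda>\<omega>. f (?U Z \<omega>))" "integrable M (\<lambda>\<omega>. g (?U Z \<omega>))"
          and "\<And>\<omega>. \<omega> \<in> space M \<Longrightarrow> ?U Z \<omega> \<in> {0..1}" for Z
      proof -
        have "\<bar>expectation (\<lambda>\<omega>. f (?U Z \<omega>) - g (?U Z \<omega>))\<bar> \<le> expectation (\<lambda>\<omega>. \<bar>f (?U Z \<omega>) - g (?U Z \<omega>)\<bar>)"
          by (rule integral_abs_bound)
        also have "\<dots> \<le> expectation (\<lambda>_. e / 2)"
          using i g(2) that(3) by (intro integral_mono_AE AE_I2) (auto intro!: less_imp_le)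
        finally show ?thesis using i by (simp add: prob_space)
      qed
      show ?thesis
        using close[OF int(1) poly_int(1)[OF g(1)] U01(1)] close[OF int(2) poly_int(2)[OF g(1)] U01(2)]
          poly_eq[OF g(1)] by linarith
    qed
    hence "\<bar>expectation (\<lambda>\<omega>. f (?U X \<omega>)) - expectation (\<lambda>\<omega>. f (?U Y \<omega>))\<bar> \<le> 0"
      by (rule field_le_epsilon)
    thus ?thesis by simp
  qed
  define c where "c = exp (- t)"
  \<comment> \<open>Continuous ramps decreasing to the indicator of \<open>x \<ge> c\<close>; with \<open>x = exp (- Z)\<close> this is \<open>Z \<le> t\<close>.\<close>
  define f where "f = (\<lambda>n x. max 0 (min 1 (1 + real n * (x - c))))"
  have lim: "(\<lambda>n. expectation (\<lambda>\<omega>. f n (?U Z \<omega>))) \<longlonglongrightarrow> prob {\<omega> \<in> space M. Z \<omega> \<le> t}"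
    if [measurable]: "Z \<in> borel_measurable M" for Z
  proof -
    have "(\<lambda>n. expectation (\<lambda>\<omega>. f n (?U Z \<omega>))) \<longlonglongrightarrow> expectation (indicator {\<omega> \<in> space M. Z \<omega> \<le> t})"
    proof (rule integral_dominated_convergence[where w="\<lambda>_. 1"])
      show "AE \<omega> in M. (\<lambda>n. f n (?U Z \<omega>)) \<longlonglongrightarrow> indicator {\<omega> \<in> space M. Z \<omega> \<le> t} \<omega>"
      proof (rule AE_I2)
        fix \<omega> assume w: "\<omega> \<in> space M"
        show "(\<lambda>n. f n (?U Z \<omega>)) \<longlonglongrightarrow> indicator {\<omega> \<in> space M. Z \<omega> \<le> t} \<omega>"
        proof (cases "Z \<omega> \<le> t")
          case True
          hence "f n (?U Z \<omega>) = 1" for n by (simp add: f_def c_def)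
          thus ?thesis using w True by simp
        next
          case False
          hence d: "?U Z \<omega> - c < 0" by (simp add: c_def)
          have "filterlim (\<lambda>n. real n * (c - ?U Z \<omega>)) at_top sequentially"
            using d by (intro filterlim_at_top_mult_tendsto_pos[OF tendsto_const _ filterlim_real_sequentially, THEN filterlim_cong[THEN iffD1, OF refl refl, rotated]]) (auto simp: mult.commute)
          hence "\<forall>\<^sub>F n in sequentially. 1 \<le> real n * (c - ?U Z \<omega>)"
            by (simp add: filterlim_at_top)
          hence "\<forall>\<^sub>F n in sequentially. f n (?U Z \<omega>) = 0"
            by eventually_elim (auto simp: f_def algebra_simps)
          thus ?thesis using False by (simp add: tendsto_eventually)
        qed
      qed
    qed (auto simp: f_def)
    thus ?thesis by simp
  qed
  have "expectation (\<lambda>\<omega>. f n (?U X \<omega>)) = expectation (\<lambda>\<omega>. f n (?U Y \<omega>))" for n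
    by (rule cont_eq) (auto simp: f_def intro!: continuous_intros)
  with lim[of X] lim[of Y] show ?thesis by (auto intro: LIMSEQ_unique)
qed

lemma nn_integral_power_layer:
  fixes x :: real
  assumes "0 \<le> x" "0 < n" and I: "I = {0<..<x} \<or> I = {0<..x}"
  shows "(\<integral>\<^sup>+z. ennreal (real n * z ^ (n - 1)) * indicator I z \<partial>lborel) = ennreal (x ^ n)"
proof -
  have "(\<integral>\<^sup>+z. ennreal (real n * z ^ (n - 1)) * indicator {0..x} z \<partial>lborel) = ennreal (x ^ n - 0 ^ n)"
    using assms by (intro nn_integral_FTC_Icc) (auto intro!: derivative_eq_intros simp: zero_le_mult_iff)
  moreover have "(\<integral>\<^sup>+z. ennreal (real n * z ^ (n - 1)) * indicator I z \<partial>lborel) =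
      (\<integral>\<^sup>+z. ennreal (real n * z ^ (n - 1)) * indicator {0..x} z \<partial>lborel)"
  proof (rule nn_integral_cong_AE)
    have "AE z in lborel. z \<noteq> (0::real) \<and> z \<noteq> x"
      using AE_lborel_singleton[of "0::real"] AE_lborel_singleton[of x] by auto
    thus "AE z in lborel. ennreal (real n * z ^ (n - 1)) * indicator I z =
        ennreal (real n * z ^ (n - 1)) * indicator {0..x} z"
      by eventually_elim (use I in \<open>auto simp: indicator_def\<close>)
  qed
  ultimately show ?thesis using assms by simp
qed

text \<open>
  The layer-cake formula does not see the difference between strict and weak tail probabilities,
  which agree for almost every \<open>z\<close>. Any \<open>h\<close> between the two gives the moment, so two variables
  that share such an \<open>h\<close> have equal moments.
\<close>

lemma (in prob_space) moment_layer_cake: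
  fixes X :: "'a \<Rightarrow> real"
  assumes [measurable]: "X \<in> borel_measurable M" and X: "\<And>\<omega>. \<omega> \<in> space M \<Longrightarrow> 0 \<le> X \<omega>"
    and n: "0 < n"
    and lower: "\<And>z. 0 < z \<Longrightarrow> prob {\<omega> \<in> space M. z < X \<omega>} \<le> h z"
    and upper: "\<And>z. 0 < z \<Longrightarrow> h z \<le> prob {\<omega> \<in> space M. z \<le> X \<omega>}"
  shows "(\<integral>\<^sup>+\<omega>. ennreal (X \<omega> ^ n) \<partial>M) =
     (\<integral>\<^sup>+z. ennreal (real n * z ^ (n - 1)) * (indicator {0<..} z * ennreal (h z)) \<partial>lborel)"
proof -
  interpret P: pair_sigma_finite M lborel ..
  have layer: "(\<integral>\<^sup>+\<omega>. ennreal (X \<omega> ^ n) \<partial>M) =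
     (\<integral>\<^sup>+z. ennreal (real n * z ^ (n - 1)) * (indicator {0<..} z * emeasure M {\<omega> \<in> space M. R z (X \<omega>)}) \<partial>lborel)"
    if [measurable]: "Measurable.pred (M \<Otimes>\<^sub>M lborel) (\<lambda>(\<omega>, z). R z (X \<omega>))"
      and R: "R = (<) \<or> R = (\<le>)" for R
  proof -
    have "(\<integral>\<^sup>+\<omega>. ennreal (X \<omega> ^ n) \<partial>M) =
       (\<integral>\<^sup>+\<omega>. (\<integral>\<^sup>+z. ennreal (real n * z ^ (n - 1)) * (indicator {0<..} z * (if R z (X \<omega>) then 1 else 0)) \<partial>lborel) \<partial>M)"
    proof (rule nn_integral_cong)
      fix \<omega> assume w: "\<omega> \<in> space M"
      have "indicator {0<..} z * (if R z (X \<omega>) then 1 else 0) = (indicator {z. 0 < z \<and> R z (X \<omega>)} z :: ennreal)" for z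
        by (auto simp: indicator_def)
      moreover have "{z. 0 < z \<and> R z (X \<omega>)} = {0<..<X \<omega>} \<or> {z. 0 < z \<and> R z (X \<omega>)} = {0<..X \<omega>}"
        using R by auto
      ultimately show "ennreal (X \<omega> ^ n) =
        (\<integral>\<^sup>+z. ennreal (real n * z ^ (n - 1)) * (indicator {0<..} z * (if R z (X \<omega>) then 1 else 0)) \<partial>lborel)"
        using nn_integral_power_layer[OF X[OF w] n] by simp
    qed
    also have "\<dots> = (\<integral>\<^sup>+z. (\<integral>\<^sup>+\<omega>. ennreal (real n * z ^ (n - 1)) * (indicator {0<..} z * (if R z (X \<omega>) then 1 else 0)) \<partial>M) \<partial>lborel)"
      by (rule P.Fubini'[symmetric]) measurable
    also have "\<dots> = (\<integral>\<^sup>+z. ennreal (real n * z ^ (n - 1)) * (indicator {0<..} z * emeasure M {\<omega> \<in> space M. R z (X \<omega>)}) \<partial>lborel)"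
    proof (rule nn_integral_cong)
      fix z :: real
      have [measurable]: "Measurable.pred M (\<lambda>\<omega>. R z (X \<omega>))"
        using R by (elim disjE) simp_all
      have "(\<integral>\<^sup>+\<omega>. (if R z (X \<omega>) then 1 else 0) \<partial>M) = (\<integral>\<^sup>+\<omega>. indicator {\<omega> \<in> space M. R z (X \<omega>)} \<omega> \<partial>M)"
        by (rule nn_integral_cong) (simp add: indicator_def)
      thus "(\<integral>\<^sup>+\<omega>. ennreal (real n * z ^ (n - 1)) * (indicator {0<..} z * (if R z (X \<omega>) then 1 else 0)) \<partial>M) =
        ennreal (real n * z ^ (n - 1)) * (indicator {0<..} z * emeasure M {\<omega> \<in> space M. R z (X \<omega>)})"
        by (simp add: nn_integral_cmult)
    qed
    finally show ?thesis .
  qed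
  show ?thesis
  proof (rule antisym)
    show "(\<integral>\<^sup>+\<omega>. ennreal (X \<omega> ^ n) \<partial>M) \<le>
       (\<integral>\<^sup>+z. ennreal (real n * z ^ (n - 1)) * (indicator {0<..} z * ennreal (h z)) \<partial>lborel)"
    proof (subst layer[of "(<)"])
      show "Measurable.pred (M \<Otimes>\<^sub>M lborel) (\<lambda>(\<omega>, z). z < X \<omega>)" by simp
      show "(\<integral>\<^sup>+z. ennreal (real n * z ^ (n - 1)) * (indicator {0<..} z * emeasure M {\<omega> \<in> space M. z < X \<omega>}) \<partial>lborel)
        \<le> (\<integral>\<^sup>+z. ennreal (real n * z ^ (n - 1)) * (indicator {0<..} z * ennreal (h z)) \<partial>lborel)"
      proof (rule nn_integral_mono, rule mult_left_mono)
        fix z :: real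
        show "indicator {0<..} z * emeasure M {\<omega> \<in> space M. z < X \<omega>} \<le> indicator {0<..} z * ennreal (h z)"
          using ennreal_leI[OF lower[of z]] by (cases "0 < z") (simp_all add: emeasure_eq_measure)
      qed simp_all
    qed simp_all
    show "(\<integral>\<^sup>+z. ennreal (real n * z ^ (n - 1)) * (indicator {0<..} z * ennreal (h z)) \<partial>lborel)
       \<le> (\<integral>\<^sup>+\<omega>. ennreal (X \<omega> ^ n) \<partial>M)"
    proof (subst layer[of "(\<le>)"])
      show "Measurable.pred (M \<Otimes>\<^sub>M lborel) (\<lambda>(\<omega>, z). z \<le> X \<omega>)" by simp
      show "(\<integral>\<^sup>+z. ennreal (real n * z ^ (n - 1)) * (indicator {0<..} z * ennreal (h z)) \<partial>lborel)
        \<le> (\<integral>\<^sup>+z. ennreal (real n * z ^ (n - 1)) * (indicator {0<..} z * emeasure M {\<omega> \<in> space M. z \<le> X \<omega>}) \<partial>lborel)"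
      proof (rule nn_integral_mono, rule mult_left_mono)
        fix z :: real
        show "indicator {0<..} z * ennreal (h z) \<le> indicator {0<..} z * emeasure M {\<omega> \<in> space M. z \<le> X \<omega>}"
          using ennreal_leI[OF upper[of z]] by (cases "0 < z") (simp_all add: emeasure_eq_measure)
      qed simp_all
    qed simp_all
  qed
qed

text \<open>
  The substitution \<open>k = y powr (1 / \<nu>)\<close> reduces this to the Gamma integral.
\<close>

lemma stretched_exponential_integral:
  fixes \<nu> :: real
  assumes nu: "0 < \<nu>" and n: "0 < n"
  shows "(\<integral>\<^sup>+k. indicator {0<..} k * ennreal (k powr (\<nu> * real n - 1) * exp (- (k powr \<nu>))) \<partial>lborel) =
     ennreal (Gamma (real n) / \<nu>)"
proof -
  let ?f = "\<lambda>k. k powr (\<nu> * real n - 1) * exp (- (k powr \<nu>))"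
  let ?g = "\<lambda>y::real. y powr (1 / \<nu>)" and ?g' = "\<lambda>y::real. 1 / \<nu> * y powr (1 / \<nu> - 1)"
  have G: "has_bochner_integral lborel (\<lambda>x. 1 / \<nu> * (indicator {0<..} x * (x powr (real n - 1) * exp (- 1 * x))))
      (1 / \<nu> * (Gamma (real n) * 1 powr (- real n)))"
    using n by (intro has_bochner_integral_mult_right Gamma_scaled_has_bochner_integral) auto
  have fg: "?f (?g y) * ?g' y = 1 / \<nu> * (y powr (real n - 1) * exp (- y))" if "0 < y" for y
  proof -
    have "y powr (1 / \<nu> * (\<nu> * real n - 1)) * y powr (1 / \<nu> - 1) = y powr (real n - 1)"
    proof -
      have "1 / \<nu> * (\<nu> * real n - 1) + (1 / \<nu> - 1) = real n - 1"
        using nu by (simp add: right_diff_distrib)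
      thus ?thesis by (simp only: powr_add[symmetric])
    qed
    thus ?thesis using nu that by (simp add: powr_powr)
  qed
  have e: "einterval 0 \<infinity> = {0::real<..}" by (auto simp: einterval_def)
  have fgi: "indicator {0<..} y *\<^sub>R (?f (?g y) * ?g' y) =
      1 / \<nu> * (indicator {0<..} y * (y powr (real n - 1) * exp (- 1 * y)))" for y
    by (cases "0 < y") (simp_all add: fg indicator_def del: times_divide_eq_left)
  have int_fg: "set_integrable lborel (einterval 0 \<infinity>) (\<lambda>y. ?f (?g y) * ?g' y)"
    using G unfolding set_integrable_def e fgi by (simp only: has_bochner_integral_iff)
  have lim0: "((ereal \<circ> ?g \<circ> real_of_ereal) \<longlongrightarrow> 0) (at_right 0)"
  proof -
    have "(?g \<longlongrightarrow> 0) (at_right 0)"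
      using nu by (auto intro!: tendsto_eq_intros simp: eventually_at_filter)
    hence "((\<lambda>x. ereal (?g x)) \<longlongrightarrow> ereal 0) (at_right 0)" by simp
    thus ?thesis
      using ereal_tendsto_simps(2)[of "\<lambda>x. ereal (?g x)" "ereal 0" 0] by (simp add: o_def zero_ereal_def)
  qed
  have limI: "((ereal \<circ> ?g \<circ> real_of_ereal) \<longlongrightarrow> \<infinity>) (at_left \<infinity>)"
  proof -
    have "filterlim ?g at_top at_top" using nu by real_asymp
    hence "((\<lambda>x. ereal (?g x)) \<longlongrightarrow> \<infinity>) at_top"
      by (simp add: tendsto_PInfty_eq_at_top)
    hence "((\<lambda>x. ereal (real_of_ereal (ereal x) powr (1 / \<nu>))) \<longlongrightarrow> \<infinity>) at_top" by simp
    thus ?thesis unfolding o_def at_left_PInf filterlim_filtermap .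
  qed
  note sub = interval_integral_substitution_nonneg[where f="?f" and g="?g" and g'="?g'" and a=0 and b=\<infinity> and A=0 and B=\<infinity>,
      OF _ _ _ _ _ _ lim0 limI int_fg]
  have d: "DERIV ?g x :> ?g' x" if "0 < x" for x
    using that by (auto intro!: derivative_eq_intros)
  have c1: "isCont ?f (?g x)" if "0 < x" for x using that nu by (auto intro!: continuous_intros)
  have c2: "isCont ?g' x" if "0 < x" for x using that nu by (auto intro!: continuous_intros)
  have s: "set_integrable lborel (einterval 0 \<infinity>) ?f"
     "(LBINT x=0..\<infinity>. ?f x) = (LBINT x=0..\<infinity>. ?f (?g x) * ?g' x)"
    by (rule sub; use d c1 c2 nu in \<open>simp add: zero_ereal_def\<close>)+
  have "(LBINT x=0..\<infinity>. ?f (?g x) * ?g' x) = 1 / \<nu> * Gamma (real n)"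
    using G unfolding interval_lebesgue_integral_def set_lebesgue_integral_def e fgi
    by (simp add: has_bochner_integral_iff)
  with s have "has_bochner_integral lborel (\<lambda>x. indicator {0<..} x * ?f x) (Gamma (real n) / \<nu>)"
    unfolding set_integrable_def interval_lebesgue_integral_def set_lebesgue_integral_def e
    by (simp add: has_bochner_integral_iff)
  hence "(\<integral>\<^sup>+x. ennreal (indicator {0<..} x * ?f x) \<partial>lborel) = ennreal (Gamma (real n) / \<nu>)"
    by (subst nn_integral_eq_integral) (auto simp: has_bochner_integral_iff)
  moreover have "ennreal (indicator {0<..} x * ?f x) = indicator {0<..} x * ennreal (?f x)" for x
    by (auto simp: indicator_def)
  ultimately show ?thesis by simp
qed

section \<open>Negative moments and first exceedance times\<close>


text \<open>
  Markov's inequality for \<open>exp (- k X)\<close>.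
\<close>

lemma (in prob_space) laplace_tail:
  fixes X :: "'a \<Rightarrow> real"
  assumes [measurable]: "X \<in> borel_measurable M" and X: "\<And>\<omega>. \<omega> \<in> space M \<Longrightarrow> 0 \<le> X \<omega>" and k: "0 \<le> k"
  shows "prob {\<omega> \<in> space M. X \<omega> \<le> t} \<le> exp (k * t) * expectation (\<lambda>\<omega>. exp (- k * X \<omega>))"
proof -
  have int: "integrable M (\<lambda>\<omega>. exp (- k * X \<omega>))"
    using X k by (intro integrable_const_bound[where B=1]) (auto intro!: AE_I2)
  have "prob {\<omega> \<in> space M. X \<omega> \<le> t} = expectation (indicator {\<omega> \<in> space M. X \<omega> \<le> t})" by simp
  also have "\<dots> \<le> expectation (\<lambda>\<omega>. exp (k * t) * exp (- k * X \<omega>))"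
  proof (intro integral_mono)
    show "integrable M (\<lambda>\<omega>. exp (k * t) * exp (- k * X \<omega>))" using int by (rule integrable_mult_right)
    fix \<omega> assume "\<omega> \<in> space M"
    show "indicator {\<omega> \<in> space M. X \<omega> \<le> t} \<omega> \<le> exp (k * t) * exp (- k * X \<omega>)"
      using k by (auto simp: indicator_def exp_add[symmetric] mult_left_mono simp flip: right_diff_distrib)
  qed (auto intro!: integrable_real_indicator simp: less_top[symmetric])
  also have "\<dots> = exp (k * t) * expectation (\<lambda>\<omega>. exp (- k * X \<omega>))" by simp
  finally show ?thesis .
qed

text \<open>
  Mellin transform: \<open>\<Gamma>(r) x\<^sup>-\<^sup>r\<close> is the integral of \<open>k\<^sup>r\<^sup>-\<^sup>1 exp (- k x)\<close> over \<open>k > 0\<close>. By Tonelli the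
  expectation becomes an integral of the Laplace transform \<open>exp (- k\<^sup>\<nu>)\<close>.
\<close>

lemma (in prob_space) stable_negative_moment:
  fixes X :: "'a \<Rightarrow> real"
  assumes [measurable]: "X \<in> borel_measurable M" and X: "\<And>\<omega>. \<omega> \<in> space M \<Longrightarrow> 0 \<le> X \<omega>"
    and nu: "0 < \<nu>" and n: "0 < n"
    and laplace: "\<And>k. 0 < k \<Longrightarrow> expectation (\<lambda>\<omega>. exp (- k * X \<omega>)) = exp (- (k powr \<nu>))"
    and pos: "AE \<omega> in M. 0 < X \<omega>"
  shows "(\<integral>\<^sup>+\<omega>. ennreal (X \<omega> powr (- (\<nu> * real n))) \<partial>M) = ennreal (fact n / Gamma (\<nu> * real n + 1))"
proof -
  interpret P: pair_sigma_finite M lborel ..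
  define r where "r = \<nu> * real n"
  have r: "0 < r" using nu n by (simp add: r_def)
  have "ennreal (Gamma r) * (\<integral>\<^sup>+\<omega>. ennreal (X \<omega> powr (- r)) \<partial>M) =
      (\<integral>\<^sup>+\<omega>. ennreal (Gamma r) * ennreal (X \<omega> powr (- r)) \<partial>M)"
    by (subst nn_integral_cmult) auto
  also have "\<dots> = (\<integral>\<^sup>+\<omega>. (\<integral>\<^sup>+k. indicator {0<..} k * ennreal (k powr (r - 1) * exp (- k * X \<omega>)) \<partial>lborel) \<partial>M)"
  proof (rule nn_integral_cong_AE)
    show "AE \<omega> in M. ennreal (Gamma r) * ennreal (X \<omega> powr (- r)) =
      (\<integral>\<^sup>+k. indicator {0<..} k * ennreal (k powr (r - 1) * exp (- k * X \<omega>)) \<partial>lborel)"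
      using pos
    proof eventually_elim
      fix \<omega> assume Xp: "0 < X \<omega>"
      have "(\<integral>\<^sup>+k. ennreal (indicator {0<..} k * (k powr (r - 1) * exp (- X \<omega> * k))) \<partial>lborel) =
          ennreal (Gamma r * X \<omega> powr (- r))"
        using Gamma_scaled_has_bochner_integral[OF r Xp]
        by (subst nn_integral_eq_integral) (auto simp: has_bochner_integral_iff)
      moreover have "ennreal (indicator {0<..} k * (k powr (r - 1) * exp (- X \<omega> * k))) =
          indicator {0<..} k * ennreal (k powr (r - 1) * exp (- k * X \<omega>))" for k
        by (simp add: indicator_def mult.commute)
      ultimately show "ennreal (Gamma r) * ennreal (X \<omega> powr (- r)) =
          (\<integral>\<^sup>+k. indicator {0<..} k * ennreal (k powr (r - 1) * exp (- k * X \<omega>)) \<partial>lborel)"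
        using r by (simp add: ennreal_mult less_imp_le)
    qed
  qed
  also have "\<dots> = (\<integral>\<^sup>+k. (\<integral>\<^sup>+\<omega>. indicator {0<..} k * ennreal (k powr (r - 1) * exp (- k * X \<omega>)) \<partial>M) \<partial>lborel)"
    by (rule P.Fubini'[symmetric]) measurable
  also have "\<dots> = (\<integral>\<^sup>+k. indicator {0<..} k * ennreal (k powr (r - 1) * exp (- (k powr \<nu>))) \<partial>lborel)"
  proof (rule nn_integral_cong)
    fix k :: real
    show "(\<integral>\<^sup>+\<omega>. indicator {0<..} k * ennreal (k powr (r - 1) * exp (- k * X \<omega>)) \<partial>M) =
      indicator {0<..} k * ennreal (k powr (r - 1) * exp (- (k powr \<nu>)))"
    proof (cases "0 < k")
      case True
      have int: "integrable M (\<lambda>\<omega>. exp (- k * X \<omega>))"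
        using X True by (intro integrable_const_bound[where B=1]) (auto intro!: AE_I2)
      have "(\<integral>\<^sup>+\<omega>. ennreal (k powr (r - 1) * exp (- k * X \<omega>)) \<partial>M) =
         ennreal (expectation (\<lambda>\<omega>. k powr (r - 1) * exp (- k * X \<omega>)))"
        using int by (intro nn_integral_eq_integral integrable_mult_right) auto
      also have "\<dots> = ennreal (k powr (r - 1) * exp (- (k powr \<nu>)))"
        using laplace[OF True] by simp
      finally show ?thesis using True by simp
    qed simp
  qed
  also have "\<dots> = ennreal (Gamma (real n) / \<nu>)"
    unfolding r_def by (rule stretched_exponential_integral[OF nu n])
  finally have eq: "ennreal (Gamma r) * (\<integral>\<^sup>+\<omega>. ennreal (X \<omega> powr (- r)) \<partial>M) = ennreal (Gamma (real n) / \<nu>)" .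
  have Gr: "0 < Gamma r" using r by (rule Gamma_real_pos)
  have "(\<integral>\<^sup>+\<omega>. ennreal (X \<omega> powr (- r)) \<partial>M) =
     ennreal (1 / Gamma r) * (ennreal (Gamma r) * (\<integral>\<^sup>+\<omega>. ennreal (X \<omega> powr (- r)) \<partial>M))"
    using Gr by (simp add: mult.assoc[symmetric] ennreal_mult[symmetric])
  also have "\<dots> = ennreal (1 / Gamma r * (Gamma (real n) / \<nu>))"
    unfolding eq using Gr nu n by (intro ennreal_mult[symmetric]) (auto intro!: Gamma_real_nonneg)
  also have "1 / Gamma r * (Gamma (real n) / \<nu>) = fact n / Gamma (\<nu> * real n + 1)"
  proof -
    have "Gamma (r + 1) = r * Gamma r" using r by (intro Gamma_plus1) (auto elim!: nonpos_Ints_cases)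
    moreover have "(fact n :: real) = real n * Gamma (real n)"
      using n by (cases n) (simp_all add: Gamma_fact)
    ultimately show ?thesis using n nu Gr by (simp add: r_def field_simps)
  qed
  finally show ?thesis unfolding r_def .
qed

lemma inverse_process_nonneg: "0 \<le> inverse_process A t \<omega>"
  unfolding inverse_process_def by (auto intro!: cInf_greatest)

lemma inverse_process_less_imp:
  assumes "0 \<le> z" "z < inverse_process A t \<omega>"
  shows "A z \<omega> \<le> t"
proof (rule ccontr)
  let ?S = "{z. 0 \<le> z \<and> A z \<omega> > t}"
  assume "\<not> A z \<omega> \<le> t"
  hence z: "z \<in> ?S" using assms by auto
  have "Inf ?S \<le> z" by (rule cInf_lower[OF z]) (auto intro!: bdd_belowI[of _ 0])
  thus False using z assms by (auto simp: inverse_process_def split: if_splits)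
qed

lemma le_inverse_process:
  assumes mono: "mono_on {0..} (\<lambda>z. A z \<omega>)" and z: "0 \<le> z" "A z \<omega> \<le> t" and ex: "0 \<le> x" "t < A x \<omega>"
  shows "z \<le> inverse_process A t \<omega>"
proof -
  let ?S = "{z. 0 \<le> z \<and> A z \<omega> > t}"
  have "z \<le> Inf ?S"
  proof (rule cInf_greatest)
    show "?S \<noteq> {}" using ex by auto
    fix s assume s: "s \<in> ?S"
    show "z \<le> s"
    proof (rule ccontr)
      assume "\<not> z \<le> s"
      hence "A s \<omega> \<le> A z \<omega>" using s z by (intro monotone_onD[OF mono]) auto
      thus False using s z by auto
    qed
  qed
  thus ?thesis using ex by (auto simp: inverse_process_def)
qed

text \<open>
  By monotonicity the infimum may be taken over the rationals, which gives measurability. In extended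
  reals the infimum of the empty set is \<open>\<infinity>\<close>, and \<open>real_of_ereal\<close> maps it to \<open>0\<close>, the default value of
  \<open>inverse_process\<close>.
\<close>

lemma inverse_process_rational:
  assumes mono: "mono_on {0..} (\<lambda>z. A z \<omega>)"
  shows "inverse_process A t \<omega> =
    real_of_ereal (INF r\<in>{r\<in>\<rat>. 0 \<le> r}. if A r \<omega> > t then ereal r else \<infinity>)"
proof -
  let ?S = "{z. 0 \<le> z \<and> A z \<omega> > t}"
  let ?f = "\<lambda>r. if A r \<omega> > t then ereal r else \<infinity>"
  show ?thesis
  proof (cases "?S = {}")
    case True
    hence "?f r = \<infinity>" if "r \<in> {r\<in>\<rat>. 0 \<le> r}" for r using that by auto
    hence "\<infinity> \<le> (INF r\<in>{r\<in>\<rat>. 0 \<le> r}. ?f r)" by (intro INF_greatest) simp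
    hence "(INF r\<in>{r\<in>\<rat>. 0 \<le> r}. ?f r) = \<infinity>" by (simp only: ereal_infty_less_eq)
    thus ?thesis using True by (simp only: inverse_process_def real_of_ereal.simps simp_thms if_True)
  next
    case False
    have "(INF r\<in>{r\<in>\<rat>. 0 \<le> r}. ?f r) = ereal (Inf ?S)"
    proof (rule INF_eqI)
      fix r :: real assume r: "r \<in> {r\<in>\<rat>. 0 \<le> r}"
      show "ereal (Inf ?S) \<le> ?f r"
        using r by (auto intro!: cInf_lower bdd_belowI[of _ 0])
    next
      fix y :: ereal assume y: "\<And>r. r \<in> {r\<in>\<rat>. 0 \<le> r} \<Longrightarrow> y \<le> ?f r"
      show "y \<le> ereal (Inf ?S)"
      proof (rule ccontr)
        assume "\<not> y \<le> ereal (Inf ?S)"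
        then obtain c where c: "Inf ?S < c" "ereal c < y"
          using ereal_dense2[of "ereal (Inf ?S)" y] by (auto simp: not_le)
        then obtain z where z: "z \<in> ?S" "z < c" using cInf_lessD[OF False] by blast
        obtain q where q: "q \<in> \<rat>" "z < q" "q < c" using Rats_dense_in_real[OF z(2)] by blast
        have "A z \<omega> \<le> A q \<omega>" using z q by (intro monotone_onD[OF mono]) auto
        hence "y \<le> ereal q" using y[of q] z q by auto
        hence "y < ereal c" using q(3) by (auto intro: le_less_trans)
        with c show False by simp
      qed
    qed
    thus ?thesis using False by (simp only: inverse_process_def if_False real_of_ereal.simps)
  qed
qed

section \<open>Moments of the inverse stable subordinator\<close>


text \<open>
  The functional of a path computed by \<open>inverse_process\<close>, as a measurable function on the product space.
  Independence of whole processes then passes to the inverse process.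
\<close>

definition first_exceedance :: "real \<Rightarrow> (real \<Rightarrow> real) \<Rightarrow> real" where
  "first_exceedance t a = real_of_ereal (INF r\<in>{r\<in>\<rat>. 0 \<le> r}. if a r > t then ereal r else \<infinity>)"

lemma countable_nonneg_rationals: "countable {r\<in>\<rat>. 0 \<le> (r::real)}"
  by (rule countable_subset[OF _ countable_rat]) auto

lemma first_exceedance_measurable [measurable]:
  "first_exceedance t \<in> borel_measurable (Pi\<^sub>M {0..} (\<lambda>_. borel))"
proof -
  have [measurable]: "(\<lambda>a. a r) \<in> borel_measurable (Pi\<^sub>M {0..} (\<lambda>_. borel))" if "0 \<le> r" for r :: real
    using that by (intro measurable_component_singleton) auto
  have "(\<lambda>a. INF r\<in>{r\<in>\<rat>. 0 \<le> r}. if a r > t then ereal r else \<infinity>) \<in>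
      borel_measurable (Pi\<^sub>M {0..} (\<lambda>_. borel))"
    by (intro borel_measurable_INF countable_nonneg_rationals) auto
  thus ?thesis unfolding first_exceedance_def[abs_def] by measurable
qed

lemma subordinator_paths:
  assumes "subordinator M X"
  shows "0 \<le> t \<Longrightarrow> X t \<in> borel_measurable M"
    and "\<omega> \<in> space M \<Longrightarrow> X 0 \<omega> = 0"
    and "\<omega> \<in> space M \<Longrightarrow> mono_on {0..} (\<lambda>t. X t \<omega>)"
    and "\<omega> \<in> space M \<Longrightarrow> 0 \<le> t \<Longrightarrow> 0 \<le> X t \<omega>"
    and "\<omega> \<in> space M \<Longrightarrow> 0 \<le> t \<Longrightarrow> continuous (at_right t) (\<lambda>t. X t \<omega>)"
proof -
  show "0 \<le> t \<Longrightarrow> X t \<in> borel_measurable M"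
    and z: "\<omega> \<in> space M \<Longrightarrow> X 0 \<omega> = 0"
    and m: "\<omega> \<in> space M \<Longrightarrow> mono_on {0..} (\<lambda>t. X t \<omega>)"
    and "\<omega> \<in> space M \<Longrightarrow> 0 \<le> t \<Longrightarrow> continuous (at_right t) (\<lambda>t. X t \<omega>)"
    using assms by (auto simp: subordinator_def)
  show "\<omega> \<in> space M \<Longrightarrow> 0 \<le> t \<Longrightarrow> 0 \<le> X t \<omega>"
    using monotone_onD[OF m, of 0 t] z by auto
qed

lemma inverse_process_eq_first_exceedance:
  assumes "subordinator M A" "\<omega> \<in> space M"
  shows "inverse_process A t \<omega> = first_exceedance t (\<lambda>z\<in>{0..}. A z \<omega>)"
proof -
  have "(INF r\<in>{r\<in>\<rat>. 0 \<le> r}. if A r \<omega> > t then ereal r else \<infinity>) =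
     (INF r\<in>{r\<in>\<rat>. 0 \<le> r}. if (\<lambda>z\<in>{0..}. A z \<omega>) r > t then ereal r else \<infinity>)"
    by (intro INF_cong) auto
  thus ?thesis
    unfolding first_exceedance_def using inverse_process_rational[where A=A and \<omega>=\<omega>, OF subordinator_paths(3)[OF assms]] by simp
qed

lemma inverse_process_measurable:
  assumes "subordinator M A"
  shows "inverse_process A t \<in> borel_measurable M"
proof -
  have "(\<lambda>\<omega>. \<lambda>z\<in>{0..}. A z \<omega>) \<in> measurable M (Pi\<^sub>M {0..} (\<lambda>_. borel))"
    using subordinator_paths(1)[OF assms] by (intro measurable_restrict) auto
  hence "(\<lambda>\<omega>. first_exceedance t (\<lambda>z\<in>{0..}. A z \<omega>)) \<in> borel_measurable M"
    by (rule measurable_compose[OF _ first_exceedance_measurable])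
  thus ?thesis
    using inverse_process_eq_first_exceedance[OF assms] by (subst measurable_cong) auto
qed

lemma (in prob_space) stable_laplace:
  assumes "stable_subordinator M \<nu> A" "0 \<le> t" "0 < k"
  shows "expectation (\<lambda>\<omega>. exp (- k * A t \<omega>)) = exp (- (k powr \<nu>) * t)"
  using assms by (simp add: stable_subordinator_def)

text \<open>
  \<open>Pr(A(t) \<le> 0) \<le> exp (- k\<^sup>\<nu> t)\<close> for every \<open>k\<close>.
\<close>

lemma (in prob_space) stable_positive:
  assumes A: "stable_subordinator M \<nu> A" and nu: "0 < \<nu>" and t: "0 < t"
  shows "AE \<omega> in M. 0 < A t \<omega>"
proof -
  have sub: "subordinator M A" using A by (simp add: stable_subordinator_def)
  note paths = subordinator_paths[OF sub]
  have [measurable]: "A t \<in> borel_measurable M" using paths(1) t by simp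
  have bound: "prob {\<omega> \<in> space M. A t \<omega> \<le> 0} \<le> exp (- (k powr \<nu>) * t)" if "0 < k" for k
    using laplace_tail[of "A t" k 0] stable_laplace[OF A, of t k] paths(4)[of _ t] that t by simp
  have "filterlim (\<lambda>k. exp (- (k powr \<nu>) * t)) (nhds 0) at_top"
    using nu t by real_asymp
  hence "prob {\<omega> \<in> space M. A t \<omega> \<le> 0} \<le> 0"
  proof (rule tendsto_lowerbound)
    show "\<forall>\<^sub>F k in at_top. prob {\<omega> \<in> space M. A t \<omega> \<le> 0} \<le> exp (- (k powr \<nu>) * t)"
      by (rule eventually_mono[OF eventually_gt_at_top[of 0] bound])
  qed simp
  hence "prob {\<omega> \<in> space M. A t \<omega> \<le> 0} = 0" by (simp add: antisym)
  hence "AE \<omega> in M. \<not> A t \<omega> \<le> 0"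
    by (subst (asm) prob_eq_0) (auto elim: eventually_mono)
  thus ?thesis by (auto elim!: eventually_mono)
qed

text \<open>
  \<open>Pr(A(n) \<le> t) \<le> exp (t - n)\<close>. This excludes, almost surely, the empty set in the definition of the
  inverse process.
\<close>

lemma (in prob_space) stable_unbounded:
  assumes A: "stable_subordinator M \<nu> A"
  shows "AE \<omega> in M. \<exists>x\<ge>0. t < A x \<omega>"
proof -
  have sub: "subordinator M A" using A by (simp add: stable_subordinator_def)
  note paths = subordinator_paths[OF sub]
  have [measurable]: "A (real n) \<in> borel_measurable M" for n using paths(1) by simp
  have bound: "prob {\<omega> \<in> space M. \<forall>n. A (real n) \<omega> \<le> t} \<le> exp (t - real n)" for n
  proof -
    have "prob {\<omega> \<in> space M. \<forall>n. A (real n) \<omega> \<le> t} \<le> prob {\<omega> \<in> space M. A (real n) \<omega> \<le> t}"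
      by (intro finite_measure_mono) auto
    also have "\<dots> \<le> exp (1 * t) * expectation (\<lambda>\<omega>. exp (- 1 * A (real n) \<omega>))"
      using paths(4) by (intro laplace_tail) auto
    also have "\<dots> = exp (t - real n)"
      using stable_laplace[OF A, of "real n" 1] by (simp add: exp_diff exp_minus divide_inverse)
    finally show ?thesis .
  qed
  have "(\<lambda>n. exp (t - real n)) \<longlonglongrightarrow> 0" by real_asymp
  hence "prob {\<omega> \<in> space M. \<forall>n. A (real n) \<omega> \<le> t} \<le> 0"
    by (rule tendsto_lowerbound) (rule always_eventually, rule allI, rule bound, simp)
  hence "prob {\<omega> \<in> space M. \<forall>n. A (real n) \<omega> \<le> t} = 0" by (simp add: antisym)
  hence "AE \<omega> in M. \<not> (\<forall>n. A (real n) \<omega> \<le> t)"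
    by (subst (asm) prob_eq_0) (auto elim: eventually_mono)
  thus ?thesis by eventually_elim (metis not_le of_nat_0_le_iff)
qed

lemma (in prob_space) stable_self_similar:
  assumes A: "stable_subordinator M \<nu> A" and nu: "0 < \<nu>" and z: "0 < z"
  shows "prob {\<omega> \<in> space M. A z \<omega> \<le> t} = prob {\<omega> \<in> space M. z powr (1 / \<nu>) * A 1 \<omega> \<le> t}"
proof -
  have sub: "subordinator M A" using A by (simp add: stable_subordinator_def)
  note paths = subordinator_paths[OF sub]
  have [measurable]: "A z \<in> borel_measurable M" "A 1 \<in> borel_measurable M" using paths(1) z by auto
  show ?thesis
  proof (rule laplace_determines_cdf)
    fix k :: real assume k: "0 < k"
    have "expectation (\<lambda>\<omega>. exp (- (k * z powr (1 / \<nu>)) * A 1 \<omega>)) = exp (- ((k * z powr (1 / \<nu>)) powr \<nu>))"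
      using stable_laplace[OF A, of 1 "k * z powr (1 / \<nu>)"] k z by simp
    also have "(k * z powr (1 / \<nu>)) powr \<nu> = k powr \<nu> * z"
      using k z nu by (simp add: powr_mult powr_powr)
    finally show "expectation (\<lambda>\<omega>. exp (- k * A z \<omega>)) = expectation (\<lambda>\<omega>. exp (- k * (z powr (1 / \<nu>) * A 1 \<omega>)))"
      using stable_laplace[OF A, of z k] k z by (simp add: mult.assoc)
  qed (use paths(4) z in auto)
qed

text \<open>
  \<open>Pr(A(z) \<le> t)\<close> lies between the strict and the weak tail probability of the inverse process at \<open>z\<close>.
  By self-similarity it is also \<open>Pr(z \<le> (t / A(1))\<^sup>\<nu>)\<close>, so the inverse process has the moments of
  \<open>(t / A(1))\<^sup>\<nu>\<close>.
\<close>

lemma (in prob_space) inverse_stable_moment: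
  assumes A: "stable_subordinator M \<nu> A" and nu: "0 < \<nu>" and t: "0 < t"
  shows "(\<integral>\<^sup>+\<omega>. ennreal (inverse_process A t \<omega> ^ n) \<partial>M) =
     ennreal (fact n * t powr (\<nu> * real n) / Gamma (\<nu> * real n + 1))"
proof (cases "n = 0")
  case True
  then show ?thesis using t by (simp add: emeasure_space_1)
next
  case False
  have sub: "subordinator M A" using A by (simp add: stable_subordinator_def)
  note paths = subordinator_paths[OF sub]
  have Am [measurable]: "A z \<in> borel_measurable M" if "0 \<le> z" for z using paths(1) that .
  note [measurable] = inverse_process_measurable[OF sub]
  have [measurable]: "A 1 \<in> borel_measurable M" by (rule Am) simp
  let ?L = "inverse_process A t" and ?V = "\<lambda>\<omega>. (t / A 1 \<omega>) powr \<nu>"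
  let ?h = "\<lambda>z. prob {\<omega> \<in> space M. A z \<omega> \<le> t}"
  have pos1: "AE \<omega> in M. 0 < A 1 \<omega>" using stable_positive[OF A nu] by simp
  have hV: "?h z = prob {\<omega> \<in> space M. z \<le> ?V \<omega>}" if z: "0 < z" for z
    unfolding stable_self_similar[OF A nu z]
  proof (rule finite_measure_eq_AE)
    show "AE \<omega> in M. (\<omega> \<in> {\<omega> \<in> space M. z powr (1 / \<nu>) * A 1 \<omega> \<le> t}) = (\<omega> \<in> {\<omega> \<in> space M. z \<le> ?V \<omega>})"
      using pos1
    proof eventually_elim
      fix \<omega> assume p: "0 < A 1 \<omega>"
      have "z powr (1 / \<nu>) * A 1 \<omega> \<le> t \<longleftrightarrow> z powr (1 / \<nu>) \<le> t / A 1 \<omega>"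
        using p by (simp add: pos_le_divide_eq)
      also have "\<dots> \<longleftrightarrow> (z powr (1 / \<nu>)) powr \<nu> \<le> (t / A 1 \<omega>) powr \<nu>"
        using powr_mono2[of \<nu> "z powr (1 / \<nu>)" "t / A 1 \<omega>"]
          powr_less_mono2[of \<nu> "t / A 1 \<omega>" "z powr (1 / \<nu>)"] p t nu by (force simp: not_le)
      also have "(z powr (1 / \<nu>)) powr \<nu> = z" using nu z by (simp add: powr_powr)
      finally show "(\<omega> \<in> {\<omega> \<in> space M. z powr (1 / \<nu>) * A 1 \<omega> \<le> t}) = (\<omega> \<in> {\<omega> \<in> space M. z \<le> ?V \<omega>})"
        by simp
    qed
  qed measurable
  have "(\<integral>\<^sup>+\<omega>. ennreal (?L \<omega> ^ n) \<partial>M) =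
     (\<integral>\<^sup>+z. ennreal (real n * z ^ (n - 1)) * (indicator {0<..} z * ennreal (?h z)) \<partial>lborel)"
  proof (rule moment_layer_cake)
    fix z :: real assume z: "0 < z"
    have [measurable]: "A z \<in> borel_measurable M" using z by simp
    show "prob {\<omega> \<in> space M. z < ?L \<omega>} \<le> ?h z"
      using inverse_process_less_imp[of z A t] z by (intro finite_measure_mono) auto
    show "?h z \<le> prob {\<omega> \<in> space M. z \<le> ?L \<omega>}"
    proof (rule finite_measure_mono_AE)
      show "AE \<omega> in M. \<omega> \<in> {\<omega> \<in> space M. A z \<omega> \<le> t} \<longrightarrow> \<omega> \<in> {\<omega> \<in> space M. z \<le> ?L \<omega>}"
        using stable_unbounded[OF A, of t]
      proof eventually_elim
        case (elim \<omega>)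
        then obtain x where "0 \<le> x" "t < A x \<omega>" by blast
        then show ?case
          using le_inverse_process[where A=A and \<omega>=\<omega> and z=z and t=t and x=x] paths(3)[of \<omega>] z by auto
      qed
    qed measurable
  qed (use False inverse_process_nonneg in auto)
  also have "\<dots> = (\<integral>\<^sup>+\<omega>. ennreal (?V \<omega> ^ n) \<partial>M)"
    by (rule moment_layer_cake[symmetric]) (use False hV in \<open>auto intro!: finite_measure_mono\<close>)
  also have "\<dots> = (\<integral>\<^sup>+\<omega>. ennreal (t powr (\<nu> * real n)) * ennreal (A 1 \<omega> powr (- (\<nu> * real n))) \<partial>M)"
  proof (rule nn_integral_cong_AE)
    show "AE \<omega> in M. ennreal (?V \<omega> ^ n) = ennreal (t powr (\<nu> * real n)) * ennreal (A 1 \<omega> powr (- (\<nu> * real n)))"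
      using pos1
    proof eventually_elim
      fix \<omega> assume p: "0 < A 1 \<omega>"
      have "?V \<omega> ^ n = (t / A 1 \<omega>) powr (\<nu> * real n)"
        using p t by (simp add: powr_mult_nat)
      also have "\<dots> = t powr (\<nu> * real n) * A 1 \<omega> powr (- (\<nu> * real n))"
        using p t by (simp add: powr_divide powr_minus_divide)
      finally show "ennreal (?V \<omega> ^ n) = ennreal (t powr (\<nu> * real n)) * ennreal (A 1 \<omega> powr (- (\<nu> * real n)))"
        by (simp add: ennreal_mult)
    qed
  qed
  also have "\<dots> = ennreal (t powr (\<nu> * real n)) * ennreal (fact n / Gamma (\<nu> * real n + 1))"
  proof (subst nn_integral_cmult)
    have "(\<integral>\<^sup>+\<omega>. ennreal (A 1 \<omega> powr (- (\<nu> * real n))) \<partial>M) = ennreal (fact n / Gamma (\<nu> * real n + 1))"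
    proof (rule stable_negative_moment)
      show "expectation (\<lambda>\<omega>. exp (- k * A 1 \<omega>)) = exp (- (k powr \<nu>))" if "0 < k" for k
        using stable_laplace[OF A, of 1 k] that by simp
    qed (use nu False pos1 paths(4) in auto)
    thus "ennreal (t powr (\<nu> * real n)) * (\<integral>\<^sup>+\<omega>. ennreal (A 1 \<omega> powr (- (\<nu> * real n))) \<partial>M) =
       ennreal (t powr (\<nu> * real n)) * ennreal (fact n / Gamma (\<nu> * real n + 1))" by simp
  qed simp
  also have "\<dots> = ennreal (fact n * t powr (\<nu> * real n) / Gamma (\<nu> * real n + 1))"
  proof -
    have "0 < Gamma (\<nu> * real n + 1)" using nu by (auto intro!: Gamma_real_pos add_nonneg_pos)
    thus ?thesis by (simp add: ennreal_mult[symmetric] mult.commute)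
  qed
  finally show ?thesis .
qed

text \<open>
  The \<open>n\<close>-th derivative at \<open>0\<close> of \<open>P(s) exp (- lam s)\<close>.
\<close>

definition tilt_taylor :: "real \<Rightarrow> real poly \<Rightarrow> nat \<Rightarrow> real" where
  "tilt_taylor lam P n = (-1) ^ n * poly ((tilt lam ^^ n) P) 0"

lemma tilt_taylor_sums:
  "(\<lambda>n. tilt_taylor lam P n / fact n * s ^ n) sums (poly P s * exp (- lam * s))"
proof -
  have "(\<lambda>n. (- s) ^ n / fact n * poly ((tilt lam ^^ n) P) 0) sums
      (exp (lam * (- s)) * poly (pcompose P [:- (- s), 1:]) 0)"
    by (rule tilt_exp_shift[where phi="\<lambda>Q. poly Q 0"]) simp_all
  thus ?thesis
    by (simp add: tilt_taylor_def poly_pcompose power_minus[of s] mult_ac)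
qed

text \<open>
  The Taylor series of \<open>P(s) exp (- lam s)\<close> is integrated termwise against the law of the inverse
  process. The geometric bound on its coefficients makes the series of absolute moments converge.
\<close>

lemma (in prob_space) inverse_stable_tilted_poly:
  assumes A: "stable_subordinator M \<nu> A" and nu: "0 < \<nu>" and t: "0 < t" and lam: "0 \<le> lam"
  shows "expectation (\<lambda>\<omega>. poly P (inverse_process A t \<omega>) * exp (- lam * inverse_process A t \<omega>)) =
     frac_series \<nu> (tilt_taylor lam P) t"
proof -
  have sub: "subordinator M A" using A by (simp add: stable_subordinator_def)
  note [measurable] = inverse_process_measurable[OF sub]
  let ?L = "inverse_process A t"
  let ?b = "tilt_taylor lam P"
  obtain C R where CR: "0 \<le> C" "0 < R" "\<And>n. \<bar>poly ((tilt lam ^^ n) P) 0\<bar> \<le> C * R ^ n"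
    using tilt_coeff_bound[OF lam, of P] by blast
  have b: "\<bar>?b n\<bar> \<le> C * R ^ n" for n using CR(3)[of n] by (simp add: tilt_taylor_def abs_mult)
  have Gp: "0 < Gamma (\<nu> * real n + 1)" for n using nu by (auto intro!: Gamma_real_pos add_nonneg_pos)
  have mom: "has_bochner_integral M (\<lambda>\<omega>. ?L \<omega> ^ n) (fact n * t powr (\<nu> * real n) / Gamma (\<nu> * real n + 1))" for n
    using Gp[of n] inverse_process_nonneg[of A t]
    by (intro has_bochner_integral_nn_integral inverse_stable_moment[OF A nu t]) auto
  define f where "f = (\<lambda>n \<omega>. ?b n / fact n * ?L \<omega> ^ n)"
  have f: "has_bochner_integral M (f n) (?b n * t powr (\<nu> * real n) / Gamma (\<nu> * real n + 1))" for n
    using has_bochner_integral_mult_right[OF mom[of n], where c="?b n / fact n"] by (simp add: f_def)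
  have int: "integrable M (f n)" for n using f by (auto simp: has_bochner_integral_iff)
  have absf: "(\<integral>\<omega>. norm (f n \<omega>) \<partial>M) = \<bar>?b n\<bar> * (t powr \<nu>) ^ n / Gamma (\<nu> * real n + 1)" for n
  proof -
    have "(\<lambda>\<omega>. norm (f n \<omega>)) = (\<lambda>\<omega>. \<bar>?b n\<bar> / fact n * ?L \<omega> ^ n)"
      using inverse_process_nonneg[of A t] by (simp add: f_def abs_mult)
    thus ?thesis
      using has_bochner_integral_mult_right[OF mom[of n], where c="\<bar>?b n\<bar> / fact n"]
      by (simp add: has_bochner_integral_iff powr_mult_nat[OF t])
  qed
  have 1: "AE \<omega> in M. summable (\<lambda>n. norm (f n \<omega>))"
  proof (rule AE_I2)
    fix \<omega>
    have "summable (\<lambda>n. C * ((R * ?L \<omega>) ^ n /\<^sub>R fact n))"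
      by (intro summable_mult summable_exp_generic)
    thus "summable (\<lambda>n. norm (f n \<omega>))"
    proof (rule summable_comparison_test_ev[rotated], intro always_eventually allI)
      fix n
      have "\<bar>?b n\<bar> * ?L \<omega> ^ n \<le> C * R ^ n * ?L \<omega> ^ n"
        using b inverse_process_nonneg[of A t] by (intro mult_right_mono) auto
      thus "norm (norm (f n \<omega>)) \<le> C * ((R * ?L \<omega>) ^ n /\<^sub>R fact n)"
        using inverse_process_nonneg[of A t \<omega>]
        by (simp add: f_def abs_mult power_mult_distrib field_simps)
    qed
  qed
  have 2: "summable (\<lambda>n. \<integral>\<omega>. norm (f n \<omega>) \<partial>M)"
    unfolding absf using CR by (intro frac_series_abs_summable[OF nu b]) auto
  have "expectation (\<lambda>\<omega>. poly P (?L \<omega>) * exp (- lam * ?L \<omega>)) = expectation (\<lambda>\<omega>. \<Sum>n. f n \<omega>)"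
    using tilt_taylor_sums[of lam P] by (simp add: f_def sums_iff)
  also have "\<dots> = (\<Sum>n. expectation (f n))" by (rule integral_suminf[OF int 1 2])
  also have "\<dots> = frac_series \<nu> ?b t"
    using f by (simp add: frac_series_def has_bochner_integral_iff)
  finally show ?thesis .
qed

section \<open>Integer-valued processes at independent random times\<close>


text \<open>
  Right-continuity of an integer-valued path. In this form it composes with nondecreasing
  right-continuous time changes, which may be constant to the right of a point.
\<close>

definition locally_right_constant :: "(real \<Rightarrow> nat) \<Rightarrow> real \<Rightarrow> bool" where
  "locally_right_constant f x \<longleftrightarrow> (\<exists>\<delta>>0. \<forall>y. x \<le> y \<and> y < x + \<delta> \<longrightarrow> f y = f x)"

lemma locally_right_constant_if_continuous:
  fixes f :: "real \<Rightarrow> nat"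
  assumes "continuous (at_right x) (\<lambda>y. real (f y))"
  shows "locally_right_constant f x"
proof -
  have "\<forall>\<^sub>F y in at_right x. dist (real (f y)) (real (f x)) < 1"
    using assms by (intro tendstoD) (auto simp: continuous_within)
  then obtain b where b: "x < b" "\<And>y. x < y \<Longrightarrow> y < b \<Longrightarrow> dist (real (f y)) (real (f x)) < 1"
    unfolding eventually_at_right_field by blast
  have eq: "f y = f x" if "x \<le> y" "y < x + (b - x)" for y
  proof (cases "x = y")
    case False
    hence "dist (real (f y)) (real (f x)) < 1" using that by (intro b(2)) auto
    thus ?thesis by (simp add: dist_real_def)
  qed simp
  show ?thesis
    unfolding locally_right_constant_def
  proof (intro exI conjI allI impI)
    show "0 < b - x" using b(1) by simp
  qed (use eq in blast)
qed

lemma locally_right_constant_compose: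
  fixes g :: "real \<Rightarrow> real"
  assumes g: "mono_on {0..} g" "continuous (at_right s) g" and s: "0 \<le> s"
    and f: "locally_right_constant f (g s)"
  shows "locally_right_constant (\<lambda>y. f (g y)) s"
proof -
  obtain \<delta> where d: "0 < \<delta>" "\<And>y. g s \<le> y \<Longrightarrow> y < g s + \<delta> \<Longrightarrow> f y = f (g s)"
    using f unfolding locally_right_constant_def by blast
  have "\<forall>\<^sub>F y in at_right s. dist (g y) (g s) < \<delta>"
    using g(2) d(1) by (intro tendstoD) (auto simp: continuous_within)
  then obtain b where b: "s < b" "\<And>y. s < y \<Longrightarrow> y < b \<Longrightarrow> dist (g y) (g s) < \<delta>"
    unfolding eventually_at_right_field by blast
  have eq: "f (g y) = f (g s)" if "s \<le> y" "y < s + (b - s)" for y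
  proof (cases "s = y")
    case False
    hence "dist (g y) (g s) < \<delta>" using that by (intro b(2)) auto
    moreover have "g s \<le> g y" using that s by (intro monotone_onD[OF g(1)]) auto
    ultimately show ?thesis by (intro d(2)) (auto simp: dist_real_def)
  qed simp
  show ?thesis
    unfolding locally_right_constant_def
  proof (intro exI conjI allI impI)
    show "0 < b - s" using b(1) by simp
  qed (use eq in blast)
qed

lemma (in prob_space) expectation_indicator_Collect:
  "expectation (indicator {\<omega> \<in> space M. P \<omega>}) = prob {\<omega> \<in> space M. P \<omega>}"
proof -
  have "{\<omega> \<in> space M. P \<omega>} \<inter> space M = {\<omega> \<in> space M. P \<omega>}" by auto
  thus ?thesis by (simp only: Bochner_Integration.integral_indicator)
qed

text \<open>
  For fixed times the claim is the independence hypothesis. It extends to random times with values in a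
  countable grid by summation over the grid, and to \<open>\<tau>\<close> by approximating it from the right.
  The event \<open>C\<close> is carried along so that the result can be applied twice: first to \<open>N\<close> at
  the time \<open>\<Gamma>(u)\<close> with \<open>C\<close> describing the clock, then to \<open>N(\<Gamma>(\<cdot>))\<close> at the clock itself.
\<close>

lemma (in prob_space) process_at_random_time:
  fixes X :: "real \<Rightarrow> 'a \<Rightarrow> nat" and \<tau> :: "'a \<Rightarrow> real" and \<psi> :: "real \<Rightarrow> real"
  assumes X [measurable]: "\<And>s. 0 \<le> s \<Longrightarrow> X s \<in> measurable M (count_space UNIV)"
    and rc: "\<And>\<omega> s. \<omega> \<in> space M \<Longrightarrow> 0 \<le> s \<Longrightarrow> locally_right_constant (\<lambda>s. X s \<omega>) s"
    and \<tau> [measurable]: "\<tau> \<in> borel_measurable M" and \<tau>0: "\<And>\<omega>. \<omega> \<in> space M \<Longrightarrow> 0 \<le> \<tau> \<omega>"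
    and C [measurable]: "C \<in> events"
    and indep: "\<And>s B. 0 \<le> s \<Longrightarrow> B \<in> sets borel \<Longrightarrow>
       prob {\<omega> \<in> space M. X s \<omega> = k \<and> \<tau> \<omega> \<in> B \<and> \<omega> \<in> C} = \<psi> s * prob {\<omega> \<in> space M. \<tau> \<omega> \<in> B \<and> \<omega> \<in> C}"
    and \<psi>: "continuous_on {0..} \<psi>" "\<And>s. 0 \<le> s \<Longrightarrow> \<bar>\<psi> s\<bar> \<le> 1"
  shows "{\<omega> \<in> space M. X (\<tau> \<omega>) \<omega> = k} \<in> events"
    and "prob {\<omega> \<in> space M. X (\<tau> \<omega>) \<omega> = k \<and> \<omega> \<in> C} = expectation (\<lambda>\<omega>. \<psi> (\<tau> \<omega>) * indicator C \<omega>)"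
proof -
  \<comment> \<open>The grid points \<open>(\<lfloor>n \<tau>\<rfloor> + 1) / n\<close>, with \<open>n\<close> replaced by \<open>Suc n\<close>, lie strictly to the right of \<open>\<tau>\<close>.\<close>
  define J where "J = (\<lambda>n \<omega>. nat \<lfloor>real (Suc n) * \<tau> \<omega>\<rfloor>)"
  define d where "d = (\<lambda>n j. real (Suc j) / real (Suc n))"
  define \<tau>' where "\<tau>' = (\<lambda>n \<omega>. d n (J n \<omega>))"
  have J [measurable]: "J n \<in> measurable M (count_space UNIV)" for n unfolding J_def by measurable
  have d0: "0 \<le> d n j" for n j by (simp add: d_def)
  have \<tau>'_bounds: "\<tau> \<omega> < \<tau>' n \<omega>" "\<tau>' n \<omega> \<le> \<tau> \<omega> + 1 / real (Suc n)" if "\<omega> \<in> space M" for n \<omega>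
  proof -
    have "0 \<le> real (Suc n) * \<tau> \<omega>" using \<tau>0[OF that] by simp
    hence "real (J n \<omega>) = of_int \<lfloor>real (Suc n) * \<tau> \<omega>\<rfloor>" by (simp add: J_def)
    hence e: "real (Suc (J n \<omega>)) = of_int \<lfloor>real (Suc n) * \<tau> \<omega>\<rfloor> + 1" by simp
    have lo: "real (Suc n) * \<tau> \<omega> < real (Suc (J n \<omega>))"
      and up: "real (Suc (J n \<omega>)) \<le> real (Suc n) * \<tau> \<omega> + 1"
      unfolding e using floor_correct[of "real (Suc n) * \<tau> \<omega>"] by linarith+
    have pos: "0 < real (Suc n)" by simp
    have cancel: "(y + 1 / x) * x = x * y + 1" if "x \<noteq> 0" for x y :: real
      using that by (simp add: field_simps)
    show "\<tau> \<omega> < \<tau>' n \<omega>"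
      unfolding \<tau>'_def d_def pos_less_divide_eq[OF pos] using lo by (simp only: mult.commute)
    show "\<tau>' n \<omega> \<le> \<tau> \<omega> + 1 / real (Suc n)"
      unfolding \<tau>'_def d_def pos_divide_le_eq[OF pos] cancel[OF less_imp_neq[OF pos, symmetric]] by (rule up)
  qed
  have \<tau>'_lim: "(\<lambda>n. \<tau>' n \<omega>) \<longlonglongrightarrow> \<tau> \<omega>" if "\<omega> \<in> space M" for \<omega>
  proof (rule tendsto_sandwich)
    show "\<forall>\<^sub>F n in sequentially. \<tau> \<omega> \<le> \<tau>' n \<omega>"
      using \<tau>'_bounds(1)[OF that] by (intro always_eventually allI less_imp_le)
    show "\<forall>\<^sub>F n in sequentially. \<tau>' n \<omega> \<le> \<tau> \<omega> + 1 / real (Suc n)"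
      by (intro always_eventually allI \<tau>'_bounds(2)[OF that])
    have "(\<lambda>n. 1 / real (Suc n)) \<longlonglongrightarrow> 0" by (rule LIMSEQ_Suc[OF lim_1_over_n])
    from tendsto_add[OF tendsto_const this, of "\<tau> \<omega>"]
    show "(\<lambda>n. \<tau> \<omega> + 1 / real (Suc n)) \<longlonglongrightarrow> \<tau> \<omega>" by (simp only: add_0_right)
  qed (rule tendsto_const)
  define g where "g = (\<lambda>n \<omega>. if X (\<tau>' n \<omega>) \<omega> = k then 1 else 0 :: real)"
  define g0 where "g0 = (\<lambda>\<omega>. if X (\<tau> \<omega>) \<omega> = k then 1 else 0 :: real)"
  have g [measurable]: "g n \<in> borel_measurable M" for n
  proof -
    have [measurable]: "(\<lambda>\<omega>. X (d n j) \<omega>) \<in> measurable M (count_space UNIV)" for j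
      using d0 by (rule X)
    have "(\<lambda>\<omega>. X (d n (J n \<omega>)) \<omega>) \<in> measurable M (count_space UNIV)"
      by (rule measurable_compose_countable[where f="\<lambda>j \<omega>. X (d n j) \<omega>"]) measurable
    thus ?thesis unfolding g_def \<tau>'_def by measurable
  qed
  have g_lim: "(\<lambda>n. g n \<omega>) \<longlonglongrightarrow> g0 \<omega>" if w: "\<omega> \<in> space M" for \<omega>
  proof -
    obtain \<delta> where \<delta>: "0 < \<delta>" "\<And>y. \<tau> \<omega> \<le> y \<Longrightarrow> y < \<tau> \<omega> + \<delta> \<Longrightarrow> X y \<omega> = X (\<tau> \<omega>) \<omega>"
      using rc[OF w \<tau>0[OF w]] unfolding locally_right_constant_def by blast
    have "\<forall>\<^sub>F n in sequentially. \<tau>' n \<omega> < \<tau> \<omega> + \<delta>"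
      using \<tau>'_lim[OF w] \<delta>(1) by (intro order_tendstoD(2)) auto
    hence "\<forall>\<^sub>F n in sequentially. g n \<omega> = g0 \<omega>"
    proof eventually_elim
      case (elim n)
      then show ?case using \<delta>(2)[of "\<tau>' n \<omega>"] \<tau>'_bounds(1)[OF w, of n] by (simp add: g_def g0_def)
    qed
    thus ?thesis by (rule tendsto_eventually)
  qed
  have g0 [measurable]: "g0 \<in> borel_measurable M"
    by (rule borel_measurable_LIMSEQ_real[OF g_lim g])
  have "{\<omega> \<in> space M. X (\<tau> \<omega>) \<omega> = k} = {\<omega> \<in> space M. g0 \<omega> = 1}" by (auto simp: g0_def)
  also have "\<dots> \<in> events" by measurable
  finally show ev: "{\<omega> \<in> space M. X (\<tau> \<omega>) \<omega> = k} \<in> events" .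
  have [measurable]: "(indicator C :: 'a \<Rightarrow> real) \<in> borel_measurable M" by measurable
  have step: "expectation (\<lambda>\<omega>. g n \<omega> * indicator C \<omega>) = expectation (\<lambda>\<omega>. \<psi> (\<tau>' n \<omega>) * indicator C \<omega>)" for n
  proof -
    let ?A = "\<lambda>j. {\<omega> \<in> space M. J n \<omega> = j \<and> \<omega> \<in> C}"
    have A [measurable]: "?A j \<in> events" for j by measurable
    have UN: "(\<Union>j. ?A j) = C" using sets.sets_into_space[OF C] by auto
    have disj: "i \<noteq> j \<Longrightarrow> ?A i \<inter> ?A j = {}" for i j by auto
    have split: "expectation (\<lambda>\<omega>. f \<omega> * indicator C \<omega>) = (\<Sum>j. LINT \<omega>:?A j|M. f \<omega>)"
      if [measurable]: "f \<in> borel_measurable M" and "\<And>\<omega>. \<bar>f \<omega>\<bar> \<le> 1" for f :: "'a \<Rightarrow> real"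
    proof -
      have si: "set_integrable M C f"
        unfolding set_integrable_def
      proof (rule integrable_const_bound[where B=1])
        have "norm (indicator C \<omega> *\<^sub>R f \<omega>) \<le> 1" for \<omega>
          using that(2)[of \<omega>] by (simp add: indicator_def)
        thus "AE \<omega> in M. norm (indicator C \<omega> *\<^sub>R f \<omega>) \<le> 1" by (rule AE_I2)
      qed measurable
      have "(LINT \<omega>:(\<Union>j. ?A j)|M. f \<omega>) = (\<Sum>j. LINT \<omega>:?A j|M. f \<omega>)"
        by (rule lebesgue_integral_countable_add[OF A disj], assumption, simp only: UN si)
      thus ?thesis unfolding UN by (simp add: set_lebesgue_integral_def mult.commute)
    qed
    have 1: "(LINT \<omega>:?A j|M. g n \<omega>) = \<psi> (d n j) * prob (?A j)" for j
    proof -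
      \<comment> \<open>On the event \<open>\<tau> \<in> ?B\<close> the approximating time is the constant \<open>d n j\<close>.\<close>
      let ?B = "{x::real. nat \<lfloor>real (Suc n) * x\<rfloor> = j}"
      have B: "?B \<in> sets borel" by measurable
      have "(LINT \<omega>:?A j|M. g n \<omega>) = expectation (indicator {\<omega> \<in> space M. X (d n j) \<omega> = k \<and> \<tau> \<omega> \<in> ?B \<and> \<omega> \<in> C})"
        unfolding set_lebesgue_integral_def
        by (intro Bochner_Integration.integral_cong) (auto simp: g_def \<tau>'_def J_def indicator_def)
      also have "\<dots> = prob {\<omega> \<in> space M. X (d n j) \<omega> = k \<and> \<tau> \<omega> \<in> ?B \<and> \<omega> \<in> C}"
        by (rule expectation_indicator_Collect)
      also have "\<dots> = \<psi> (d n j) * prob {\<omega> \<in> space M. \<tau> \<omega> \<in> ?B \<and> \<omega> \<in> C}"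
        by (rule indep[OF d0 B])
      also have "{\<omega> \<in> space M. \<tau> \<omega> \<in> ?B \<and> \<omega> \<in> C} = ?A j" by (simp add: J_def)
      finally show ?thesis .
    qed
    have 2: "(LINT \<omega>:?A j|M. \<psi> (\<tau>' n \<omega>)) = \<psi> (d n j) * prob (?A j)" for j
    proof -
      have "(LINT \<omega>:?A j|M. \<psi> (\<tau>' n \<omega>)) = expectation (\<lambda>\<omega>. \<psi> (d n j) * indicator (?A j) \<omega>)"
        unfolding set_lebesgue_integral_def
        by (intro Bochner_Integration.integral_cong) (auto simp: \<tau>'_def indicator_def)
      thus ?thesis by simp
    qed
    have [measurable]: "(\<lambda>\<omega>. \<psi> (\<tau>' n \<omega>)) \<in> borel_measurable M"
      unfolding \<tau>'_def by (rule measurable_compose[OF J]) simp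
    have "expectation (\<lambda>\<omega>. g n \<omega> * indicator C \<omega>) = (\<Sum>j. LINT \<omega>:?A j|M. g n \<omega>)"
      by (rule split[OF g]) (simp add: g_def)
    also have "\<dots> = (\<Sum>j. LINT \<omega>:?A j|M. \<psi> (\<tau>' n \<omega>))" unfolding 1 2 ..
    also have "\<dots> = expectation (\<lambda>\<omega>. \<psi> (\<tau>' n \<omega>) * indicator C \<omega>)"
      by (rule split[symmetric]) (auto simp: \<tau>'_def intro!: \<psi>(2) d0)
    finally show ?thesis .
  qed
  have lim1: "(\<lambda>n. expectation (\<lambda>\<omega>. g n \<omega> * indicator C \<omega>)) \<longlonglongrightarrow> expectation (\<lambda>\<omega>. g0 \<omega> * indicator C \<omega>)"
  proof (rule integral_dominated_convergence[where w="\<lambda>_. 1"])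
    show "AE \<omega> in M. (\<lambda>n. g n \<omega> * indicator C \<omega>) \<longlonglongrightarrow> g0 \<omega> * indicator C \<omega>"
      by (intro AE_I2 tendsto_mult g_lim tendsto_const)
    show "AE \<omega> in M. norm (g n \<omega> * indicator C \<omega>) \<le> 1" for n
      by (auto simp: g_def indicator_def)
  qed simp_all
  have \<psi>_lim: "(\<lambda>n. \<psi> (\<tau>' n \<omega>)) \<longlonglongrightarrow> \<psi> (\<tau> \<omega>)" if w: "\<omega> \<in> space M" for \<omega>
    by (rule continuous_on_tendsto_compose[OF \<psi>(1) \<tau>'_lim[OF w]])
       (use \<tau>0[OF w] in \<open>auto simp: \<tau>'_def d0\<close>)
  have [measurable]: "(\<lambda>\<omega>. \<psi> (\<tau>' n \<omega>)) \<in> borel_measurable M" for n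
    unfolding \<tau>'_def by (rule measurable_compose[OF J]) simp
  have [measurable]: "(\<lambda>\<omega>. \<psi> (\<tau> \<omega>)) \<in> borel_measurable M"
    by (rule borel_measurable_LIMSEQ_real[OF \<psi>_lim]) measurable
  have lim2: "(\<lambda>n. expectation (\<lambda>\<omega>. \<psi> (\<tau>' n \<omega>) * indicator C \<omega>)) \<longlonglongrightarrow> expectation (\<lambda>\<omega>. \<psi> (\<tau> \<omega>) * indicator C \<omega>)"
  proof (rule integral_dominated_convergence[where w="\<lambda>_. 1"])
    show "AE \<omega> in M. (\<lambda>n. \<psi> (\<tau>' n \<omega>) * indicator C \<omega>) \<longlonglongrightarrow> \<psi> (\<tau> \<omega>) * indicator C \<omega>"
      by (intro AE_I2 tendsto_mult \<psi>_lim tendsto_const)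
    show "AE \<omega> in M. norm (\<psi> (\<tau>' n \<omega>) * indicator C \<omega>) \<le> 1" for n
      using \<psi>(2)[OF d0] by (auto simp: \<tau>'_def indicator_def)
  qed simp_all
  have "prob {\<omega> \<in> space M. X (\<tau> \<omega>) \<omega> = k \<and> \<omega> \<in> C} = prob ({\<omega> \<in> space M. X (\<tau> \<omega>) \<omega> = k} \<inter> C)"
    by (intro arg_cong[where f=prob]) auto
  also have "\<dots> = expectation (indicator ({\<omega> \<in> space M. X (\<tau> \<omega>) \<omega> = k} \<inter> C))"
    using ev by simp
  also have "\<dots> = expectation (\<lambda>\<omega>. g0 \<omega> * indicator C \<omega>)"
  proof (rule Bochner_Integration.integral_cong[OF refl])
    fix \<omega> assume "\<omega> \<in> space M"
    thus "indicator ({\<omega> \<in> space M. X (\<tau> \<omega>) \<omega> = k} \<inter> C) \<omega> = g0 \<omega> * indicator C \<omega>"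
      by (simp add: g0_def indicator_def)
  qed
  also have "\<dots> = expectation (\<lambda>\<omega>. \<psi> (\<tau> \<omega>) * indicator C \<omega>)"
    by (rule LIMSEQ_unique[OF lim1]) (simp only: step lim2)
  finally show "prob {\<omega> \<in> space M. X (\<tau> \<omega>) \<omega> = k \<and> \<omega> \<in> C} = expectation (\<lambda>\<omega>. \<psi> (\<tau> \<omega>) * indicator C \<omega>)" .
qed

section \<open>The negative binomial law of the subordinated process\<close>


text \<open>
  Mutual independence of the three whole processes, used only for functions of one coordinate of \<open>X\<close>, one
  coordinate of \<open>G\<close>, and one measurable functional of the path of \<open>A\<close>.
\<close>

lemma (in prob_space) indep_processes_expectation:
  fixes f g h :: "real \<Rightarrow> real"
  assumes indep: "indep_processes M [X, G, A]"
    and s: "0 \<le> s" and u: "0 \<le> u" and \<sigma>: "\<sigma> \<in> borel_measurable (Pi\<^sub>M {0..} (\<lambda>_. borel))"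
    and S: "\<And>\<omega>. \<omega> \<in> space M \<Longrightarrow> S \<omega> = \<sigma> (\<lambda>z\<in>{0..}. A z \<omega>)"
    and [measurable]: "f \<in> borel_measurable borel" "g \<in> borel_measurable borel" "h \<in> borel_measurable borel"
    and bound: "\<And>x. \<bar>f x\<bar> \<le> 1" "\<And>x. \<bar>g x\<bar> \<le> 1" "\<And>x. \<bar>h x\<bar> \<le> 1"
  shows "expectation (\<lambda>\<omega>. f (X s \<omega>) * g (G u \<omega>) * h (S \<omega>)) =
     expectation (\<lambda>\<omega>. f (X s \<omega>)) * expectation (\<lambda>\<omega>. g (G u \<omega>)) * expectation (\<lambda>\<omega>. h (S \<omega>))"
proof -
  define Y where "Y = (\<lambda>i::nat. if i = 0 then (\<lambda>a::real \<Rightarrow> real. f (a s)) else if i = 1 then (\<lambda>a. g (a u)) else (\<lambda>a. h (\<sigma> a)))"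
  define Z where "Z = (\<lambda>i \<omega>. Y i (\<lambda>t\<in>{0..}. ([X, G, A] ! i) t \<omega>))"
  note [measurable] = \<sigma>
  have comp: "(\<lambda>a. a r) \<in> borel_measurable (Pi\<^sub>M {0..} (\<lambda>_. borel))" if "0 \<le> r" for r :: real
    using that by (intro measurable_component_singleton) auto
  note [measurable] = comp[OF s] comp[OF u]
  have Y: "Y i \<in> measurable (Pi\<^sub>M {0..} (\<lambda>_. borel)) borel" for i
    unfolding Y_def by simp
  have "indep_vars (\<lambda>_. Pi\<^sub>M {0..} (\<lambda>_. borel)) (\<lambda>i \<omega>. \<lambda>t\<in>{0..}. ([X, G, A] ! i) t \<omega>) {..<3::nat}"
    using indep unfolding indep_processes_def by (simp add: numeral_3_eq_3)
  hence Z: "indep_vars (\<lambda>_. borel) Z {..<3::nat}"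
    unfolding Z_def by (rule indep_vars_compose2) (rule Y)
  have Z_bound: "\<bar>Z i \<omega>\<bar> \<le> 1" for i \<omega>
    using bound by (simp add: Z_def Y_def)
  have Z_meas: "Z i \<in> borel_measurable M" if "i < 3" for i
    using Z that by (auto simp: indep_vars_def)
  have int: "integrable M (Z i)" if "i < 3" for i
    using Z_meas[OF that] Z_bound by (intro integrable_const_bound[where B=1]) auto
  have e0: "Z 0 \<omega> = f (X s \<omega>)" and e1: "Z 1 \<omega> = g (G u \<omega>)" for \<omega>
    using s u by (simp_all add: Z_def Y_def)
  have e2: "Z 2 \<omega> = h (S \<omega>)" if "\<omega> \<in> space M" for \<omega>
    using S[OF that] by (simp add: Z_def Y_def numeral_2_eq_2)
  have set3: "{..<3} = {0, 1, 2::nat}" by auto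
  have "expectation (\<lambda>\<omega>. \<Prod>i\<in>{..<3}. Z i \<omega>) = (\<Prod>i\<in>{..<3}. expectation (Z i))"
    by (rule indep_vars_lebesgue_integral[OF _ Z]) (auto intro: int)
  hence "expectation (\<lambda>\<omega>. Z 0 \<omega> * Z 1 \<omega> * Z 2 \<omega>) =
      expectation (Z 0) * expectation (Z 1) * expectation (Z 2)"
    by (simp add: set3 mult.assoc)
  moreover have "expectation (\<lambda>\<omega>. Z 0 \<omega> * Z 1 \<omega> * Z 2 \<omega>) = expectation (\<lambda>\<omega>. f (X s \<omega>) * g (G u \<omega>) * h (S \<omega>))"
    by (intro Bochner_Integration.integral_cong) (simp_all add: e0 e1[unfolded One_nat_def] e2)
  moreover have "expectation (Z 0) = expectation (\<lambda>\<omega>. f (X s \<omega>))"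
    "expectation (Z 1) = expectation (\<lambda>\<omega>. g (G u \<omega>))"
    "expectation (Z 2) = expectation (\<lambda>\<omega>. h (S \<omega>))"
    by (intro Bochner_Integration.integral_cong; simp add: e0 e1[unfolded One_nat_def] e2)+
  ultimately show ?thesis by simp
qed

text \<open>
  The negative binomial probability with \<open>p powr s\<close> in exponential form, to expose the tilt.
\<close>

definition nb_prob :: "real \<Rightarrow> nat \<Rightarrow> real \<Rightarrow> real" where
  "nb_prob p k s = poly (nb_poly p k) s * exp (- ln (1 / p) * s)"

lemma nb_prob_0: "nb_prob p k 0 = (if k = 0 then 1 else 0)"
  by (simp add: nb_prob_def poly_nb_poly pochhammer_0_left)

definition poisson_prob :: "nat \<Rightarrow> real \<Rightarrow> real" where
  "poisson_prob k x = x ^ k / fact k * exp (- x)"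

lemma poisson_prob_bounds:
  assumes "0 \<le> x" shows "0 \<le> poisson_prob k x" "poisson_prob k x \<le> 1"
proof -
  show "0 \<le> poisson_prob k x" using assms by (simp add: poisson_prob_def)
  show "poisson_prob k x \<le> 1"
  proof (cases "x = 0")
    case False
    hence "poisson_prob k x = pmf (poisson_pmf x) k" using assms by (simp add: poisson_prob_def)
    thus ?thesis by (simp add: pmf_le_1)
  qed (cases k; simp add: poisson_prob_def)
qed

lemma (in prob_space) poisson_process_prob:
  assumes N: "poisson_process M 1 N" and s: "0 \<le> s"
  shows "N s \<in> measurable M (count_space UNIV)"
    and "prob {\<omega> \<in> space M. N s \<omega> = k} = poisson_prob k s"
proof -
  have sub: "subordinator M (\<lambda>t \<omega>. real (N t \<omega>))" using N by (simp add: poisson_process_def)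
  have "(\<lambda>\<omega>. real (N s \<omega>)) \<in> borel_measurable M" using subordinator_paths(1)[OF sub s] .
  hence "(\<lambda>\<omega>. nat \<lfloor>real (N s \<omega>)\<rfloor>) \<in> measurable M (count_space UNIV)" by measurable
  thus meas [measurable]: "N s \<in> measurable M (count_space UNIV)" by simp
  show "prob {\<omega> \<in> space M. N s \<omega> = k} = poisson_prob k s"
  proof (cases "s = 0")
    case True
    hence "{\<omega> \<in> space M. N s \<omega> = k} = (if k = 0 then space M else {})"
      using subordinator_paths(2)[OF sub] by auto
    thus ?thesis using True by (simp add: prob_space poisson_prob_def)
  next
    case False
    hence d: "distr M (count_space UNIV) (N s) = measure_pmf (poisson_pmf (1 * s))"
      using N s by (simp add: poisson_process_def)
    have "{\<omega> \<in> space M. N s \<omega> = k} = N s -` {k} \<inter> space M" by auto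
    hence "prob {\<omega> \<in> space M. N s \<omega> = k} = measure (distr M (count_space UNIV) (N s)) {k}"
      by (simp add: measure_distr)
    also have "\<dots> = pmf (poisson_pmf s) k" unfolding d by (simp add: measure_pmf_single)
    finally show ?thesis using False s by (simp add: poisson_prob_def)
  qed
qed

text \<open>
  A Poisson law with Gamma distributed parameter is negative binomial.
\<close>

lemma (in prob_space) gamma_mixed_poisson:
  assumes G: "gamma_subordinator M (p / (1 - p)) G" and p: "0 < p" "p < 1" and u: "0 \<le> u"
  shows "expectation (\<lambda>\<omega>. poisson_prob k (G u \<omega>)) = nb_prob p k u"
proof (cases "u = 0")
  case True
  have "expectation (\<lambda>\<omega>. poisson_prob k (G u \<omega>)) = expectation (\<lambda>\<omega>. poisson_prob k 0)"
    using G True by (intro Bochner_Integration.integral_cong)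
      (auto simp: gamma_subordinator_def subordinator_paths(2))
  also have "\<dots> = nb_prob p k u"
    unfolding True nb_prob_0 by (simp add: prob_space poisson_prob_def power_0_left)
  finally show ?thesis .
next
  case False
  with u have u: "0 < u" by linarith
  define b where "b = p / (1 - p)"
  have b: "0 < b" using p by (simp add: b_def)
  have "b + 1 = 1 / (1 - p)" using p by (simp add: b_def add_divide_distrib[symmetric] divide_add_eq_iff)
  hence b1: "1 / (b + 1) = 1 - p" by simp
  have [measurable]: "poisson_prob k \<in> borel_measurable borel" unfolding poisson_prob_def[abs_def] by measurable
  have "distributed M lborel (G u) (\<lambda>x. ennreal (gamma_density b u x))"
    using G u by (simp add: gamma_subordinator_def b_def)
  moreover have Gu: "0 < Gamma u" using u by (rule Gamma_real_pos)
  ultimately have "expectation (\<lambda>\<omega>. poisson_prob k (G u \<omega>)) = (\<integral>x. gamma_density b u x * poisson_prob k x \<partial>lborel)"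
    by (intro distributed_integral[symmetric]) (auto simp: gamma_density_def less_imp_le)
  also have "\<dots> = (\<integral>x. b powr u / Gamma u / fact k *
      (indicator {0<..} x * (x powr ((u + real k) - 1) * exp (- (b + 1) * x))) \<partial>lborel)"
  proof (rule integral_cong_AE)
    show "AE x in lborel. gamma_density b u x * poisson_prob k x = b powr u / Gamma u / fact k *
      (indicator {0<..} x * (x powr ((u + real k) - 1) * exp (- (b + 1) * x)))"
      using AE_lborel_singleton[of "0::real"]
    proof eventually_elim
      fix x :: real assume x: "x \<noteq> 0"
      show "gamma_density b u x * poisson_prob k x = b powr u / Gamma u / fact k *
        (indicator {0<..} x * (x powr ((u + real k) - 1) * exp (- (b + 1) * x)))"
      proof (cases "0 < x")
        case True
        have "x powr ((u + real k) - 1) = x powr (u - 1) * x ^ k"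
        proof -
          have "(u + real k) - 1 = (u - 1) + real k" by simp
          thus ?thesis by (simp only: powr_add powr_realpow[OF True])
        qed
        moreover have "exp (- (b + 1) * x) = exp (- b * x) * exp (- x)"
          by (simp add: exp_add[symmetric] algebra_simps)
        ultimately show ?thesis using True by (simp add: gamma_density_def poisson_prob_def)
      qed (use x in \<open>simp add: gamma_density_def\<close>)
    qed
  qed (unfold gamma_density_def[abs_def], measurable)
  also have "\<dots> = b powr u / Gamma u / fact k * (Gamma (u + real k) * (b + 1) powr (- (u + real k)))"
    using has_bochner_integral_mult_right[OF Gamma_scaled_has_bochner_integral[of "u + real k" "b + 1"],
        where c="b powr u / Gamma u / fact k"] u b
    by (simp only: has_bochner_integral_iff)
  also have "\<dots> = nb_prob p k u"
  proof -
    have G1: "Gamma (u + real k) = pochhammer u k * Gamma u"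
    proof -
      have "u \<notin> \<int>\<^sub>\<le>\<^sub>0" using u by (auto elim!: nonpos_Ints_cases)
      from pochhammer_Gamma[OF this, of k] show ?thesis using less_imp_neq[OF Gu] by simp
    qed
    have "(b + 1) powr (- (u + real k)) = (1 / (b + 1)) powr (u + real k)"
    proof -
      have "(1 / (b + 1)) powr (u + real k) = 1 powr (u + real k) / (b + 1) powr (u + real k)"
        by (rule powr_divide)
      thus ?thesis by (simp only: powr_minus_divide powr_one_eq_one)
    qed
    also have "\<dots> = (1 - p) powr u * (1 - p) ^ k"
      using p by (simp add: b1 powr_add powr_realpow)
    finally have 2: "(b + 1) powr (- (u + real k)) = (1 - p) powr u * (1 - p) ^ k" .
    have "b powr u * (1 - p) powr u = p powr u"
      using p b by (simp add: powr_mult[symmetric] b_def)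
    moreover have "p powr u = exp (- ln (1 / p) * u)"
      using p by (simp add: powr_def ln_div mult.commute)
    ultimately have 3: "b powr u * (1 - p) powr u = exp (- ln (1 / p) * u)" by simp
    have "b powr u / Gamma u / fact k * (pochhammer u k * Gamma u * ((1 - p) powr u * (1 - p) ^ k)) =
       (1 - p) ^ k * pochhammer u k / fact k * (b powr u * (1 - p) powr u)"
      using Gu by simp
    thus ?thesis unfolding G1 2 3 nb_prob_def poly_nb_poly .
  qed
  finally show ?thesis .
qed

text \<open>
  Conditioning on the Gamma subordinator first and on the clock \<open>S\<close> second; the evaluation of processes at
  random times is handled by \<open>process_at_random_time\<close> in both steps.
\<close>

lemma (in prob_space) negative_binomial_at_random_time:
  assumes N: "poisson_process M 1 N" and G: "gamma_subordinator M (p / (1 - p)) G" and p: "0 < p" "p < 1"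
    and indep: "indep_processes M [\<lambda>t \<omega>. real (N t \<omega>), G, A]"
    and \<sigma>: "\<sigma> \<in> borel_measurable (Pi\<^sub>M {0..} (\<lambda>_. borel))"
    and S: "\<And>\<omega>. \<omega> \<in> space M \<Longrightarrow> S \<omega> = \<sigma> (\<lambda>z\<in>{0..}. A z \<omega>)"
    and Sm [measurable]: "S \<in> borel_measurable M" and S0: "\<And>\<omega>. \<omega> \<in> space M \<Longrightarrow> 0 \<le> S \<omega>"
  shows "prob {\<omega> \<in> space M. N (G (S \<omega>) \<omega>) \<omega> = k} = expectation (\<lambda>\<omega>. nb_prob p k (S \<omega>))"
proof -
  have subN: "subordinator M (\<lambda>t \<omega>. real (N t \<omega>))" using N by (simp add: poisson_process_def)
  have subG: "subordinator M G" using G by (simp add: gamma_subordinator_def)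
  note pathsG = subordinator_paths[OF subG]
  have Nrc: "locally_right_constant (\<lambda>s. N s \<omega>) s" if "\<omega> \<in> space M" "0 \<le> s" for \<omega> s
    using subordinator_paths(5)[OF subN that] by (rule locally_right_constant_if_continuous)
  have [measurable]: "poisson_prob k \<in> borel_measurable borel" for k
    unfolding poisson_prob_def[abs_def] by measurable
  note factor = indep_processes_expectation[OF indep _ _ \<sigma> S]
  have law: "{\<omega> \<in> space M. N (G u \<omega>) \<omega> = k} \<in> events"
    "prob {\<omega> \<in> space M. N (G u \<omega>) \<omega> = k \<and> S \<omega> \<in> B'} = nb_prob p k u * prob {\<omega> \<in> space M. S \<omega> \<in> B'}"
    if u: "0 \<le> u" and B': "B' \<in> sets borel" for u k B'
  proof -
    note [measurable] = B' pathsG(1)[OF u]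
    let ?C = "{\<omega> \<in> space M. S \<omega> \<in> B'}"
    have C: "?C \<in> events" by measurable
    have ind: "prob {\<omega> \<in> space M. N s \<omega> = k \<and> G u \<omega> \<in> B \<and> \<omega> \<in> ?C} =
        poisson_prob k s * prob {\<omega> \<in> space M. G u \<omega> \<in> B \<and> \<omega> \<in> ?C}"
      if s: "0 \<le> s" and B [measurable]: "B \<in> sets borel" for s B
    proof -
      note [measurable] = poisson_process_prob(1)[OF N s]
      have "prob {\<omega> \<in> space M. N s \<omega> = k \<and> G u \<omega> \<in> B \<and> \<omega> \<in> ?C} =
         expectation (indicator {\<omega> \<in> space M. N s \<omega> = k \<and> G u \<omega> \<in> B \<and> \<omega> \<in> ?C})"
        by (rule expectation_indicator_Collect[symmetric])
      also have "\<dots> = expectation (\<lambda>\<omega>. indicator {real k} (real (N s \<omega>)) * indicator B (G u \<omega>) * indicator B' (S \<omega>))"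
        by (intro Bochner_Integration.integral_cong) (auto simp: indicator_def)
      also have "\<dots> = expectation (\<lambda>\<omega>. indicator {real k} (real (N s \<omega>))) *
          expectation (\<lambda>\<omega>. indicator B (G u \<omega>)) * expectation (\<lambda>\<omega>. indicator B' (S \<omega>))"
        by (rule factor) (use s u in \<open>auto simp: indicator_def\<close>)
      also have "expectation (\<lambda>\<omega>. indicator {real k} (real (N s \<omega>))) = expectation (indicator {\<omega> \<in> space M. N s \<omega> = k})"
        by (intro Bochner_Integration.integral_cong) (auto simp: indicator_def)
      also have "\<dots> = poisson_prob k s" using poisson_process_prob(2)[OF N s] by (simp only: expectation_indicator_Collect)
      finally have 1: "prob {\<omega> \<in> space M. N s \<omega> = k \<and> G u \<omega> \<in> B \<and> \<omega> \<in> ?C} =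
        poisson_prob k s * (expectation (\<lambda>\<omega>. indicator B (G u \<omega>)) * expectation (\<lambda>\<omega>. indicator B' (S \<omega>)))"
        by simp
      have "prob {\<omega> \<in> space M. G u \<omega> \<in> B \<and> \<omega> \<in> ?C} =
         expectation (indicator {\<omega> \<in> space M. G u \<omega> \<in> B \<and> \<omega> \<in> ?C})"
        by (rule expectation_indicator_Collect[symmetric])
      also have "\<dots> = expectation (\<lambda>\<omega>. (\<lambda>_. 1) (real (N s \<omega>)) * indicator B (G u \<omega>) * indicator B' (S \<omega>))"
        by (intro Bochner_Integration.integral_cong) (auto simp: indicator_def)
      also have "\<dots> = expectation (\<lambda>\<omega>. (\<lambda>_. 1) (real (N s \<omega>))) *
          expectation (\<lambda>\<omega>. indicator B (G u \<omega>)) * expectation (\<lambda>\<omega>. indicator B' (S \<omega>))"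
        by (rule factor) (use s u in \<open>auto simp: indicator_def\<close>)
      finally show ?thesis unfolding 1 by (simp add: prob_space)
    qed
    have rt: "{\<omega> \<in> space M. N (G u \<omega>) \<omega> = k} \<in> events"
      "prob {\<omega> \<in> space M. N (G u \<omega>) \<omega> = k \<and> \<omega> \<in> ?C} = expectation (\<lambda>\<omega>. poisson_prob k (G u \<omega>) * indicator ?C \<omega>)"
    proof -
      have cont: "continuous_on {0..} (poisson_prob k)"
        unfolding poisson_prob_def[abs_def] by (intro continuous_intros) auto
      have bd: "\<bar>poisson_prob k s\<bar> \<le> 1" if "0 \<le> s" for s using poisson_prob_bounds[OF that, of k] by simp
      note rt = process_at_random_time[where X=N and \<tau>="G u" and C="?C" and k=k and \<psi>="poisson_prob k",
        OF poisson_process_prob(1)[OF N] Nrc pathsG(1)[OF u] pathsG(4)[OF _ u] C ind cont bd]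
      show "{\<omega> \<in> space M. N (G u \<omega>) \<omega> = k} \<in> events" by (rule rt(1))
      show "prob {\<omega> \<in> space M. N (G u \<omega>) \<omega> = k \<and> \<omega> \<in> ?C} = expectation (\<lambda>\<omega>. poisson_prob k (G u \<omega>) * indicator ?C \<omega>)"
        by (rule rt(2))
    qed
    show "{\<omega> \<in> space M. N (G u \<omega>) \<omega> = k} \<in> events" by (rule rt(1))
    \<comment> \<open>Cut off at negative arguments, where \<open>poisson_prob k\<close> is not bounded by \<open>1\<close>.\<close>
    define g where "g = (\<lambda>x. if 0 \<le> x then poisson_prob k x else 0)"
    have [measurable]: "g \<in> borel_measurable borel" unfolding g_def by measurable
    have gb: "\<bar>g x\<bar> \<le> 1" for x using poisson_prob_bounds[of x k] by (simp add: g_def)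
    have gG: "g (G u \<omega>) = poisson_prob k (G u \<omega>)" if "\<omega> \<in> space M" for \<omega>
      using pathsG(4)[OF that u] by (simp add: g_def)
    have "prob {\<omega> \<in> space M. N (G u \<omega>) \<omega> = k \<and> S \<omega> \<in> B'} = prob {\<omega> \<in> space M. N (G u \<omega>) \<omega> = k \<and> \<omega> \<in> ?C}"
      by (intro arg_cong[where f=prob]) auto
    also have "\<dots> = expectation (\<lambda>\<omega>. poisson_prob k (G u \<omega>) * indicator ?C \<omega>)" by (rule rt(2))
    \<comment> \<open>A constant function of \<open>N\<close> reduces the three-fold factorization to one of \<open>G\<close> and \<open>S\<close>.\<close>
    also have "\<dots> = expectation (\<lambda>\<omega>. (\<lambda>_. 1) (real (N 0 \<omega>)) * g (G u \<omega>) * indicator B' (S \<omega>))"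
      by (intro Bochner_Integration.integral_cong) (auto simp: indicator_def gG)
    also have "\<dots> = expectation (\<lambda>\<omega>. (\<lambda>_. 1) (real (N 0 \<omega>))) * expectation (\<lambda>\<omega>. g (G u \<omega>)) * expectation (\<lambda>\<omega>. indicator B' (S \<omega>))"
      by (rule factor) (use u gb in \<open>auto simp: indicator_def\<close>)
    also have "expectation (\<lambda>\<omega>. g (G u \<omega>)) = expectation (\<lambda>\<omega>. poisson_prob k (G u \<omega>))"
      by (intro Bochner_Integration.integral_cong) (auto simp: gG)
    also have "\<dots> = nb_prob p k u" by (rule gamma_mixed_poisson[OF G p u])
    also have "expectation (\<lambda>\<omega>. indicator B' (S \<omega>)) = expectation (indicator ?C)"
      by (intro Bochner_Integration.integral_cong) (auto simp: indicator_def)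
    also have "\<dots> = prob ?C" by (rule expectation_indicator_Collect)
    finally show "prob {\<omega> \<in> space M. N (G u \<omega>) \<omega> = k \<and> S \<omega> \<in> B'} = nb_prob p k u * prob {\<omega> \<in> space M. S \<omega> \<in> B'}"
      by (simp add: prob_space)
  qed
  have Zm: "(\<lambda>\<omega>. N (G u \<omega>) \<omega>) \<in> measurable M (count_space UNIV)" if "0 \<le> u" for u
    using law(1)[OF that, of UNIV] by (intro measurable_count_space_eq2_countable[THEN iffD2]) (auto simp: vimage_def Int_def conj_commute)
  have Zrc: "locally_right_constant (\<lambda>s. N (G s \<omega>) \<omega>) s" if "\<omega> \<in> space M" "0 \<le> s" for \<omega> s
    using that by (intro locally_right_constant_compose[where f="\<lambda>s. N s \<omega>" and g="\<lambda>s. G s \<omega>"] pathsG Nrc)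
  have ind: "prob {\<omega> \<in> space M. N (G s \<omega>) \<omega> = k \<and> S \<omega> \<in> B \<and> \<omega> \<in> space M} =
      nb_prob p k s * prob {\<omega> \<in> space M. S \<omega> \<in> B \<and> \<omega> \<in> space M}" if "0 \<le> s" "B \<in> sets borel" for s B
  proof -
    have 1: "{\<omega> \<in> space M. N (G s \<omega>) \<omega> = k \<and> S \<omega> \<in> B \<and> \<omega> \<in> space M} =
        {\<omega> \<in> space M. N (G s \<omega>) \<omega> = k \<and> S \<omega> \<in> B}"
      and 2: "{\<omega> \<in> space M. S \<omega> \<in> B \<and> \<omega> \<in> space M} = {\<omega> \<in> space M. S \<omega> \<in> B}"
      by auto
    show ?thesis unfolding 1 2 by (rule law(2)[OF that])
  qed
  have cont: "continuous_on {0..} (nb_prob p k)"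
    unfolding nb_prob_def[abs_def] by (intro continuous_intros)
  have bd: "\<bar>nb_prob p k s\<bar> \<le> 1" if "0 \<le> s" for s
  proof -
    have "nb_prob p k s = prob {\<omega> \<in> space M. N (G s \<omega>) \<omega> = k}"
      using law(2)[OF that, of UNIV k] by (simp add: prob_space)
    thus ?thesis by simp
  qed
  have "prob {\<omega> \<in> space M. N (G (S \<omega>) \<omega>) \<omega> = k \<and> \<omega> \<in> space M} =
      expectation (\<lambda>\<omega>. nb_prob p k (S \<omega>) * indicator (space M) \<omega>)"
    by (rule process_at_random_time(2)[where X="\<lambda>s \<omega>. N (G s \<omega>) \<omega>" and \<tau>=S and C="space M" and \<psi>="nb_prob p k",
        OF Zm Zrc Sm S0 sets.top ind cont bd])
  moreover have "{\<omega> \<in> space M. N (G (S \<omega>) \<omega>) \<omega> = k \<and> \<omega> \<in> space M} = {\<omega> \<in> space M. N (G (S \<omega>) \<omega>) \<omega> = k}" by auto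
  moreover have "expectation (\<lambda>\<omega>. nb_prob p k (S \<omega>) * indicator (space M) \<omega>) = expectation (\<lambda>\<omega>. nb_prob p k (S \<omega>))"
    by (intro Bochner_Integration.integral_cong) auto
  ultimately show ?thesis by simp
qed

section \<open>The governing equations\<close>


lemma tilt_taylor_funpow: "tilt_taylor lam P (m + n) = (-1) ^ n * tilt_taylor lam ((tilt lam ^^ n) P) m"
  by (simp add: tilt_taylor_def funpow_add power_add)

lemma iterated_caputo_tilted:
  assumes nu: "0 < \<nu>" "\<nu> < 1" and lam: "0 \<le> lam"
    and u: "\<And>t. 0 < t \<Longrightarrow> u t = frac_series \<nu> (tilt_taylor lam P) t"
  shows "caputo_exists \<nu> ((caputo \<nu> ^^ n) u)"
    and "0 < t \<Longrightarrow> (caputo \<nu> ^^ n) u t = (-1) ^ n * frac_series \<nu> (tilt_taylor lam ((tilt lam ^^ n) P)) t"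
proof -
  obtain C R where CR: "0 \<le> C" "0 < R" "\<And>n. \<bar>poly ((tilt lam ^^ n) P) 0\<bar> \<le> C * R ^ n"
    using tilt_coeff_bound[OF lam, of P] by blast
  have b: "\<bar>tilt_taylor lam P (m + n)\<bar> \<le> (C * R ^ n) * R ^ m" for m n
    using CR(3)[of "m + n"] by (simp add: tilt_taylor_def abs_mult power_add mult_ac)
  have it: "\<forall>t>0. (caputo \<nu> ^^ n) u t = frac_series \<nu> (\<lambda>m. tilt_taylor lam P (m + n)) t" for n
  proof (induction n)
    case 0
    then show ?case using u by simp
  next
    case (Suc n)
    have "caputo \<nu> ((caputo \<nu> ^^ n) u) t = frac_series \<nu> (\<lambda>m. tilt_taylor lam P (Suc m + n)) t" if "0 < t" for t
      by (rule caputo_frac_series(2)[OF nu b[of _ n] less_imp_le[OF CR(2)] _ that]) (use Suc in auto)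
    thus ?case by simp
  qed
  show "caputo_exists \<nu> ((caputo \<nu> ^^ n) u)"
    by (rule caputo_frac_series(1)[OF nu b[of _ n] less_imp_le[OF CR(2)]]) (use it in auto)
  assume t: "0 < t"
  have "frac_series \<nu> (\<lambda>m. (-1) ^ n * tilt_taylor lam ((tilt lam ^^ n) P) m) t =
      (-1) ^ n * frac_series \<nu> (tilt_taylor lam ((tilt lam ^^ n) P)) t"
  proof -
    have b': "\<bar>tilt_taylor lam ((tilt lam ^^ n) P) m\<bar> \<le> (C * R ^ n) * R ^ m" for m
      using b[of m n] by (simp add: tilt_taylor_funpow abs_mult)
    show ?thesis
      unfolding frac_series_def
      using suminf_mult[OF frac_series_summable[OF nu(1) b' less_imp_le[OF CR(2)] t], of "(-1) ^ n"]
      by (simp add: mult.assoc)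
  qed
  thus "(caputo \<nu> ^^ n) u t = (-1) ^ n * frac_series \<nu> (tilt_taylor lam ((tilt lam ^^ n) P)) t"
    using it t by (simp add: tilt_taylor_funpow)
qed

lemma iterated_right_rl_tilted:
  assumes nu: "1 < \<nu>" and lam: "0 < lam"
    and u: "\<And>t. 0 < t \<Longrightarrow> u t = powexp_comb (1 / \<nu>) P 0 lam t"
  shows "right_rl_exists \<nu> ((right_rl \<nu> ^^ n) u)"
    and "0 < t \<Longrightarrow> (right_rl \<nu> ^^ n) u t = powexp_comb (1 / \<nu>) ((tilt lam ^^ n) P) 0 lam t"
proof -
  have it: "\<forall>t>0. (right_rl \<nu> ^^ n) u t = powexp_comb (1 / \<nu>) ((tilt lam ^^ n) P) 0 lam t" for n
  proof (induction n)
    case 0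
    then show ?case using u by simp
  next
    case (Suc n)
    have "right_rl \<nu> ((right_rl \<nu> ^^ n) u) t = powexp_comb (1 / \<nu>) ((tilt lam ^^ n) P) (0 + 1) lam t" if "0 < t" for t
      by (rule right_rl_powexp_comb(2)[OF nu lam _ that]) (use Suc in auto)
    thus ?case by (simp add: powexp_comb_exponent_plus_1[OF lam, of _ _ 0, simplified])
  qed
  show "right_rl_exists \<nu> ((right_rl \<nu> ^^ n) u)"
    by (rule right_rl_powexp_comb(1)[OF nu lam]) (use it in auto)
  show "0 < t \<Longrightarrow> (right_rl \<nu> ^^ n) u t = powexp_comb (1 / \<nu>) ((tilt lam ^^ n) P) 0 lam t"
    using it by blast
qed

text \<open>
  The common core of both equations: the exponential series of the tilt produces the factor \<open>1/p\<close> and a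
  unit shift of the negative binomial polynomial.
\<close>

lemma (in prob_space) nb_tilt_sums:
  assumes [measurable]: "S \<in> borel_measurable M" and S: "\<And>\<omega>. \<omega> \<in> space M \<Longrightarrow> 0 \<le> S \<omega>"
    and p: "0 < p" "p < 1"
  defines "lam \<equiv> ln (1 / p)"
  shows "(\<lambda>n. 1 / fact n * expectation (\<lambda>\<omega>. poly ((tilt lam ^^ n) (nb_poly p k)) (S \<omega>) * exp (- lam * S \<omega>))) sums
     (1 / p * expectation (\<lambda>\<omega>. nb_prob p k (S \<omega>))
        - (1 - p) / p * (if k = 0 then 0 else expectation (\<lambda>\<omega>. nb_prob p (k - 1) (S \<omega>))))"
proof -
  define phi where "phi = (\<lambda>Q. expectation (\<lambda>\<omega>. poly Q (S \<omega>) * exp (- lam * S \<omega>)))"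
  have lam: "0 < lam" using p by (simp add: lam_def)
  have int: "integrable M (\<lambda>\<omega>. poly Q (S \<omega>) * exp (- lam * S \<omega>))" for Q
  proof -
    have "integrable M (\<lambda>\<omega>. \<Sum>j\<le>degree Q. coeff Q j * (S \<omega> ^ j * exp (- lam * S \<omega>)))"
      by (intro Bochner_Integration.integrable_sum integrable_mult_right laplace_derivative(1)[OF _ _ lam] S assms(1))
    moreover have "(\<lambda>\<omega>. \<Sum>j\<le>degree Q. coeff Q j * (S \<omega> ^ j * exp (- lam * S \<omega>))) =
        (\<lambda>\<omega>. poly Q (S \<omega>) * exp (- lam * S \<omega>))"
      by (simp add: poly_altdef sum_distrib_right mult.assoc fun_eq_iff)
    ultimately show ?thesis by (simp only:)
  qed
  have add: "phi (P + Q) = phi P + phi Q" for P Q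
    unfolding phi_def poly_add distrib_right using int by (rule Bochner_Integration.integral_add[OF int])
  have sm: "phi (smult a P) = a * phi P" for a P
    unfolding phi_def poly_smult mult.assoc by (rule integral_mult_right_zero)
  have main: "(\<lambda>n. 1 ^ n / fact n * phi ((tilt lam ^^ n) (nb_poly p k))) sums
      (exp (lam * 1) * phi (pcompose (nb_poly p k) [:-1, 1:]))"
    by (rule tilt_exp_shift[OF add sm])
  have e1: "exp (lam * 1) = 1 / p" using p by (simp add: lam_def)
  have e2: "phi (pcompose (nb_poly p k) [:-1, 1:]) =
      phi (nb_poly p k) - (1 - p) * (if k = 0 then 0 else phi (nb_poly p (k - 1)))"
  proof (cases "k = 0")
    case False
    hence "pcompose (nb_poly p k) [:-1, 1:] = nb_poly p k + smult (-(1 - p)) (nb_poly p (k - 1))"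
      by (simp add: nb_poly_shift flip: smult_minus_left)
    thus ?thesis using False by (simp add: add sm left_diff_distrib del: smult_minus_left)
  qed (simp add: nb_poly_shift)
  have e3: "expectation (\<lambda>\<omega>. nb_prob p k (S \<omega>)) = phi (nb_poly p k)" for k
    by (simp add: phi_def nb_prob_def lam_def)
  have "(\<lambda>n. 1 / fact n * phi ((tilt lam ^^ n) (nb_poly p k))) sums
     (1 / p * phi (nb_poly p k) - (1 - p) / p * (if k = 0 then 0 else phi (nb_poly p (k - 1))))"
    using main e1 unfolding e2 by (simp add: right_diff_distrib)
  thus ?thesis unfolding e3 unfolding phi_def .
qed

text \<open>
  The path is positive immediately after time \<open>0\<close>, so level \<open>0\<close> is exceeded at once.
\<close>

lemma (in prob_space) inverse_stable_at_0:
  assumes A: "stable_subordinator M \<nu> A" and nu: "0 < \<nu>"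
  shows "AE \<omega> in M. inverse_process A 0 \<omega> = 0"
proof -
  have "AE \<omega> in M. \<forall>n. 0 < A (1 / real (Suc n)) \<omega>"
    by (subst AE_all_countable) (intro allI stable_positive[OF A nu], simp)
  thus ?thesis
  proof eventually_elim
    fix \<omega> assume pos: "\<forall>n. 0 < A (1 / real (Suc n)) \<omega>"
    have "inverse_process A 0 \<omega> \<le> 1 / real (Suc n)" for n
      using inverse_process_less_imp[of "1 / real (Suc n)" A 0 \<omega>] pos[rule_format, of n] by fastforce
    hence "inverse_process A 0 \<omega> \<le> 0"
      using reals_Archimedean[of "inverse_process A 0 \<omega>"] by (force simp: inverse_eq_divide not_less[symmetric])
    thus "inverse_process A 0 \<omega> = 0" using inverse_process_nonneg[of A 0 \<omega>] by simp
  qed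
qed

lemma (in prob_space) frac_nb_state_prob:
  assumes N: "poisson_process M 1 N" and G: "gamma_subordinator M (p / (1 - p)) G" and p: "0 < p" "p < 1"
    and A: "subordinator M A" and indep: "indep_processes M [\<lambda>t \<omega>. real (N t \<omega>), G, A]"
  shows "state_prob M (frac_nb N G A) (int k) t = expectation (\<lambda>\<omega>. nb_prob p k (inverse_process A t \<omega>))"
    and "0 \<le> t \<Longrightarrow> state_prob M (frac_nb_bar N G A) (int k) t = expectation (\<lambda>\<omega>. nb_prob p k (A t \<omega>))"
proof -
  show "state_prob M (frac_nb N G A) (int k) t = expectation (\<lambda>\<omega>. nb_prob p k (inverse_process A t \<omega>))"
    unfolding state_prob_def frac_nb_def frac_gamma_def of_nat_eq_iff
    by (rule negative_binomial_at_random_time[OF N G p indep first_exceedance_measurable[of t]])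
       (simp_all add: inverse_process_eq_first_exceedance[OF A] inverse_process_measurable[OF A] inverse_process_nonneg
          flip: inverse_process_eq_first_exceedance[OF A])
  assume t: "0 \<le> t"
  have m: "(\<lambda>a. a t) \<in> borel_measurable (Pi\<^sub>M {0..} (\<lambda>_. borel :: real measure))"
    using t by (intro measurable_component_singleton) auto
  show "state_prob M (frac_nb_bar N G A) (int k) t = expectation (\<lambda>\<omega>. nb_prob p k (A t \<omega>))"
    unfolding state_prob_def frac_nb_bar_def frac_gamma_bar_def of_nat_eq_iff
    by (rule negative_binomial_at_random_time[OF N G p indep m])
       (use t subordinator_paths[OF A] in auto)
qed

lemma state_prob_negative: "k < 0 \<Longrightarrow> state_prob M X k t = 0"
  by (simp add: state_prob_def)

theorem theorem14:
  fixes M :: "'a measure"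
    and N :: "real \<Rightarrow> 'a \<Rightarrow> nat"
    and G :: "real \<Rightarrow> 'a \<Rightarrow> real"
    and p :: real
  assumes "prob_space M"
    and "0 < p" and "p < 1"
    and "poisson_process M 1 N"
    and "gamma_subordinator M (p / (1 - p)) G"
  shows
    "(\<forall>(\<nu>::real) (A :: real \<Rightarrow> 'a \<Rightarrow> real).
        0 < \<nu> \<and> \<nu> < 1 \<and> stable_subordinator M \<nu> A \<and>
        indep_processes M [\<lambda>t \<omega>. real (N t \<omega>), G, A] \<longrightarrow>
        (let q = state_prob M (frac_nb N G A) in
          (\<forall>k\<ge>0. \<forall>t>1.
             shift_op_defined \<nu> (-1) (q k) t \<and>
             shift_op \<nu> (-1) (q k) t = 1 / p * q k t - (1 - p) / p * q (k - 1) t) \<and>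
          q 0 0 = 1 \<and> (\<forall>k>0. q k 0 = 0) \<and> (\<forall>t. q (-1) t = 0))) \<and>
     (\<forall>(\<nu>::real) (A :: real \<Rightarrow> 'a \<Rightarrow> real).
        1 < \<nu> \<and> stable_subordinator M (1 / \<nu>) A \<and>
        indep_processes M [\<lambda>t \<omega>. real (N t \<omega>), G, A] \<longrightarrow>
        (let q = state_prob M (frac_nb_bar N G A) in
          (\<forall>k\<ge>0. \<forall>t>1.
             shift_op_bar_defined \<nu> (-1) (q k) t \<and>
             shift_op_bar \<nu> (-1) (q k) t = 1 / p * q k t - (1 - p) / p * q (k - 1) t) \<and>
          q 0 0 = 1 \<and> (\<forall>k>0. q k 0 = 0) \<and> (\<forall>t. q (-1) t = 0)))"
proof (intro conjI allI impI)
  interpret prob_space M by fact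
  note p = \<open>0 < p\<close> \<open>p < 1\<close>
  define lam where "lam = ln (1 / p)"
  have lam: "0 < lam" using p by (simp add: lam_def)
  have prev: "state_prob M X (int k - 1) t = (if k = 0 then 0 else state_prob M X (int (k - 1)) t)" for X k t
    by (cases k) (simp_all add: state_prob_negative)
  {
    fix \<nu> :: real and A :: "real \<Rightarrow> 'a \<Rightarrow> real"
    assume as: "0 < \<nu> \<and> \<nu> < 1 \<and> stable_subordinator M \<nu> A \<and> indep_processes M [\<lambda>t \<omega>. real (N t \<omega>), G, A]"
    hence nu: "0 < \<nu>" "\<nu> < 1" and A: "stable_subordinator M \<nu> A"
      and indep: "indep_processes M [\<lambda>t \<omega>. real (N t \<omega>), G, A]" by blast+
    have sub: "subordinator M A" using A by (simp add: stable_subordinator_def)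
    define q where "q = state_prob M (frac_nb N G A)"
    have q: "q (int k) t = expectation (\<lambda>\<omega>. nb_prob p k (inverse_process A t \<omega>))" for k t
      unfolding q_def by (rule frac_nb_state_prob(1)[OF assms(4,5) p sub indep])
    have E: "expectation (\<lambda>\<omega>. poly P (inverse_process A t \<omega>) * exp (- lam * inverse_process A t \<omega>)) =
        frac_series \<nu> (tilt_taylor lam P) t" if "0 < t" for P t
      using inverse_stable_tilted_poly[OF A nu(1) that] lam by simp
    have prevq: "q (int k - 1) t = (if k = 0 then 0 else q (int (k - 1)) t)" for k t
      unfolding q_def by (rule prev)
    have eqn: "shift_op_defined \<nu> (-1) (q (int k)) t \<and>
        shift_op \<nu> (-1) (q (int k)) t = 1 / p * q (int k) t - (1 - p) / p * q (int k - 1) t" if t: "0 < t" for k t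
    proof -
      have u: "q (int k) t = frac_series \<nu> (tilt_taylor lam (nb_poly p k)) t" if "0 < t" for t
        using E[OF that, of "nb_poly p k"] by (simp add: q nb_prob_def lam_def)
      have ex: "caputo_exists \<nu> ((caputo \<nu> ^^ n) (q (int k)))" for n
        by (rule iterated_caputo_tilted(1)[OF nu less_imp_le[OF lam]]) (rule u)
      have it: "(caputo \<nu> ^^ n) (q (int k)) t = (-1) ^ n * frac_series \<nu> (tilt_taylor lam ((tilt lam ^^ n) (nb_poly p k))) t" for n
        by (rule iterated_caputo_tilted(2)[OF nu less_imp_le[OF lam] _ t]) (rule u)
      have base: "(\<lambda>n. 1 / fact n * expectation (\<lambda>\<omega>. poly ((tilt lam ^^ n) (nb_poly p k)) (inverse_process A t \<omega>) * exp (- lam * inverse_process A t \<omega>))) sums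
         (1 / p * expectation (\<lambda>\<omega>. nb_prob p k (inverse_process A t \<omega>))
            - (1 - p) / p * (if k = 0 then 0 else expectation (\<lambda>\<omega>. nb_prob p (k - 1) (inverse_process A t \<omega>))))"
        unfolding lam_def by (rule nb_tilt_sums[OF inverse_process_measurable[OF sub] inverse_process_nonneg p])
      have eq: "(-1) ^ n / fact n * (caputo \<nu> ^^ n) (q (int k)) t = 1 / fact n *
          expectation (\<lambda>\<omega>. poly ((tilt lam ^^ n) (nb_poly p k)) (inverse_process A t \<omega>) * exp (- lam * inverse_process A t \<omega>))" for n
        unfolding E[OF t] it by simp
      have "(\<lambda>n. (-1) ^ n / fact n * (caputo \<nu> ^^ n) (q (int k)) t) sums
          (1 / p * q (int k) t - (1 - p) / p * q (int k - 1) t)"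
        unfolding eq prevq q by (rule base)
      thus ?thesis
        using ex by (simp add: shift_op_defined_def shift_op_def sums_iff)
    qed
    have q0: "q (int k) 0 = (if k = 0 then 1 else 0)" for k
    proof -
      have "q (int k) 0 = expectation (\<lambda>\<omega>. nb_prob p k 0)"
        unfolding q
      proof (rule integral_cong_AE)
        show "AE \<omega> in M. nb_prob p k (inverse_process A 0 \<omega>) = nb_prob p k 0"
          using inverse_stable_at_0[OF A nu(1)] by eventually_elim simp
        have [measurable]: "nb_prob p k \<in> borel_measurable borel"
          unfolding nb_prob_def[abs_def] by (intro borel_measurable_continuous_onI continuous_intros)
        show "(\<lambda>\<omega>. nb_prob p k (inverse_process A 0 \<omega>)) \<in> borel_measurable M"
          using inverse_process_measurable[OF sub] by measurable
      qed simp
      thus ?thesis by (simp add: nb_prob_0 prob_space)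
    qed
    show "let q = state_prob M (frac_nb N G A) in
          (\<forall>k\<ge>0. \<forall>t>1.
             shift_op_defined \<nu> (-1) (q k) t \<and>
             shift_op \<nu> (-1) (q k) t = 1 / p * q k t - (1 - p) / p * q (k - 1) t) \<and>
          q 0 0 = 1 \<and> (\<forall>k>0. q k 0 = 0) \<and> (\<forall>t. q (-1) t = 0)"
      unfolding Let_def q_def[symmetric]
    proof (intro conjI allI impI)
      fix k :: int and t :: real assume "0 \<le> k" "1 < t"
      thus "shift_op_defined \<nu> (-1) (q k) t"
        "shift_op \<nu> (-1) (q k) t = 1 / p * q k t - (1 - p) / p * q (k - 1) t"
        using eqn[of t "nat k"] by simp_all
    next
      show "q 0 0 = 1" using q0[of 0] by simp
      show "q k 0 = 0" if "0 < k" for k using q0[of "nat k"] that by simp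
      show "q (-1) t = 0" for t by (simp add: q_def state_prob_negative)
    qed
  next
    fix \<nu> :: real and A :: "real \<Rightarrow> 'a \<Rightarrow> real"
    assume as: "1 < \<nu> \<and> stable_subordinator M (1 / \<nu>) A \<and> indep_processes M [\<lambda>t \<omega>. real (N t \<omega>), G, A]"
    hence nu: "1 < \<nu>" and A: "stable_subordinator M (1 / \<nu>) A"
      and indep: "indep_processes M [\<lambda>t \<omega>. real (N t \<omega>), G, A]" by blast+
    have sub: "subordinator M A" using A by (simp add: stable_subordinator_def)
    note paths = subordinator_paths[OF sub]
    define q where "q = state_prob M (frac_nb_bar N G A)"
    have q: "q (int k) t = expectation (\<lambda>\<omega>. nb_prob p k (A t \<omega>))" if "0 \<le> t" for k t
      unfolding q_def by (rule frac_nb_state_prob(2)[OF assms(4,5) p sub indep that])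
    have E: "expectation (\<lambda>\<omega>. poly P (A t \<omega>) * exp (- lam * A t \<omega>)) = powexp_comb (1 / \<nu>) P 0 lam t"
      if "0 < t" for P t
      by (rule stable_tilted_poly) (use that paths stable_laplace[OF A] lam in auto)
    have prevq: "q (int k - 1) t = (if k = 0 then 0 else q (int (k - 1)) t)" for k t
      unfolding q_def by (rule prev)
    have eqn: "shift_op_bar_defined \<nu> (-1) (q (int k)) t \<and>
        shift_op_bar \<nu> (-1) (q (int k)) t = 1 / p * q (int k) t - (1 - p) / p * q (int k - 1) t" if t: "0 < t" for k t
    proof -
      have u: "q (int k) t = powexp_comb (1 / \<nu>) (nb_poly p k) 0 lam t" if "0 < t" for t
        using E[OF that, of "nb_poly p k"] that by (simp add: q nb_prob_def lam_def)
      have ex: "right_rl_exists \<nu> ((right_rl \<nu> ^^ n) (q (int k)))" for n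
        by (rule iterated_right_rl_tilted(1)[OF nu lam]) (rule u)
      have it: "(right_rl \<nu> ^^ n) (q (int k)) t = powexp_comb (1 / \<nu>) ((tilt lam ^^ n) (nb_poly p k)) 0 lam t" for n
        by (rule iterated_right_rl_tilted(2)[OF nu lam _ t]) (rule u)
      have base: "(\<lambda>n. 1 / fact n * expectation (\<lambda>\<omega>. poly ((tilt lam ^^ n) (nb_poly p k)) (A t \<omega>) * exp (- lam * A t \<omega>))) sums
         (1 / p * expectation (\<lambda>\<omega>. nb_prob p k (A t \<omega>))
            - (1 - p) / p * (if k = 0 then 0 else expectation (\<lambda>\<omega>. nb_prob p (k - 1) (A t \<omega>))))"
        unfolding lam_def by (rule nb_tilt_sums) (use p t paths in auto)
      have eq: "(- (-1)) ^ n / fact n * (right_rl \<nu> ^^ n) (q (int k)) t = 1 / fact n *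
          expectation (\<lambda>\<omega>. poly ((tilt lam ^^ n) (nb_poly p k)) (A t \<omega>) * exp (- lam * A t \<omega>))" for n
        unfolding E[OF t] it by simp
      have "(\<lambda>n. (- (-1)) ^ n / fact n * (right_rl \<nu> ^^ n) (q (int k)) t) sums
          (1 / p * q (int k) t - (1 - p) / p * q (int k - 1) t)"
        unfolding eq prevq q[OF less_imp_le[OF t]] by (rule base)
      thus ?thesis
        using ex by (simp add: shift_op_bar_defined_def shift_op_bar_def sums_iff)
    qed
    have q0: "q (int k) 0 = (if k = 0 then 1 else 0)" for k
    proof -
      have "q (int k) 0 = expectation (\<lambda>\<omega>. nb_prob p k 0)"
        unfolding q[OF order_refl] by (intro Bochner_Integration.integral_cong) (simp_all add: paths(2))
      thus ?thesis by (simp add: nb_prob_0 prob_space)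
    qed
    show "let q = state_prob M (frac_nb_bar N G A) in
          (\<forall>k\<ge>0. \<forall>t>1.
             shift_op_bar_defined \<nu> (-1) (q k) t \<and>
             shift_op_bar \<nu> (-1) (q k) t = 1 / p * q k t - (1 - p) / p * q (k - 1) t) \<and>
          q 0 0 = 1 \<and> (\<forall>k>0. q k 0 = 0) \<and> (\<forall>t. q (-1) t = 0)"
      unfolding Let_def q_def[symmetric]
    proof (intro conjI allI impI)
      fix k :: int and t :: real assume "0 \<le> k" "1 < t"
      thus "shift_op_bar_defined \<nu> (-1) (q k) t"
        "shift_op_bar \<nu> (-1) (q k) t = 1 / p * q k t - (1 - p) / p * q (k - 1) t"
        using eqn[of t "nat k"] by simp_all
    next
      show "q 0 0 = 1" using q0[of 0] by simp
      show "q k 0 = 0" if "0 < k" for k using q0[of "nat k"] that by simp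
      show "q (-1) t = 0" for t by (simp add: q_def state_prob_negative)
    qed
  }
qed

end
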